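(* Let $k$ be a number field. Then there exist smooth cubic surfaces $S \subset \mathbb{P}^3_k$ over $k$ which fail the Hasse principle for lines; that is, $S$ contains no line defined over $k$, but for every place $v$ of $k$ the surface $S_{k_v}$ contains a line defined over the completion $k_v$.
   Context: Places of $k$ include the archimedean ones; $k_v$ denotes the completion of $k$ at $v$. A line on a cubic surface $S\subset\mathbb{P}^3$ over a field $F$ is a line of $\mathbb{P}^3_F$ (a linear subspace of dimension $1$ defined over $F$) contained in $S_F$. *)

theory Defs
  imports
    Complex_Main
    "HOL-Library.Poly_Mapping"
    "HOL-Library.Numeral_Type"
    "HOL-Algebra.QuotRing"
    "HOL-Algebra.Algebraic_Closure_Type"
begin

section \<open>Number fields, places and completions\<close>

definition number_field :: "'k::field_char_0 itself \<Rightarrow> bool" where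
  "number_field _ \<longleftrightarrow>
     (\<exists>B::'k set. finite B \<and> module.span (\<lambda>(r::rat) (x::'k). of_rat r * x) B = UNIV)"

text \<open>The trivial absolute value is excluded, as it does not define a place.\<close>

definition absolute_value :: "('k::field \<Rightarrow> real) \<Rightarrow> bool" where
  "absolute_value v \<longleftrightarrow>
     (\<forall>x. 0 \<le> v x) \<and> (\<forall>x. v x = 0 \<longleftrightarrow> x = 0) \<and>
     (\<forall>x y. v (x * y) = v x * v y) \<and>
     (\<forall>x y. v (x + y) \<le> v x + v y) \<and>
     (\<exists>x. x \<noteq> 0 \<and> v x \<noteq> 1)"

definition absolute_value_equiv :: "(('k::field \<Rightarrow> real) \<times> ('k \<Rightarrow> real)) set" where
  "absolute_value_equiv =
     {(v, w). absolute_value v \<and> absolute_value w \<and> (\<exists>s>0. \<forall>x. w x = v x powr s)}"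

definition places :: "('k::field \<Rightarrow> real) set set" where
  "places = {v. absolute_value v} // absolute_value_equiv"

definition cauchy_wrt :: "('k::field \<Rightarrow> real) \<Rightarrow> (nat \<Rightarrow> 'k) \<Rightarrow> bool" where
  "cauchy_wrt v s \<longleftrightarrow> (\<forall>e>0. \<exists>N. \<forall>m\<ge>N. \<forall>n\<ge>N. v (s m - s n) < e)"

definition cauchy_ring :: "('k::field \<Rightarrow> real) \<Rightarrow> (nat \<Rightarrow> 'k) ring" where
  "cauchy_ring v =
     \<lparr>carrier = {s. cauchy_wrt v s},
      monoid.mult = (\<lambda>s t n. s n * t n), one = (\<lambda>n. 1),
      ring.zero = (\<lambda>n. 0), add = (\<lambda>s t n. s n + t n)\<rparr>"

definition null_sequences :: "('k::field \<Rightarrow> real) \<Rightarrow> (nat \<Rightarrow> 'k) set" where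
  "null_sequences v = {s. (\<lambda>n. v (s n)) \<longlonglongrightarrow> 0}"

text \<open>
  Equivalent absolute values have the same Cauchy sequences and the same null sequences, so
  the completion below depends only on the place that \<open>v\<close> represents.
\<close>

definition completion :: "('k::field \<Rightarrow> real) \<Rightarrow> (nat \<Rightarrow> 'k) set ring" where
  "completion v = cauchy_ring v Quot null_sequences v"

definition to_completion :: "('k::field \<Rightarrow> real) \<Rightarrow> 'k \<Rightarrow> (nat \<Rightarrow> 'k) set" where
  "to_completion v x = null_sequences v +>\<^bsub>cauchy_ring v\<^esub> (\<lambda>n. x)"


section \<open>Cubic surfaces and lines\<close>

text \<open>
  Polynomials in four variables over a type \<open>'k\<close> are finitely supported maps from exponent
  vectors \<open>4 \<Rightarrow>\<^sub>0 nat\<close> to \<open>'k\<close>.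
\<close>

definition cubic_form :: "((4 \<Rightarrow>\<^sub>0 nat) \<Rightarrow>\<^sub>0 'k::field) \<Rightarrow> bool" where
  "cubic_form F \<longleftrightarrow>
     F \<noteq> 0 \<and> (\<forall>m\<in>Poly_Mapping.keys F. (\<Sum>i\<in>UNIV. Poly_Mapping.lookup m i) = 3)"

definition partial_deriv ::
    "4 \<Rightarrow> ((4 \<Rightarrow>\<^sub>0 nat) \<Rightarrow>\<^sub>0 'k::field) \<Rightarrow> ((4 \<Rightarrow>\<^sub>0 nat) \<Rightarrow>\<^sub>0 'k)" where
  "partial_deriv i F =
     (\<Sum>m\<in>Poly_Mapping.keys F.
        Poly_Mapping.single (m - Poly_Mapping.single i 1)
          (of_nat (Poly_Mapping.lookup m i) * Poly_Mapping.lookup F m))"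

text \<open>
  The value of \<open>F\<close> at a point with coordinates in an extension field \<open>K\<close> of the coefficient
  field, the extension being given by an embedding \<open>\<phi>\<close>.
\<close>

definition eval_form ::
    "'c ring \<Rightarrow> ('k \<Rightarrow> 'c) \<Rightarrow> ((4 \<Rightarrow>\<^sub>0 nat) \<Rightarrow>\<^sub>0 'k::field) \<Rightarrow> (4 \<Rightarrow> 'c) \<Rightarrow> 'c" where
  "eval_form K \<phi> F x =
     (\<Oplus>\<^bsub>K\<^esub>m\<in>Poly_Mapping.keys F.
        \<phi> (Poly_Mapping.lookup F m) \<otimes>\<^bsub>K\<^esub>
        (\<Otimes>\<^bsub>K\<^esub>i\<in>(UNIV :: 4 set). x i [^]\<^bsub>K\<^esub> Poly_Mapping.lookup m i))"

text \<open>The Jacobian criterion, tested on the points over an algebraic closure.\<close>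

definition smooth_surface :: "((4 \<Rightarrow>\<^sub>0 nat) \<Rightarrow>\<^sub>0 'k::field) \<Rightarrow> bool" where
  "smooth_surface F \<longleftrightarrow>
     \<not> (\<exists>x :: 4 \<Rightarrow> 'k alg_closure. (\<exists>i. x i \<noteq> 0) \<and>
          eval_form ring_of_type_algebra to_ac F x = 0 \<and>
          (\<forall>i. eval_form ring_of_type_algebra to_ac (partial_deriv i F) x = 0))"

text \<open>
  A line of projective 3-space over \<open>K\<close>, as the two-dimensional linear subspace of \<open>K\<^sup>4\<close> that it is the
  projectivization of.
\<close>

definition projective_line :: "'c ring \<Rightarrow> (4 \<Rightarrow> 'c) set \<Rightarrow> bool" where
  "projective_line K L \<longleftrightarrow>
     (\<exists>p\<in>UNIV \<rightarrow> carrier K. \<exists>q\<in>UNIV \<rightarrow> carrier K.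
        (\<forall>s\<in>carrier K. \<forall>t\<in>carrier K.
           (\<forall>i. s \<otimes>\<^bsub>K\<^esub> p i \<oplus>\<^bsub>K\<^esub> t \<otimes>\<^bsub>K\<^esub> q i = \<zero>\<^bsub>K\<^esub>) \<longrightarrow> s = \<zero>\<^bsub>K\<^esub> \<and> t = \<zero>\<^bsub>K\<^esub>) \<and>
        L = {(\<lambda>i. s \<otimes>\<^bsub>K\<^esub> p i \<oplus>\<^bsub>K\<^esub> t \<otimes>\<^bsub>K\<^esub> q i) | s t. s \<in> carrier K \<and> t \<in> carrier K})"

text \<open>
  Containment is tested on \<open>K\<close>-points. This agrees with containment of closed subschemes when
  \<open>K\<close> is infinite, in particular in characteristic \<open>0\<close>.
\<close>

definition contains_line :: "'c ring \<Rightarrow> ('k \<Rightarrow> 'c) \<Rightarrow> ((4 \<Rightarrow>\<^sub>0 nat) \<Rightarrow>\<^sub>0 'k::field) \<Rightarrow> bool" where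
  "contains_line K \<phi> F \<longleftrightarrow>
     (\<exists>L. projective_line K L \<and> (\<forall>x\<in>L. eval_form K \<phi> F x = \<zero>\<^bsub>K\<^esub>))"

end

theory Submission
  imports Defs
begin

text \<open>
  Let \<open>e\<close> be a non-square of \<open>k\<close>, \<open>r\<^sup>2 = e\<close>, and let \<open>\<theta>\<close> run through the roots of a quintic \<open>f\<close>. Blowing up
  the quadric \<open>R\<^bsub>k(r)/k\<^esub> P\<^sup>1\<close> in the closed point \<open>\<theta> + r \<theta>\<^sup>2\<close> of degree 5 gives a cubic surface. If no
  nonzero polynomial of degree below 5 over \<open>k\<close> vanishes at a root of \<open>f\<close>, then the surface is smooth and
  has no line over \<open>k\<close>; but it has two skew lines over \<open>k(r)\<close> and a line over \<open>k(\<theta>)\<close> for every root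
  \<open>\<theta>\<close>. It therefore suffices that in every completion \<open>e\<close> becomes a square or \<open>f\<close> acquires a root.
  This is arranged by a quintic with dihedral or Frobenius Galois group whose 5-cycles act trivially on \<open>r\<close>.

  If \<open>k\<close> contains no primitive fifth root of unity, take \<open>f = t\<^sup>5 - a\<close> and \<open>r\<close> in the fifth cyclotomic
  extension, where \<open>a\<close> is an iterated fifth root of \<open>\<Phi>\<^sub>5(n)\<close> with \<open>n\<close> highly divisible by 5. A completion
  without a fifth root of unity lies over 5, where \<open>\<Phi>\<^sub>5(n)\<close> is close to 1, or is real, or \<open>a\<close> is a unit
  and the fifth power map is injective, hence bijective, on residues. If \<open>k\<close> contains a fifth root of
  unity, take \<open>f = D\<^sub>5(t) - a\<close> with the Dickson polynomial \<open>D\<^sub>5(u + 1/u) = u\<^sup>5 + 1/u\<^sup>5\<close> and \<open>e\<close> in the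
  class of \<open>a\<^sup>2 - 4\<close>: where this is a non-square, the fifth power map is bijective on the norm one group
  of the residue fields. In both cases \<open>a\<close> is the last term in a chain of iterated preimages of a rational
  number; the chain ends because an Eisenstein polynomial of degree \<open>5\<^sup>N\<close> has no root in a field of
  smaller degree.
\<close>

section \<open>The cubic form and its lines\<close>

text \<open>A cubic form that vanishes on the two skew lines \<open>p = q = 0\<close> and its
  conjugate is a sum of parts of bidegree (2, 1) and (1, 2) in \<open>(p, q)\<close> and its
  conjugate. A form of bidegree (2, 1) has six coefficients, so one passes through the five points;
  \<open>surf\<close> is, up to a scalar, this form plus its conjugate. The choice of \<theta> + r
  \<theta>^2 for the point makes incidence of a line over k with the line of \<theta> a polynomial
  condition of degree 4 in \<theta>, just below the degree of the quintic. In a Frobenius or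
  dihedral group an element that fixes no root is a 5-cycle, and 5-cycles fix r. Hence cyclic
  decomposition groups do no harm; the obstacle is the ramified places, where the group can be
  larger, and the constants are chosen with these in view. As k is arbitrary, no fixed rational
  number can serve as \<open>a\<close>: it may be a fifth power in k. Passing to preimages repairs
  this, because what the local arguments ask of \<open>a\<close> can be deduced from the rational
  number at the start of the chain. The parameter \<open>c\<close> treats both cases at once: c = 0
  gives t^5 - a and c = 1 gives D_5(t) - a.\<close>

definition surf :: "'a::field \<Rightarrow> 'a \<Rightarrow> 'a \<Rightarrow> 'a \<Rightarrow> 'a \<Rightarrow> 'a \<Rightarrow> 'a \<Rightarrow> 'a" where
  "surf e a c x0 x1 x2 x3 =
     - (e * a * x0 * x2^2) - e * a * x2^2 * x3 + e^2 * a * x3^3 + e^2 * a * x1 * x2 * x3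
     + 5 * c^2 * e * x1 * x2^2 - 5 * c^2 * e^2 * x1 * x3^2 + (1 - 5 * c * e) * x1^2 * x2
     - (1 - 5 * c * e) * x0 * x1 * x3 - x0^2 * x1 + e * x1^3"

definition cosurf :: "'a::field \<Rightarrow> 'a \<Rightarrow> 'a \<Rightarrow> 'a \<Rightarrow> 'a \<Rightarrow> 'a \<Rightarrow> 'a \<Rightarrow> 'a" where
  "cosurf e a c x0 x1 x2 x3 =
     - (e * a * x2 * (x2^2 - e * x3^2)) + 5 * c^2 * e * x0 * (x2^2 - e * x3^2)
     - e^2 * a * x0 * x2 * x3 + e^3 * a * x1 * x3^2
     + (1 - 5 * c * e) * x0 * (x1 * x2 - x0 * x3) - x0 * (x0^2 - e * x1^2)"

definition quintic :: "'a::field \<Rightarrow> 'a \<Rightarrow> 'a \<Rightarrow> 'a" where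
  "quintic c a t = t^5 - 5 * c * t^3 + 5 * c^2 * t - a"

text \<open>
  With \<open>r\<^sup>2 = e\<close>, \<open>p = x0 + r x1\<close> and \<open>q = x2 + r x3\<close>, \<open>bi21\<close> is a form of bidegree \<open>(2, 1)\<close> in \<open>(p, q)\<close> and its
  conjugate; it and its conjugate cut out the five points \<open>p / q = \<theta> + r \<theta>\<^sup>2\<close>, and \<open>surf\<close> and \<open>cosurf\<close>
  are its two components over the field that contains \<open>e\<close>.
\<close>

definition bi21 :: "'a::field \<Rightarrow> 'a \<Rightarrow> 'a \<Rightarrow> 'a \<Rightarrow> 'a \<Rightarrow> 'a \<Rightarrow> 'a \<Rightarrow> 'a" where
  "bi21 r a c x z y v =
     - (2 * r^3 * a * z^2 * v) + (10 * c^2 * r^3 - r^4 * a) * x * z * v - r^4 * a * z^2 * y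
     - (1 - 5 * c * r^2) * x * y * z + (1 - 5 * c * r^2) * x^2 * v - 2 * r * x^2 * y"

lemma bi21_surf:
  "bi21 r a c (x0 + r * x1) (x2 + r * x3) (x0 - r * x1) (x2 - r * x3) =
     2 * r^2 * surf (r^2) a c x0 x1 x2 x3 + 2 * r * cosurf (r^2) a c x0 x1 x2 x3"
  unfolding bi21_def surf_def cosurf_def by Groebner_Basis.algebra

lemma bi21_surf_conj:
  "bi21 (-r) a c (x0 - r * x1) (x2 - r * x3) (x0 + r * x1) (x2 + r * x3) =
     2 * r^2 * surf (r^2) a c x0 x1 x2 x3 - 2 * r * cosurf (r^2) a c x0 x1 x2 x3"
  unfolding bi21_def surf_def cosurf_def by Groebner_Basis.algebra

lemma numeral_cancel: "numeral k * x = numeral k * y \<Longrightarrow> x = (y :: 'a :: field_char_0)"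
  by simp

text \<open>The points with \<open>p / q\<close> infinite have to be excluded before dividing; there
  the two forms leave only the line on which the conjugate pair vanishes.\<close>

lemma bi21_zero_infinity:
  fixes x :: "'a::field_char_0"
  assumes "bi21 r a c x 0 y v = 0" "bi21 (-r) a c y v x 0 = 0" "r \<noteq> 0" "a \<noteq> 0" "x \<noteq> 0"
  shows "y = 0 \<and> v = 0"
proof -
  have "x^2 * ((1 - 5 * c * r^2) * v - 2 * r * y) = 0"
    using assms(1) unfolding bi21_def power_zero_numeral mult_zero_left mult_zero_right
    by Groebner_Basis.algebra
  then have *: "(1 - 5 * c * r^2) * v = 2 * r * y" using assms(5) by simp
  have "x * (- (r^4 * a * v^2) - y * ((1 - 5 * c * r^2) * v - 2 * r * y)) = 0"
    using assms(2) unfolding bi21_def power_zero_numeral mult_zero_left mult_zero_right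
    by Groebner_Basis.algebra
  then have "r^4 * a * v^2 = 0" using assms(5) * by simp
  then have "v = 0" using assms(3,4) by simp
  then show ?thesis using * assms(3) by simp
qed

text \<open>The point is written as \<open>p / q = u + r * w\<close>. Both equations then involve
  only \<open>g1\<close>, \<open>g2\<close> and \<open>D\<close>, and
  \<open>w * g1 - u * g2 = a * D\<close>, which forces \<open>D = 0\<close>: the point lies on the
  parabola \<open>w = u^2\<close>, where \<open>g1\<close> becomes the quintic.\<close>

lemma bi21_zero_affine:
  fixes u w :: "'a::field_char_0"
  assumes "bi21 r a c (u + r * w) 1 (u - r * w) 1 = 0" "bi21 (-r) a c (u - r * w) 1 (u + r * w) 1 = 0"
    "r \<noteq> 0" "a \<noteq> 0"
  shows "w = u^2 \<and> quintic c a u = 0"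
proof -
  define D where "D = u^2 - w"
  define g1 where "g1 = u * w^2 - 5 * c * u * w + 5 * c^2 * u - a"
  define g2 where "g2 = w^3 - 5 * c * w^2 + 5 * c^2 * w - a * u"
  have s: "bi21 r a c (u + r * w) 1 (u - r * w) 1 = 2 * r^2 * (r^2 * g2 - w * D) + 2 * r * (r^2 * g1 - u * D)"
    unfolding bi21_def D_def g1_def g2_def power_one mult_1_right by Groebner_Basis.algebra
  have s': "bi21 (-r) a c (u - r * w) 1 (u + r * w) 1 = 2 * r^2 * (r^2 * g2 - w * D) - 2 * r * (r^2 * g1 - u * D)"
    unfolding bi21_def D_def g1_def g2_def power_one mult_1_right by Groebner_Basis.algebra
  have "2 * 2 * r^2 * (r^2 * g2 - w * D) = 0" "2 * 2 * r * (r^2 * g1 - u * D) = 0"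
    using s s' assms(1,2) by Groebner_Basis.algebra+
  then have 1: "r^2 * g2 = w * D" "r^2 * g1 = u * D" using assms(3) by simp_all
  have "r^2 * a * D = w * (r^2 * g1) - u * (r^2 * g2)"
    unfolding D_def g1_def g2_def by Groebner_Basis.algebra
  also have "\<dots> = 0" unfolding 1 by Groebner_Basis.algebra
  finally have D: "D = 0" using assms(3,4) by simp
  then have w: "w = u^2" by (simp add: D_def)
  have "g1 = 0" using 1(2) D assms(3) by simp
  then have "quintic c a u = 0" unfolding g1_def w quintic_def by Groebner_Basis.algebra
  with w show ?thesis by simp
qed

lemma bi21_homogeneous:
  "bi21 r a c (s * x) (s * z) (t * y) (t * v) = s^2 * t * bi21 r a c x z y v"
  unfolding bi21_def by Groebner_Basis.algebra

text \<open>The common zeros of the two bihomogeneous parts. Off the two skew lines they lie over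
  points of P^1 x P^1 common to curves of bidegrees (2, 1) and (1, 2), whose intersection number is
  2 * 2 + 1 * 1 = 5.\<close>

lemma surf_cosurf_zero:
  fixes x0 x1 x2 x3 :: "'a::field_char_0"
  assumes "surf (r^2) a c x0 x1 x2 x3 = 0" "cosurf (r^2) a c x0 x1 x2 x3 = 0"
    and nz: "r \<noteq> 0" "a \<noteq> 0"
  shows "(x0 + r * x1 = 0 \<and> x2 + r * x3 = 0) \<or> (x0 - r * x1 = 0 \<and> x2 - r * x3 = 0) \<or>
    (\<exists>t. quintic c a t = 0 \<and> x0 = t * x2 + r^2 * t^2 * x3 \<and> x1 = t^2 * x2 + t * x3 \<and>
       x2 + r * x3 \<noteq> 0 \<and> x2 - r * x3 \<noteq> 0)"
proof -
  define x z y v where xzyv: "x = x0 + r * x1" "z = x2 + r * x3" "y = x0 - r * x1" "v = x2 - r * x3"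
  have A: "bi21 r a c x z y v = 0" and B: "bi21 (-r) a c y v x z = 0"
    unfolding xzyv bi21_surf bi21_surf_conj using assms(1,2) by simp_all
  show ?thesis
  proof (cases "(x = 0 \<and> z = 0) \<or> (y = 0 \<and> v = 0)")
    case True then show ?thesis unfolding xzyv by blast
  next
    case F: False
    have z: "z \<noteq> 0" using bi21_zero_infinity[of r a c x y v] A B nz F by auto
    have v: "v \<noteq> 0" using bi21_zero_infinity[of "-r" a c y x z] A B nz F by auto
    define u where "u = (x / z + y / v) / 2"
    define w where "w = (x / z - y / v) / (2 * r)"
    have "r * (2 * w) = x / z - y / v" "2 * u = x / z + y / v" using nz by (simp_all add: w_def u_def field_simps)
    then have "2 * (u + r * w) = 2 * (x / z)" "2 * (u - r * w) = 2 * (y / v)" by Groebner_Basis.algebra+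
    then have uw: "u + r * w = x / z" "u - r * w = y / v"
      by (blast intro: numeral_cancel)+
    have "z^2 * v * bi21 r a c (x/z) 1 (y/v) 1 = 0" "v^2 * z * bi21 (-r) a c (y/v) 1 (x/z) 1 = 0"
      unfolding bi21_homogeneous[symmetric] using A B z v by simp_all
    then have "w = u^2 \<and> quintic c a u = 0"
      using bi21_zero_affine[of r a c u w] nz z v by (simp add: uw)
    then have w: "w = u^2" and q: "quintic c a u = 0" by auto
    have x: "x = (u + r * u^2) * z" and y: "y = (u - r * u^2) * v" using uw z v w by simp_all
    have "2 * x0 = 2 * (u * x2 + r^2 * u^2 * x3)" "2 * (r * x1) = 2 * (r * (u^2 * x2 + u * x3))"
      using x y unfolding xzyv by Groebner_Basis.algebra+
    then have "x0 = u * x2 + r^2 * u^2 * x3" "r * x1 = r * (u^2 * x2 + u * x3)"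
      by (blast intro: numeral_cancel)+
    then have "x0 = u * x2 + r^2 * u^2 * x3" "x1 = u^2 * x2 + u * x3" using nz by simp_all
    with q z v show ?thesis unfolding xzyv by blast
  qed
qed


section \<open>Singular points of the surface\<close>

definition surf_grad :: "'a::field \<Rightarrow> 'a \<Rightarrow> 'a \<Rightarrow> 'a \<Rightarrow> 'a \<Rightarrow> 'a \<Rightarrow> 'a \<Rightarrow> 'a list" where
  "surf_grad e a c x0 x1 x2 x3 =
    [- (e * a * x2^2) - (1 - 5 * c * e) * x1 * x3 - 2 * x0 * x1,
     e^2 * a * x2 * x3 + 5 * c^2 * e * x2^2 - 5 * c^2 * e^2 * x3^2 + 2 * (1 - 5 * c * e) * x1 * x2
       - (1 - 5 * c * e) * x0 * x3 - x0^2 + 3 * e * x1^2,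
     - (2 * e * a * x0 * x2) - 2 * e * a * x2 * x3 + e^2 * a * x1 * x3 + 10 * c^2 * e * x1 * x2
       + (1 - 5 * c * e) * x1^2,
     - (e * a * x2^2) + 3 * e^2 * a * x3^2 + e^2 * a * x1 * x2 - 10 * c^2 * e^2 * x1 * x3
       - (1 - 5 * c * e) * x0 * x1]"

text \<open>Write the form as A + B with A of bidegree (2, 1) and B of bidegree (1, 2). Euler's
  relation in all variables gives A + B = 0, and Euler's relation in \<open>p\<close> and
  \<open>q\<close> alone, which is the combination of \<open>F0\<close> to \<open>F3\<close> below
  up to the factor 2 r, gives 2 A + B = 0. So both parts vanish at a singular point.\<close>

lemma surf_grad_zero:
  fixes x0 x1 x2 x3 :: "'a::field_char_0"
  assumes g: "surf_grad (r^2) a c x0 x1 x2 x3 = [0,0,0,0]" and r: "r \<noteq> 0"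
  shows "surf (r^2) a c x0 x1 x2 x3 = 0" "cosurf (r^2) a c x0 x1 x2 x3 = 0"
proof -
  define p q where pq: "p = x0 + r * x1" "q = x2 + r * x3"
  note g' = g[unfolded surf_grad_def list.inject]
  have "3 * surf (r^2) a c x0 x1 x2 x3 = 0"
    using g' unfolding surf_def by Groebner_Basis.algebra
  then show 1: "surf (r^2) a c x0 x1 x2 x3 = 0" by simp
  define F0 F1 F2 F3 where F: "F0 = surf_grad (r^2) a c x0 x1 x2 x3 ! 0" 
     "F1 = surf_grad (r^2) a c x0 x1 x2 x3 ! 1" 
     "F2 = surf_grad (r^2) a c x0 x1 x2 x3 ! 2" 
     "F3 = surf_grad (r^2) a c x0 x1 x2 x3 ! 3"
  have F0: "F0 = 0" "F1 = 0" "F2 = 0" "F3 = 0" unfolding F g by simp_all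
  have "r * p * F0 + p * F1 + r * q * F2 + q * F3 = 3 * r * surf (r^2) a c x0 x1 x2 x3 + cosurf (r^2) a c x0 x1 x2 x3"
    unfolding F pq surf_def cosurf_def surf_grad_def by (simp add: algebra_simps eval_nat_numeral)
  then show "cosurf (r^2) a c x0 x1 x2 x3 = 0" using 1 F0 by simp
qed

text \<open>On the line \<open>x0 + r * x1 = x2 + r * x3 = 0\<close> the gradient reduces to the
  binary quadratic forms \<open>E1\<close> and \<open>E2\<close> in (y, v). The conclusion is the
  vanishing of their resultant, sorted into an odd and an even part in r, so that it can be refuted
  when r is not in the ground field.\<close>

lemma surf_grad_line_F:
  fixes y v :: "'a::field_char_0"
  assumes g: "surf_grad (r^2) a c (- r * y) y (- r * v) v = [0,0,0,0]" 
    and nz: "r \<noteq> 0" "a \<noteq> 0" "y \<noteq> 0 \<or> v \<noteq> 0"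
  shows "r * (r^4 * a * (11 - 20 * c * r^2 + 5 * c^2 * r^4))
    = r^2 * (r^4 * a)^2 + (4 - 5 * (1 - c*r^2)^2) * (5 * (1-c*r^2)^2 - 5 * (1-c*r^2) + 1)"
proof -
  define m s h K where defs: "m = r^4 * a" "s = 1 - c * r^2" "h = 5 * s - 4" "K = 2 * r * m - 5 * s^2 + 4"
  have E1: "2 * r * y^2 - h * y * v - m * v^2 = 0"
    using g unfolding surf_grad_def list.inject defs by Groebner_Basis.algebra
  have E2: "h * y^2 - (m + 10 * c^2 * r^3) * y * v + 2 * r^3 * a * v^2 = 0"
    using g unfolding surf_grad_def list.inject defs by Groebner_Basis.algebra
  have v: "v \<noteq> 0" using E1 nz by auto
  \<comment> \<open>Eliminating \<open>y^2\<close> determines the ratio y : v; inserting it into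
    \<open>E1\<close> then gives the resultant.\<close>
  have "v * (y * K - 5 * m * s * v) = h * (2 * r * y^2 - h * y * v - m * v^2) -
      2 * r * (h * y^2 - (m + 10 * c^2 * r^3) * y * v + 2 * r^3 * a * v^2)"
    unfolding defs by Groebner_Basis.algebra
  then have yK: "y * K = 5 * m * s * v" unfolding E1 E2 using v by simp
  have "v^2 * m * (50 * r * m * s^2 - 5 * s * h * K - K^2) = K^2 * (2 * r * y^2 - h * y * v - m * v^2)"
    using yK by Groebner_Basis.algebra
  then have "50 * r * m * s^2 - 5 * s * h * K - K^2 = 0"
    unfolding E1 using v nz by (simp add: defs(1))
  then have "4 * (r * m * (5 * s^2 + 10 * s - 4)) = 4 * (r^2 * m^2 + (4 - 5 * s^2) * (5 * s^2 - 5 * s + 1))"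
    unfolding defs(3,4) by Groebner_Basis.algebra
  then have *: "r * m * (5 * s^2 + 10 * s - 4) = r^2 * m^2 + (4 - 5 * s^2) * (5 * s^2 - 5 * s + 1)"
    by (rule numeral_cancel)
  have **: "5 * s^2 + 10 * s - 4 = 11 - 20 * c * r^2 + 5 * c^2 * r^4"
    unfolding defs(2) by Groebner_Basis.algebra
  show ?thesis using *[unfolded **] unfolding defs(1,2) by (simp only: mult.assoc)
qed

text \<open>The conclusion is that one fifth of the derivative of the quintic vanishes at
  \<open>t\<close>: a singular point on a transversal needs two of the five blown up points to
  coincide. After removal of the norm \<open>x2^2 - e * x3^2\<close> two linear equations in x2, x3
  remain, whose determinant is a multiple of that derivative modulo the quintic.\<close>

lemma surf_grad_line_quintic:
  fixes x2 x3 t :: "'a::field_char_0"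
  assumes g: "surf_grad e a c (t * x2 + e * t^2 * x3) (t^2 * x2 + t * x3) x2 x3 = [0,0,0,0]" 
    and t: "quintic c a t = 0"
    and nz: "e \<noteq> 0" "a \<noteq> 0" "x2^2 \<noteq> e * x3^2"
  shows "t^4 - 3 * c * t^2 + c^2 = 0"
proof -
  define R1 R2 I1 I2 where RI: "R1 = - (e * a) - 2 * t^3" "R2 = e * (3 * t^4 - 10 * c * t^2 + 5 * c^2) + t^2"
    "I1 = e * (t^4 - 5 * c * t^2 + 5 * c^2) - 2 * t^2" "I2 = e * (2 * t^3 - 5 * c * t) + t"
  have "(x2^2 - e * x3^2) * (x2 * R1 + x3 * I1) = 0"
    using g unfolding surf_grad_def list.inject RI by Groebner_Basis.algebra
  then have 1: "x2 * R1 + x3 * I1 = 0" using nz by simp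
  have "(x2^2 - e * x3^2) * (x2 * R2 + x3 * I2) = 0"
    using g unfolding surf_grad_def list.inject RI by Groebner_Basis.algebra
  then have 2: "x2 * R2 + x3 * I2 = 0" using nz by simp
  have "x2 * (R1 * I2 - R2 * I1) = 0" "x3 * (R1 * I2 - R2 * I1) = 0"
    using 1 2 by Groebner_Basis.algebra+
  then have "R1 * I2 - R2 * I1 = 0" using nz(3) by auto
  then have "5 * (e^2 * a) * (t^4 - 3 * c * t^2 + c^2) = 0"
    using t unfolding RI quintic_def by Groebner_Basis.algebra
  then show ?thesis using nz by simp
qed

lemma surf_grad_nonzero:
  fixes x0 x1 x2 x3 r :: "'a::field_char_0"
  assumes g: "surf_grad (r^2) a c x0 x1 x2 x3 = [0,0,0,0]"
    and nz: "r \<noteq> 0" "a \<noteq> 0" "\<not> (x0 = 0 \<and> x1 = 0 \<and> x2 = 0 \<and> x3 = 0)"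
    and sep: "\<And>t. quintic c a t = 0 \<Longrightarrow> t^4 - 3 * c * t^2 + c^2 \<noteq> 0"
    and indep: "\<And>s. s^2 = r^2 \<Longrightarrow> s * (r^4 * a * (11 - 20 * c * r^2 + 5 * c^2 * r^4))
      \<noteq> r^2 * (r^4 * a)^2 + (4 - 5 * (1 - c*r^2)^2) * (5 * (1-c*r^2)^2 - 5 * (1-c*r^2) + 1)"
  shows False
proof -
  have neg: "(-r)^2 = r^2" "(-r)^4 = r^4" by simp_all
  from surf_cosurf_zero[OF surf_grad_zero[OF g nz(1)] nz(1,2)]
  consider "x0 + r * x1 = 0" "x2 + r * x3 = 0" | "x0 - r * x1 = 0" "x2 - r * x3 = 0"
    | t where "quintic c a t = 0" "x0 = t * x2 + r^2 * t^2 * x3" "x1 = t^2 * x2 + t * x3"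
       "x2 + r * x3 \<noteq> 0" "x2 - r * x3 \<noteq> 0" by blast
  then show False
  proof cases
    case 1
    then have x: "x0 = - r * x1" "x2 = - r * x3" by (simp_all add: eq_neg_iff_add_eq_0)
    with nz have "x1 \<noteq> 0 \<or> x3 \<noteq> 0" by auto
    from surf_grad_line_F[OF g[unfolded x] nz(1,2) this] show False
      using indep[of r] by simp
  next
    case 2
    then have x: "x0 = - (-r) * x1" "x2 = - (-r) * x3" by simp_all
    with nz have "x1 \<noteq> 0 \<or> x3 \<noteq> 0" by auto
    moreover have "surf_grad ((-r)^2) a c (- (-r) * x1) x1 (- (-r) * x3) x3 = [0,0,0,0]"
      using g unfolding x neg .
    moreover have "- r \<noteq> 0" using nz by simp
    ultimately show False using surf_grad_line_F[of "-r" a c x1 x3] nz(2) indep[of "-r"] unfolding neg by blast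
  next
    case 3
    have "(x2 + r * x3) * (x2 - r * x3) \<noteq> 0" using 3 by simp
    moreover have "(x2 + r * x3) * (x2 - r * x3) = x2^2 - r^2 * x3^2" by Groebner_Basis.algebra
    ultimately have "x2^2 \<noteq> r^2 * x3^2" by auto
    then show False using surf_grad_line_quintic[of "r^2" a c t x2 x3] g sep[of t] nz 3 by simp
  qed
qed

section \<open>Lines over the ground field\<close>

lemma surf_pencil:
  fixes s t :: "'a::field"
  shows "2 * surf e a c (s*p0+t*q0) (s*p1+t*q1) (s*p2+t*q2) (s*p3+t*q3) =
     2 * s^3 * surf e a c p0 p1 p2 p3 + 2 * t^3 * surf e a c q0 q1 q2 q3
     + s^2 * t * (surf e a c (p0+q0) (p1+q1) (p2+q2) (p3+q3) - surf e a c (p0-q0) (p1-q1) (p2-q2) (p3-q3)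
          - 2 * surf e a c q0 q1 q2 q3)
     + s * t^2 * (surf e a c (p0+q0) (p1+q1) (p2+q2) (p3+q3) + surf e a c (p0-q0) (p1-q1) (p2-q2) (p3-q3)
          - 2 * surf e a c p0 p1 p2 p3)"
  unfolding surf_def by Groebner_Basis.algebra

lemma cosurf_pencil:
  fixes s t :: "'a::field"
  shows "2 * cosurf e a c (s*p0+t*q0) (s*p1+t*q1) (s*p2+t*q2) (s*p3+t*q3) =
     2 * s^3 * cosurf e a c p0 p1 p2 p3 + 2 * t^3 * cosurf e a c q0 q1 q2 q3
     + s^2 * t * (cosurf e a c (p0+q0) (p1+q1) (p2+q2) (p3+q3) - cosurf e a c (p0-q0) (p1-q1) (p2-q2) (p3-q3)
          - 2 * cosurf e a c q0 q1 q2 q3)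
     + s * t^2 * (cosurf e a c (p0+q0) (p1+q1) (p2+q2) (p3+q3) + cosurf e a c (p0-q0) (p1-q1) (p2-q2) (p3-q3)
          - 2 * cosurf e a c p0 p1 p2 p3)"
  unfolding cosurf_def by Groebner_Basis.algebra

lemma surf_to_ac:
  "surf (to_ac e) (to_ac a) (to_ac c) (to_ac x0) (to_ac x1) (to_ac x2) (to_ac x3) = to_ac (surf e a c x0 x1 x2 x3)"
  by (simp add: surf_def)

text \<open>On a line, \<open>cosurf\<close> is a binary cubic and so has a zero over an
  algebraically closed field; this zero lies on one of the two skew lines or on a transversal. The
  hypothesis \<open>sym\<close> says that the line meets one skew line if and only if it meets the
  other, which holds for lines over k because conjugation exchanges the two.\<close>

lemma quintic_line_meets:
  fixes p0 p1 p2 p3 q0 q1 q2 q3 r :: "'a::{alg_closed_field,field_char_0}"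
  assumes S: "\<And>s t. surf (r^2) a c (s*p0+t*q0) (s*p1+t*q1) (s*p2+t*q2) (s*p3+t*q3) = 0"
    and ind: "\<And>s t. s*p0+t*q0 = 0 \<Longrightarrow> s*p1+t*q1 = 0 \<Longrightarrow> s*p2+t*q2 = 0 \<Longrightarrow> s*p3+t*q3 = 0 \<Longrightarrow> s = 0 \<and> t = 0"
    and sym: "(p0 + r * p1) * (q2 + r * q3) = (q0 + r * q1) * (p2 + r * p3) \<longleftrightarrow>
              (p0 - r * p1) * (q2 - r * q3) = (q0 - r * q1) * (p2 - r * p3)"
    and nz: "r \<noteq> 0" "a \<noteq> 0"
  shows "\<exists>s t u x2 x3. (s \<noteq> 0 \<or> t \<noteq> 0) \<and> quintic c a u = 0 \<and>
     s*p0+t*q0 = u * x2 + r^2 * u^2 * x3 \<and> s*p1+t*q1 = u^2 * x2 + u * x3 \<and> s*p2+t*q2 = x2 \<and> s*p3+t*q3 = x3"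
proof -
  let ?J = "\<lambda>s t. cosurf (r^2) a c (s*p0+t*q0) (s*p1+t*q1) (s*p2+t*q2) (s*p3+t*q3)"
  have "\<exists>s t. (s \<noteq> 0 \<or> t \<noteq> 0) \<and> ?J s t = 0"
  proof (cases "?J 1 0 = 0")
    case True then show ?thesis by (metis one_neq_zero)
  next
    case False
    define J where "J = cosurf (r^2) a c"
    define C1 C2 where C: "C1 = J (p0+q0) (p1+q1) (p2+q2) (p3+q3) - J (p0-q0) (p1-q1) (p2-q2) (p3-q3) - 2 * J q0 q1 q2 q3"
      "C2 = J (p0+q0) (p1+q1) (p2+q2) (p3+q3) + J (p0-q0) (p1-q1) (p2-q2) (p3-q3) - 2 * J p0 p1 p2 p3"
    have nz: "2 * J p0 p1 p2 p3 \<noteq> 0" using False by (simp add: J_def)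
    have "\<exists>s. poly [:2 * J q0 q1 q2 q3, C2, C1, 2 * J p0 p1 p2 p3:] s = 0"
      by (rule alg_closed_imp_poly_has_root) (use nz in simp)
    then obtain s where "poly [:2 * J q0 q1 q2 q3, C2, C1, 2 * J p0 p1 p2 p3:] s = 0" by blast
    then have s: "2 * J q0 q1 q2 q3 + s * (C2 + s * (C1 + s * (2 * J p0 p1 p2 p3))) = 0"
      by (simp only: poly_pCons poly_0 mult_zero_right add_0_right)
    have "2 * ?J s 1 = 2 * s^3 * J p0 p1 p2 p3 + 2 * 1^3 * J q0 q1 q2 q3 + s^2 * 1 * C1 + s * 1^2 * C2"
      unfolding cosurf_pencil C J_def ..
    also have "\<dots> = 2 * J q0 q1 q2 q3 + s * (C2 + s * (C1 + s * (2 * J p0 p1 p2 p3)))"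
      by (simp add: algebra_simps eval_nat_numeral)
    finally have "2 * ?J s 1 = 0" unfolding s .
    then show ?thesis by (intro exI[of _ s] exI[of _ 1]) simp
  qed
  then obtain s t where st: "s \<noteq> 0 \<or> t \<noteq> 0" "?J s t = 0" by blast
  note cs = surf_cosurf_zero[OF S st(2) nz]
  let ?goal = "\<lambda>s t. \<exists>u. quintic c a u = 0 \<and>
      s*p0+t*q0 = u * (s*p2+t*q2) + r^2 * u^2 * (s*p3+t*q3) \<and> s*p1+t*q1 = u^2 * (s*p2+t*q2) + u * (s*p3+t*q3)"
  have red: ?thesis if "s \<noteq> 0 \<or> t \<noteq> 0" "?goal s t" for s t using that by blast
  \<comment> \<open>If the line meets both \<open>L\<close> and its conjugate, then the form is \<open>s t (s A + t B)\<close> on it.\<close>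
  have both: ?thesis
    if n: "s1 \<noteq> 0 \<or> t1 \<noteq> 0" "(s1*p0+t1*q0) + r * (s1*p1+t1*q1) = 0" "(s1*p2+t1*q2) + r * (s1*p3+t1*q3) = 0"
    and n': "s2 \<noteq> 0 \<or> t2 \<noteq> 0" "(s2*p0+t2*q0) - r * (s2*p1+t2*q1) = 0" "(s2*p2+t2*q2) - r * (s2*p3+t2*q3) = 0"
    for s1 t1 s2 t2
  proof -
    define m0 m1 m2 m3 where m: "m0 = s1*p0+t1*q0" "m1 = s1*p1+t1*q1" "m2 = s1*p2+t1*q2" "m3 = s1*p3+t1*q3"
    define l0 l1 l2 l3 where l: "l0 = s2*p0+t2*q0" "l1 = s2*p1+t2*q1" "l2 = s2*p2+t2*q2" "l3 = s2*p3+t2*q3"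
    have eqs: "m0 = - (r * m1)" "m2 = - (r * m3)" "l0 = r * l1" "l2 = r * l3"
      using n n' unfolding m l by (simp_all add: eq_neg_iff_add_eq_0)
    have S1: "surf (r^2) a c (l0 + m0) (l1 + m1) (l2 + m2) (l3 + m3) = 0"
      using S[of "s1+s2" "t1+t2"] unfolding m l by (simp add: algebra_simps)
    have S2: "surf (r^2) a c (l0 - m0) (l1 - m1) (l2 - m2) (l3 - m3) = 0"
      using S[of "s2-s1" "t2-t1"] unfolding m l by (simp add: algebra_simps)
    have "r * (surf (r^2) a c (l0 + m0) (l1 + m1) (l2 + m2) (l3 + m3)
      - surf (r^2) a c (l0 - m0) (l1 - m1) (l2 - m2) (l3 - m3)) -
      r * (surf (r^2) a c (l0 + m0) (l1 + m1) (l2 + m2) (l3 + m3)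
      + surf (r^2) a c (l0 - m0) (l1 - m1) (l2 - m2) (l3 - m3)) = 2 * cosurf (r^2) a c (l0 + m0) (l1 + m1) (l2 + m2) (l3 + m3)"
      unfolding eqs surf_def cosurf_def by Groebner_Basis.algebra
    then have J: "cosurf (r^2) a c (l0 + m0) (l1 + m1) (l2 + m2) (l3 + m3) = 0" by (simp add: S1 S2)
    have sum: "l0 + m0 = (s1+s2)*p0+(t1+t2)*q0" "l1 + m1 = (s1+s2)*p1+(t1+t2)*q1"
      "l2 + m2 = (s1+s2)*p2+(t1+t2)*q2" "l3 + m3 = (s1+s2)*p3+(t1+t2)*q3" unfolding m l by (simp_all add: algebra_simps)
    have l_nz: "\<not> (l1 = 0 \<and> l3 = 0)" using ind[of s2 t2] eqs n'(1) l by auto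
    have m_nz: "\<not> (m1 = 0 \<and> m3 = 0)" using ind[of s1 t1] eqs n(1) m by auto
    have "\<not> (l0 + m0 + r * (l1 + m1) = 0 \<and> l2 + m2 + r * (l3 + m3) = 0)"
    proof
      assume "l0 + m0 + r * (l1 + m1) = 0 \<and> l2 + m2 + r * (l3 + m3) = 0"
      then have "2 * (r * l1) = 0" "2 * (r * l3) = 0" using eqs by Groebner_Basis.algebra+
      then show False using nz l_nz by simp
    qed
    moreover have "\<not> (l0 + m0 - r * (l1 + m1) = 0 \<and> l2 + m2 - r * (l3 + m3) = 0)"
    proof
      assume "l0 + m0 - r * (l1 + m1) = 0 \<and> l2 + m2 - r * (l3 + m3) = 0"
      then have "2 * (r * m1) = 0" "2 * (r * m3) = 0" using eqs by Groebner_Basis.algebra+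
      then show False using nz m_nz by simp
    qed
    ultimately have "\<exists>u. quintic c a u = 0 \<and> l0 + m0 = u * (l2 + m2) + r\<^sup>2 * u\<^sup>2 * (l3 + m3) \<and>
       l1 + m1 = u\<^sup>2 * (l2 + m2) + u * (l3 + m3)"
      using surf_cosurf_zero[OF S1 J nz] by blast
    moreover have "s1 + s2 \<noteq> 0 \<or> t1 + t2 \<noteq> 0"
    proof (rule ccontr)
      assume "\<not> ?thesis"
      then have "l0 + m0 = 0" "l2 + m2 = 0" "l1 + m1 = 0" "l3 + m3 = 0" unfolding sum by simp_all
      then have "2 * (r * l1) = 0" "2 * (r * l3) = 0" using eqs by Groebner_Basis.algebra+
      then have "l1 = 0" "l3 = 0" using nz by simp_all
      with l_nz show False by simp
    qed
    ultimately show ?thesis using red unfolding sum by blast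
  qed
  \<comment> \<open>The hypothesis is the vanishing of the determinant of \<open>x0 + k * x1\<close>
    and \<open>x2 + k * x3\<close> restricted to the line, that is, the condition for meeting the
    skew line that belongs to \<open>k\<close>.\<close>
  have dep: "\<exists>s t. (s \<noteq> 0 \<or> t \<noteq> 0) \<and> (s*p0+t*q0) + k * (s*p1+t*q1) = 0 \<and> (s*p2+t*q2) + k * (s*p3+t*q3) = 0"
    if "(p0 + k * p1) * (q2 + k * q3) = (q0 + k * q1) * (p2 + k * p3)" for k
  proof -
    define b0 b1 b2 b3 where b: "b0 = p0 + k * p1" "b1 = q0 + k * q1" "b2 = p2 + k * p3" "b3 = q2 + k * q3"
    have "\<exists>s t. (s \<noteq> 0 \<or> t \<noteq> 0) \<and> s * b0 + t * b1 = 0 \<and> s * b2 + t * b3 = 0"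
    proof (cases "b0 = 0 \<and> b1 = 0")
      case True
      then show ?thesis 
        using that[folded b] by (cases "b2 = 0 \<and> b3 = 0")
          (force intro: exI[of _ 1], intro exI[of _ b3] exI[of _ "-b2"], auto)
    next
      case False
      then show ?thesis using that[folded b]
        by (intro exI[of _ b1] exI[of _ "-b0"]) (auto simp: mult.commute)
    qed
    then obtain s t where "s \<noteq> 0 \<or> t \<noteq> 0" "s * b0 + t * b1 = 0" "s * b2 + t * b3 = 0" by blast
    then show ?thesis unfolding b
      by (intro exI[of _ s] exI[of _ t]) (simp add: algebra_simps)
  qed
  show ?thesis
    using cs
  proof (elim disjE)
    assume n: "s * p0 + t * q0 + r * (s * p1 + t * q1) = 0 \<and> s * p2 + t * q2 + r * (s * p3 + t * q3) = 0"
    then have "s * (p0 + r * p1) + t * (q0 + r * q1) = 0" "s * (p2 + r * p3) + t * (q2 + r * q3) = 0"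
      by (simp_all add: algebra_simps)
    then have "s * ((p0 + r * p1) * (q2 + r * q3) - (q0 + r * q1) * (p2 + r * p3)) = 0"
      "t * ((p0 + r * p1) * (q2 + r * q3) - (q0 + r * q1) * (p2 + r * p3)) = 0"
      by Groebner_Basis.algebra+
    then have "(p0 + r * p1) * (q2 + r * q3) = (q0 + r * q1) * (p2 + r * p3)"
      using st by auto
    then have "(p0 + (-r) * p1) * (q2 + (-r) * q3) = (q0 + (-r) * q1) * (p2 + (-r) * p3)"
      using sym by simp
    from dep[OF this] obtain s2 t2 where n2: "s2 \<noteq> 0 \<or> t2 \<noteq> 0"
      "s2 * p0 + t2 * q0 + - r * (s2 * p1 + t2 * q1) = 0" "s2 * p2 + t2 * q2 + - r * (s2 * p3 + t2 * q3) = 0"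
      by blast
    show ?thesis
      by (rule both[OF st(1) conjunct1[OF n] conjunct2[OF n] n2(1)]) (use n2 in simp_all)
  next
    assume n: "s * p0 + t * q0 - r * (s * p1 + t * q1) = 0 \<and> s * p2 + t * q2 - r * (s * p3 + t * q3) = 0"
    then have "s * (p0 - r * p1) + t * (q0 - r * q1) = 0" "s * (p2 - r * p3) + t * (q2 - r * q3) = 0"
      by (simp_all add: algebra_simps)
    then have "s * ((p0 - r * p1) * (q2 - r * q3) - (q0 - r * q1) * (p2 - r * p3)) = 0"
      "t * ((p0 - r * p1) * (q2 - r * q3) - (q0 - r * q1) * (p2 - r * p3)) = 0"
      by Groebner_Basis.algebra+
    then have "(p0 + r * p1) * (q2 + r * q3) = (q0 + r * q1) * (p2 + r * p3)"
      using st sym by auto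
    from dep[OF this] obtain s1 t1 where n1: "s1 \<noteq> 0 \<or> t1 \<noteq> 0"
      "s1 * p0 + t1 * q0 + r * (s1 * p1 + t1 * q1) = 0" "s1 * p2 + t1 * q2 + r * (s1 * p3 + t1 * q3) = 0"
      by blast
    show ?thesis
      by (rule both[OF n1 st(1) conjunct1[OF n] conjunct2[OF n]])
  next
    assume "\<exists>u. quintic c a u = 0 \<and>
        s * p0 + t * q0 = u * (s * p2 + t * q2) + r\<^sup>2 * u\<^sup>2 * (s * p3 + t * q3) \<and>
        s * p1 + t * q1 = u\<^sup>2 * (s * p2 + t * q2) + u * (s * p3 + t * q3) \<and>
        s * p2 + t * q2 + r * (s * p3 + t * q3) \<noteq> 0 \<and> s * p2 + t * q2 - r * (s * p3 + t * q3) \<noteq> 0"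
    then show ?thesis using red[OF st(1)] by blast
  qed
qed

text \<open>Irreducibility of the quintic in the form in which it is used: the powers 1, t, ..., t^4
  of any root are linearly independent over k.\<close>

definition nonroot_below_5 :: "'k::field \<Rightarrow> 'k \<Rightarrow> bool" where
  "nonroot_below_5 c a \<longleftrightarrow> (\<forall>t g. quintic (to_ac c) (to_ac a) t = 0 \<and> degree g < 5 \<and>
     poly (map_poly to_ac g) t = 0 \<longrightarrow> g = 0)"

text \<open>In Pluecker coordinates the incidence with the transversal of a root \<open>u\<close> is
  the polynomial \<open>g\<close> of degree at most 4 over k, evaluated at \<open>u\<close>. So all
  its coefficients vanish, and what survives of the quadratic Pluecker relation exhibits
  \<open>e\<close> as a square.\<close>

lemma no_rational_line:
  fixes p0 p1 p2 p3 q0 q1 q2 q3 e a c :: "'k::field_char_0"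
  assumes S: "\<And>s t. surf e a c (s*p0+t*q0) (s*p1+t*q1) (s*p2+t*q2) (s*p3+t*q3) = 0"
    and e: "\<And>x. x^2 \<noteq> e" and a: "a \<noteq> 0" and irr: "nonroot_below_5 c a"
  obtains s t where "s \<noteq> 0 \<or> t \<noteq> 0" "s*p0+t*q0 = 0" "s*p1+t*q1 = 0" "s*p2+t*q2 = 0" "s*p3+t*q3 = 0"
proof (rule ccontr)
  assume "\<not> thesis"
  with that have ind: "s = 0 \<and> t = 0" if "s*p0+t*q0 = 0" "s*p1+t*q1 = 0" "s*p2+t*q2 = 0" "s*p3+t*q3 = 0" for s t
    using that by blast
  define \<pi>01 \<pi>02 \<pi>03 \<pi>12 \<pi>13 \<pi>23 where \<pi>: "\<pi>01 = p0 * q1 - p1 * q0" "\<pi>02 = p0 * q2 - p2 * q0"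
    "\<pi>03 = p0 * q3 - p3 * q0" "\<pi>12 = p1 * q2 - p2 * q1" "\<pi>13 = p1 * q3 - p3 * q1" "\<pi>23 = p2 * q3 - p3 * q2"
  have \<pi>_nz: "\<not> (\<pi>01 = 0 \<and> \<pi>02 = 0 \<and> \<pi>03 = 0 \<and> \<pi>12 = 0 \<and> \<pi>13 = 0 \<and> \<pi>23 = 0)"
  proof
    assume z: "\<pi>01 = 0 \<and> \<pi>02 = 0 \<and> \<pi>03 = 0 \<and> \<pi>12 = 0 \<and> \<pi>13 = 0 \<and> \<pi>23 = 0"
    have "p0 = 0" using ind[of q0 "-p0"] z unfolding \<pi> by (simp add: algebra_simps)
    moreover have "p1 = 0" using ind[of q1 "-p1"] z unfolding \<pi> by (simp add: algebra_simps)
    moreover have "p2 = 0" using ind[of q2 "-p2"] z unfolding \<pi> by (simp add: algebra_simps)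
    moreover have "p3 = 0" using ind[of q3 "-p3"] z unfolding \<pi> by (simp add: algebra_simps)
    ultimately show False using ind[of 1 0] by simp
  qed
  define h where "h = (to_ac :: 'k \<Rightarrow> 'k alg_closure)"
  have hom: "h (x + y) = h x + h y" "h (x * y) = h x * h y" "h (x - y) = h x - h y" "h 0 = 0" "h x = 0 \<longleftrightarrow> x = 0" 
    "h (- x) = - h x" "h (x ^ n) = h x ^ n" for x y n
    by (simp_all add: h_def)
  obtain r where r: "r^2 = h e" using nth_root_exists[of 2 "h e"] by auto
  have e0: "e \<noteq> 0" using e[of 0] by auto
  have r0: "r \<noteq> 0" using r e0 by (auto simp: hom)
  have r_ind: "x = 0 \<and> y = 0" if "h x + r * h y = 0" for x y
  proof (cases "y = 0")
    case True then show ?thesis using that by (simp add: hom)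
  next
    case False
    have "(h x)^2 = h e * (h y)^2" using that r by Groebner_Basis.algebra
    then have "h ((x / y)^2) = h e" using False by (simp add: h_def power_divide)
    then have "(x / y)^2 = e" by (simp only: h_def to_ac_eq_iff)
    with e show ?thesis by blast
  qed
  define S' where "S' = (\<lambda>s t. surf (r^2) (h a) (h c) (s*h p0+t*h q0) (s*h p1+t*h q1) (s*h p2+t*h q2) (s*h p3+t*h q3))"
  \<comment> \<open>A binary cubic is determined by its values at (1, 0), (0, 1), (1, 1) and (1,
    -1), so vanishing on the points of the line over k carries over to the algebraic
    closure.\<close>
  have "2 * S' s t = 0" for s t
    using S[of 1 0] S[of 0 1] S[of 1 1] S[of 1 "-1"]
    unfolding S'_def surf_pencil r hom[symmetric] unfolding h_def surf_to_ac by simp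
  then have S': "S' s t = 0" for s t by simp
  have \<pi>h: "h \<pi>01 = h p0 * h q1 - h p1 * h q0" "h \<pi>02 = h p0 * h q2 - h p2 * h q0"
    "h \<pi>03 = h p0 * h q3 - h p3 * h q0" "h \<pi>12 = h p1 * h q2 - h p2 * h q1" "h \<pi>13 = h p1 * h q3 - h p3 * h q1"
    "h \<pi>23 = h p2 * h q3 - h p3 * h q2"
    unfolding \<pi> hom by simp_all
  have ind': "s = 0 \<and> t = 0" if "s*h p0+t*h q0 = 0" "s*h p1+t*h q1 = 0" "s*h p2+t*h q2 = 0" "s*h p3+t*h q3 = 0" for s t
  proof -
    have "s * h \<pi>01 = 0" "s * h \<pi>02 = 0" "s * h \<pi>03 = 0" "s * h \<pi>12 = 0" "s * h \<pi>13 = 0" "s * h \<pi>23 = 0"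
      "t * h \<pi>01 = 0" "t * h \<pi>02 = 0" "t * h \<pi>03 = 0" "t * h \<pi>12 = 0" "t * h \<pi>13 = 0" "t * h \<pi>23 = 0"
      unfolding \<pi>h using that by Groebner_Basis.algebra+
    then show ?thesis using \<pi>_nz by (auto simp: hom)
  qed
  \<comment> \<open>The two determinants are conjugate: they are X + r Y and X - r Y with X, Y in k,
    and vanish together because r is not in k.\<close>
  have sym: "(h p0 + r * h p1) * (h q2 + r * h q3) = (h q0 + r * h q1) * (h p2 + r * h p3) \<longleftrightarrow>
     (h p0 - r * h p1) * (h q2 - r * h q3) = (h q0 - r * h q1) * (h p2 - r * h p3)"
  proof -
    have 1: "(h p0 + r * h p1) * (h q2 + r * h q3) - (h q0 + r * h q1) * (h p2 + r * h p3) =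
        h (\<pi>02 + e * \<pi>13) + r * h (\<pi>12 + \<pi>03)"
      unfolding hom \<pi>h r[symmetric] by Groebner_Basis.algebra
    have 2: "(h p0 - r * h p1) * (h q2 - r * h q3) - (h q0 - r * h q1) * (h p2 - r * h p3) =
        h (\<pi>02 + e * \<pi>13) + r * h (- (\<pi>12 + \<pi>03))"
      unfolding hom \<pi>h r[symmetric] by Groebner_Basis.algebra
    show ?thesis
      using r_ind[of "\<pi>02 + e * \<pi>13" "\<pi>12 + \<pi>03"] r_ind[of "\<pi>02 + e * \<pi>13" "- (\<pi>12 + \<pi>03)"] 1 2
      by (metis eq_iff_diff_eq_0 neg_equal_0_iff_equal)
  qed
  obtain s t u x2 x3 where st: "s \<noteq> 0 \<or> t \<noteq> 0" and u: "quintic (h c) (h a) u = 0"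
    and n: "s*h p0+t*h q0 = u * x2 + r^2 * u^2 * x3" "s*h p1+t*h q1 = u^2 * x2 + u * x3" "s*h p2+t*h q2 = x2" "s*h p3+t*h q3 = x3"
    using quintic_line_meets[OF S'[unfolded S'_def] ind' sym r0] a hom(5) by blast
  define g where "g = [:\<pi>01, \<pi>12 - \<pi>03, \<pi>23 + e * \<pi>13 - \<pi>02, 0, - e * \<pi>23:]"
  have g: "poly (map_poly h g) u = h \<pi>01 + u * (h (\<pi>12 - \<pi>03) + u * (h (\<pi>23 + e * \<pi>13 - \<pi>02) + u * (u * h (- e * \<pi>23))))"
    unfolding g_def by (simp add: map_poly_pCons hom)
  define D where "D = h \<pi>01 + u * (h (\<pi>12 - \<pi>03) + u * (h (\<pi>23 + e * \<pi>13 - \<pi>02) + u * (u * h (- e * \<pi>23))))"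
  have "s * D = 0" "t * D = 0"
    unfolding D_def hom \<pi>h r[symmetric] using n by Groebner_Basis.algebra+
  then have "D = 0" using st by auto
  moreover have "degree g < 5" by (simp add: g_def)
  ultimately have "g = 0" using irr u g unfolding nonroot_below_5_def h_def D_def by metis
  then have z: "\<pi>01 = 0" "\<pi>12 = \<pi>03" "\<pi>02 = e * \<pi>13" "\<pi>23 = 0"
    using e0 by (auto simp: g_def split: if_splits)
  have "\<pi>01 * \<pi>23 - \<pi>02 * \<pi>13 + \<pi>03 * \<pi>12 = 0" unfolding \<pi> by Groebner_Basis.algebra
  then have "\<pi>03^2 = e * \<pi>13^2" using z by Groebner_Basis.algebra
  then have "\<pi>13 \<noteq> 0 \<Longrightarrow> (\<pi>03 / \<pi>13)^2 = e" by (simp add: power_divide)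
  then have "\<pi>13 = 0" using e by blast
  then show False using \<open>\<pi>03^2 = e * \<pi>13^2\<close> \<pi>_nz z by simp
qed

section \<open>Forms as polynomial mappings\<close>

lemma UNIV_4: "(UNIV :: 4 set) = {0, 1, 2, 3}"
  by (rule sym, rule card_subset_eq) simp_all

lemma distinct_4: "(0::4) \<noteq> 1" "(0::4) \<noteq> 2" "(0::4) \<noteq> 3" "(1::4) \<noteq> 2" "(1::4) \<noteq> 3" "(2::4) \<noteq> 3"
  by simp_all

lemma prod_UNIV_4: "(\<Prod>i\<in>(UNIV :: 4 set). f i) = f 0 * f 1 * f 2 * (f 3 :: 'a :: comm_monoid_mult)"
proof -
  have "prod f {0,1,2,3::4} = f 0 * (f 1 * (f 2 * f 3))" using distinct_4
    by (simp only: prod.insert finite.intros insert_iff empty_iff simp_thms prod.empty mult_1_right not_False_eq_True)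
  then show ?thesis by (simp only: UNIV_4 mult.assoc)
qed

lemma sum_UNIV_4: "(\<Sum>i\<in>(UNIV :: 4 set). f i) = f 0 + f 1 + f 2 + (f 3 :: 'a :: comm_monoid_add)"
proof -
  have "sum f {0,1,2,3::4} = f 0 + (f 1 + (f 2 + f 3))" using distinct_4
    by (simp only: sum.insert finite.intros insert_iff empty_iff simp_thms sum.empty add_0_right not_False_eq_True)
  then show ?thesis by (simp only: UNIV_4 add.assoc)
qed

definition mon :: "nat \<Rightarrow> nat \<Rightarrow> nat \<Rightarrow> nat \<Rightarrow> 4 \<Rightarrow>\<^sub>0 nat" where
  "mon i j k l = Poly_Mapping.single 0 i + Poly_Mapping.single 1 j + Poly_Mapping.single 2 k + Poly_Mapping.single 3 l"

lemma lookup_mon: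
  "Poly_Mapping.lookup (mon i j k l) 0 = i" "Poly_Mapping.lookup (mon i j k l) 1 = j"
  "Poly_Mapping.lookup (mon i j k l) 2 = k" "Poly_Mapping.lookup (mon i j k l) 3 = l"
  by (simp_all add: mon_def lookup_add lookup_single)

text \<open>A list may repeat monomials and carry zero coefficients. A term free of the variable of
  differentiation simply stays in the list with coefficient 0.\<close>

definition form_sum :: "((4 \<Rightarrow>\<^sub>0 nat) \<times> 'k::field) list \<Rightarrow> (4 \<Rightarrow>\<^sub>0 nat) \<Rightarrow>\<^sub>0 'k" where
  "form_sum ts = sum_list (map (\<lambda>(m, b). Poly_Mapping.single m b) ts)"

text \<open>The counterpart of \<open>eval_form\<close> in the arithmetic of a field given as a
  type.\<close>

definition type_eval :: "('k \<Rightarrow> 'b::field) \<Rightarrow> ((4 \<Rightarrow>\<^sub>0 nat) \<Rightarrow>\<^sub>0 'k::field) \<Rightarrow> (4 \<Rightarrow> 'b) \<Rightarrow> 'b" where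
  "type_eval \<phi> F x = (\<Sum>m\<in>Poly_Mapping.keys F. \<phi> (Poly_Mapping.lookup F m) * (\<Prod>i\<in>UNIV. x i ^ Poly_Mapping.lookup m i))"

lemma finsum_type_algebra:
  "finsum ring_of_type_algebra f A = sum (f :: 'i \<Rightarrow> 'b::field) A" if "finite A"
proof -
  interpret cring "ring_of_type_algebra :: 'b ring" by (rule cring_from_type_algebra)
  show ?thesis using that
    by (induction A) (auto simp: ring_of_type_algebra_def finsum_insert[simplified ring_of_type_algebra_def] finsum_empty[simplified ring_of_type_algebra_def])
qed

lemma finprod_type_algebra:
  "finprod ring_of_type_algebra f A = prod (f :: 'i \<Rightarrow> 'b::field) A" if "finite A"
proof -
  interpret cring "ring_of_type_algebra :: 'b ring" by (rule cring_from_type_algebra)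
  show ?thesis using that
    by (induction A) (auto simp: ring_of_type_algebra_def finprod_insert[simplified ring_of_type_algebra_def] finprod_empty[simplified ring_of_type_algebra_def])
qed

lemma pow_type_algebra: "x [^]\<^bsub>ring_of_type_algebra\<^esub> (n::nat) = (x::'b::field) ^ n"
  by (induction n) (simp_all add: nat_pow_def ring_of_type_algebra_def)

lemma eval_form_type_algebra: "eval_form ring_of_type_algebra \<phi> F x = type_eval \<phi> F x"
proof -
  have "(\<otimes>\<^bsub>ring_of_type_algebra\<^esub>) = ((*) :: 'a \<Rightarrow> _)"
    by (simp add: ring_of_type_algebra_def)
  then show ?thesis
    unfolding eval_form_def type_eval_def
    by (simp only: pow_type_algebra finprod_type_algebra[OF finite_class.finite_UNIV] finsum_type_algebra[OF finite_keys])
qed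

lemma type_eval_superset:
  assumes "finite A" "Poly_Mapping.keys F \<subseteq> A" "\<phi> 0 = 0"
  shows "type_eval \<phi> F x = (\<Sum>m\<in>A. \<phi> (Poly_Mapping.lookup F m) * (\<Prod>i\<in>UNIV. x i ^ Poly_Mapping.lookup m i))"
  unfolding type_eval_def by (rule sum.mono_neutral_left) (use assms in \<open>auto simp: in_keys_iff\<close>)

lemma type_eval_add:
  assumes "\<phi> 0 = 0" "\<And>a b. \<phi> (a + b) = \<phi> a + \<phi> b"
  shows "type_eval \<phi> (F + G) x = type_eval \<phi> F x + type_eval \<phi> G x"
proof -
  let ?A = "Poly_Mapping.keys F \<union> Poly_Mapping.keys G"
  have "Poly_Mapping.keys (F + G) \<subseteq> ?A" by (rule keys_add)
  then show ?thesis
    by (subst (1 2 3) type_eval_superset[of ?A]) (auto simp: assms lookup_add algebra_simps sum.distrib)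
qed

lemma type_eval_single:
  assumes "\<phi> 0 = 0"
  shows "type_eval \<phi> (Poly_Mapping.single m b) x = \<phi> b * (\<Prod>i\<in>UNIV. x i ^ Poly_Mapping.lookup m i)"
  by (subst type_eval_superset[of "{m}"]) (auto simp: assms)

lemma type_eval_form_sum:
  assumes "\<phi> 0 = 0" "\<And>a b. \<phi> (a + b) = \<phi> a + \<phi> b"
  shows "type_eval \<phi> (form_sum ts) x = (\<Sum>(m, b)\<leftarrow>ts. \<phi> b * (\<Prod>i\<in>UNIV. x i ^ Poly_Mapping.lookup m i))"
proof (induction ts)
  case Nil
  then show ?case by (simp add: form_sum_def type_eval_def)
next
  case (Cons t ts)
  obtain m b where t: "t = (m, b)" by (cases t)
  have "form_sum (t # ts) = Poly_Mapping.single m b + form_sum ts" by (simp add: form_sum_def t)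
  then show ?case using Cons by (simp add: type_eval_add[of \<phi>, OF assms] type_eval_single[of \<phi>, OF assms(1)] t)
qed

lemma partial_deriv_superset:
  assumes "finite A" "Poly_Mapping.keys F \<subseteq> A"
  shows "partial_deriv i F = (\<Sum>m\<in>A. Poly_Mapping.single (m - Poly_Mapping.single i 1)
          (of_nat (Poly_Mapping.lookup m i) * Poly_Mapping.lookup F m))"
  unfolding partial_deriv_def by (rule sum.mono_neutral_left) (use assms in \<open>auto simp: in_keys_iff\<close>)

lemma partial_deriv_add: "partial_deriv i (F + G) = partial_deriv i F + partial_deriv i G"
proof -
  let ?A = "Poly_Mapping.keys F \<union> Poly_Mapping.keys G"
  have "Poly_Mapping.keys (F + G) \<subseteq> ?A" by (rule keys_add)
  then show ?thesis
    by (subst (1 2 3) partial_deriv_superset[of ?A])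
      (auto simp: lookup_add algebra_simps single_add sum.distrib)
qed

lemma partial_deriv_single: "partial_deriv i (Poly_Mapping.single m b) =
   Poly_Mapping.single (m - Poly_Mapping.single i 1) (of_nat (Poly_Mapping.lookup m i) * b)"
  by (subst partial_deriv_superset[of "{m}"]) auto

lemma partial_deriv_form_sum:
  "partial_deriv i (form_sum ts) =
     form_sum (map (\<lambda>(m, b). (m - Poly_Mapping.single i 1, of_nat (Poly_Mapping.lookup m i) * b)) ts)"
proof (induction ts)
  case Nil
  then show ?case by (simp add: form_sum_def partial_deriv_def)
next
  case (Cons t ts)
  obtain m b where t: "t = (m, b)" by (cases t)
  have "form_sum (t # ts) = Poly_Mapping.single m b + form_sum ts" by (simp add: form_sum_def t)
  then show ?case using Cons by (simp add: partial_deriv_add partial_deriv_single t form_sum_def)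
qed

lemma keys_form_sum: "Poly_Mapping.keys (form_sum ts) \<subseteq> fst ` set ts"
proof (induction ts)
  case (Cons t ts)
  obtain m b where t: "t = (m, b)" by (cases t)
  have eq: "form_sum (t # ts) = Poly_Mapping.single m b + form_sum ts" by (simp add: form_sum_def t)
  have "Poly_Mapping.keys (form_sum (t # ts)) \<subseteq> Poly_Mapping.keys (Poly_Mapping.single m b) \<union> Poly_Mapping.keys (form_sum ts)"
    unfolding eq by (rule keys_add)
  with Cons show ?case by (auto simp: t split: if_splits)
qed (simp add: form_sum_def)

definition surface_terms :: "'k::field \<Rightarrow> 'k \<Rightarrow> 'k \<Rightarrow> ((4 \<Rightarrow>\<^sub>0 nat) \<times> 'k) list" where
  "surface_terms e a c =
    [(mon 1 0 2 0, - (e * a)), (mon 0 0 2 1, - (e * a)), (mon 0 0 0 3, e^2 * a), (mon 0 1 1 1, e^2 * a),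
     (mon 0 1 2 0, 5 * c^2 * e), (mon 0 1 0 2, - (5 * c^2 * e^2)), (mon 0 2 1 0, 1 - 5 * c * e),
     (mon 1 1 0 1, - (1 - 5 * c * e)), (mon 2 1 0 0, - 1), (mon 0 3 0 0, e)]"

definition surface :: "'k::field \<Rightarrow> 'k \<Rightarrow> 'k \<Rightarrow> (4 \<Rightarrow>\<^sub>0 nat) \<Rightarrow>\<^sub>0 'k" where
  "surface e a c = form_sum (surface_terms e a c)"

lemma type_eval_surface:
  assumes "\<phi> 0 = 0" "\<phi> 1 = 1" "\<And>x y. \<phi> (x + y) = \<phi> x + \<phi> y" "\<And>x y. \<phi> (x * y) = \<phi> x * \<phi> y"
  shows "type_eval \<phi> (surface e a c) x = surf (\<phi> e) (\<phi> a) (\<phi> c) (x 0) (x 1) (x 2) (x 3)"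
proof -
  have minus: "\<phi> (- y) = - \<phi> y" for y
    using assms(3)[of y "-y"] assms(1) by (simp add: eq_neg_iff_add_eq_0 add.commute)
  have diff: "\<phi> (y - z) = \<phi> y - \<phi> z" for y z
    using assms(3)[of y "-z"] minus by simp
  have pow: "\<phi> (y ^ n) = \<phi> y ^ n" for y n by (induction n) (simp_all add: assms)
  have nat: "\<phi> (of_nat n) = of_nat n" for n by (induction n) (simp_all add: assms)
  have num: "\<phi> (numeral n) = numeral n" for n using nat[of "numeral n"] by simp
  show ?thesis
    unfolding surface_def type_eval_form_sum[of \<phi>, OF assms(1,3)]
    by (simp add: surface_terms_def prod_UNIV_4 lookup_mon surf_def minus diff pow num assms algebra_simps)
qed

lemma cubic_form_surface:
  assumes "e \<noteq> 0"
  shows "cubic_form (surface e a c)"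
  unfolding cubic_form_def
proof
  have "type_eval id (surface e a c) (\<lambda>i. if i = 1 then 1 else 0) = e"
    by (subst type_eval_surface) (simp_all add: surf_def)
  then show "surface e a c \<noteq> 0" using assms by (auto simp: type_eval_def)
  have "Poly_Mapping.keys (surface e a c) \<subseteq> fst ` set (surface_terms e a c)"
    unfolding surface_def by (rule keys_form_sum)
  also have "\<dots> \<subseteq> {m. (\<Sum>i\<in>UNIV. Poly_Mapping.lookup m i) = 3}"
    by (simp add: surface_terms_def sum_UNIV_4 lookup_mon)
  finally show "\<forall>m\<in>Poly_Mapping.keys (surface e a c). (\<Sum>i\<in>UNIV. Poly_Mapping.lookup m i) = 3"
    by blast
qed

lemma mon_minus:
  "mon i j k l - Poly_Mapping.single 0 1 = mon (i - 1) j k l"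
  "mon i j k l - Poly_Mapping.single 1 1 = mon i (j - 1) k l"
  "mon i j k l - Poly_Mapping.single 2 1 = mon i j (k - 1) l"
  "mon i j k l - Poly_Mapping.single 3 1 = mon i j k (l - 1)"
proof -
  have *: "m = m'" if "\<And>x. x \<in> {0,1,2,3} \<Longrightarrow> Poly_Mapping.lookup m x = Poly_Mapping.lookup m' x" for m m' :: "4 \<Rightarrow>\<^sub>0 nat"
    by (rule poly_mapping_eqI) (use that UNIV_4 in blast)
  show "mon i j k l - Poly_Mapping.single 0 1 = mon (i - 1) j k l"
    "mon i j k l - Poly_Mapping.single 1 1 = mon i (j - 1) k l"
    "mon i j k l - Poly_Mapping.single 2 1 = mon i j (k - 1) l"
    "mon i j k l - Poly_Mapping.single 3 1 = mon i j k (l - 1)"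
    by (rule *; elim insertE emptyE; simp add: lookup_minus lookup_single lookup_mon)+
qed

lemma type_eval_partial_deriv_surface:
  fixes x :: "4 \<Rightarrow> 'k::field alg_closure"
  shows "map (\<lambda>i. type_eval to_ac (partial_deriv i (surface e a c)) x) [0,1,2,3] =
    surf_grad (to_ac e) (to_ac a) (to_ac c) (x 0) (x 1) (x 2) (x 3)"
  unfolding surface_def partial_deriv_form_sum 
  by (simp add: type_eval_form_sum[of to_ac] surface_terms_def mon_minus[unfolded One_nat_def] prod_UNIV_4 lookup_mon surf_grad_def algebra_simps power2_eq_square)

section \<open>Smoothness and rational lines\<close>

lemma smooth_surface_surface:
  fixes e a c :: "'k::field_char_0"
  assumes e: "\<And>x. x^2 \<noteq> e" and a: "a \<noteq> 0" and irr: "nonroot_below_5 c a"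
    and d: "11 - 20 * c * e + 5 * c^2 * e^2 \<noteq> 0"
  shows "smooth_surface (surface e a c)"
  unfolding smooth_surface_def
proof (intro notI, elim exE conjE)
  fix x :: "4 \<Rightarrow> 'k alg_closure" and j
  assume x: "x j \<noteq> 0" and D: "\<forall>i. eval_form ring_of_type_algebra to_ac (partial_deriv i (surface e a c)) x = 0"
  define h where "h = (to_ac :: 'k \<Rightarrow> 'k alg_closure)"
  have e0: "e \<noteq> 0" using e[of 0] by auto
  obtain r where r: "r^2 = h e" using nth_root_exists[of 2 "h e"] by auto
  have "surf_grad (h e) (h a) (h c) (x 0) (x 1) (x 2) (x 3) = [0,0,0,0]"
    unfolding h_def type_eval_partial_deriv_surface[symmetric] using D by (simp add: eval_form_type_algebra)
  then have g: "surf_grad (r^2) (h a) (h c) (x 0) (x 1) (x 2) (x 3) = [0,0,0,0]"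
    by (simp add: r)
  have "x i = 0" if "x 0 = 0" "x 1 = 0" "x 2 = 0" "x 3 = 0" for i
  proof -
    have "i \<in> {0,1,2,3}" using UNIV_4 by blast
    with that show ?thesis by auto
  qed
  with x have nz: "\<not> (x 0 = 0 \<and> x 1 = 0 \<and> x 2 = 0 \<and> x 3 = 0)" by blast
  have sep: "t^4 - 3 * h c * t^2 + (h c)^2 \<noteq> 0" if "quintic (h c) (h a) t = 0" for t
  proof
    assume t: "t^4 - 3 * h c * t^2 + (h c)^2 = 0"
    define g where "g = [:c^2, 0, - 3 * c, 0, 1:]"
    have "poly (map_poly to_ac g) t = t^4 - 3 * h c * t^2 + (h c)^2"
      unfolding g_def by (simp add: map_poly_pCons h_def algebra_simps eval_nat_numeral)
    moreover have "degree g < 5" "g \<noteq> 0" by (simp_all add: g_def)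
    ultimately show False using irr that t unfolding nonroot_below_5_def h_def by metis
  qed
  show False
  proof (rule surf_grad_nonzero[OF g _ _ nz sep])
    show "r \<noteq> 0" using r e0 by (auto simp: h_def)
    show "h a \<noteq> 0" using a by (simp add: h_def)
  next
    fix s :: "'k alg_closure" assume s: "s^2 = r^2"
    \<comment> \<open>The relation to be refuted reads \<open>s * h P = h Q\<close>. As
      \<open>P\<close> is nonzero by \<open>d\<close>, it would make \<open>Q / P\<close> a square
      root of \<open>e\<close> in k.\<close>
    define P where "P = e^2 * a * (11 - 20 * c * e + 5 * c^2 * e^2)"
    define Q where "Q = e * (e^2 * a)^2 + (4 - 5 * (1 - c*e)^2) * (5 * (1-c*e)^2 - 5 * (1-c*e) + 1)"
    have r4: "r^4 = (h e)^2" unfolding r[symmetric] by simp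
    have "P \<noteq> 0" using d e0 a by (simp add: P_def)
    then have "h P \<noteq> 0" by (simp add: h_def)
    have "s * h P \<noteq> h Q"
    proof
      assume "s * h P = h Q"
      then have "s = h (Q / P)" using \<open>h P \<noteq> 0\<close> by (simp add: h_def field_simps)
      then have "h ((Q / P)^2) = h e" using s r by (simp add: h_def power_divide)
      then have "(Q / P)^2 = e" by (simp only: h_def to_ac_eq_iff)
      with e show False by blast
    qed
    then show "s * (r ^ 4 * h a * (11 - 20 * h c * r\<^sup>2 + 5 * (h c)\<^sup>2 * r ^ 4)) \<noteq>
         r\<^sup>2 * (r ^ 4 * h a)\<^sup>2 + (4 - 5 * (1 - h c * r\<^sup>2)\<^sup>2) * (5 * (1 - h c * r\<^sup>2)\<^sup>2 - 5 * (1 - h c * r\<^sup>2) + 1)"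
      unfolding r4 r P_def Q_def h_def by simp
  qed
qed

lemma type_algebra_simps:
  "carrier ring_of_type_algebra = UNIV" "x \<otimes>\<^bsub>ring_of_type_algebra\<^esub> y = x * y"
  "x \<oplus>\<^bsub>ring_of_type_algebra\<^esub> y = x + y" "\<zero>\<^bsub>ring_of_type_algebra\<^esub> = 0" "\<one>\<^bsub>ring_of_type_algebra\<^esub> = 1"
  by (simp_all add: ring_of_type_algebra_def)

lemma no_line_surface:
  fixes e a c :: "'k::field_char_0"
  assumes e: "\<And>x. x^2 \<noteq> e" and a: "a \<noteq> 0" and irr: "nonroot_below_5 c a"
  shows "\<not> contains_line ring_of_type_algebra id (surface e a c)"
proof
  assume "contains_line ring_of_type_algebra id (surface e a c)"
  then obtain p q :: "4 \<Rightarrow> 'k" where ind: "\<And>s t. (\<forall>i. s * p i + t * q i = 0) \<Longrightarrow> s = 0 \<and> t = 0"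
    and zero: "\<And>s t. eval_form ring_of_type_algebra id (surface e a c) (\<lambda>i. s * p i + t * q i) = 0"
    unfolding contains_line_def projective_line_def type_algebra_simps by blast
  have "surf e a c (s * p 0 + t * q 0) (s * p 1 + t * q 1) (s * p 2 + t * q 2) (s * p 3 + t * q 3) = 0" for s t
    using zero[of s t] unfolding eval_form_type_algebra by (subst (asm) type_eval_surface) simp_all
  then obtain s t where st: "s \<noteq> 0 \<or> t \<noteq> 0" "s * p 0 + t * q 0 = 0" "s * p 1 + t * q 1 = 0" "s * p 2 + t * q 2 = 0" "s * p 3 + t * q 3 = 0"
    by (rule no_rational_line[OF _ e a irr])
  have "s * p i + t * q i = 0" for i
  proof -
    have "i \<in> {0,1,2,3}" using UNIV_4 by blast
    with st show ?thesis by auto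
  qed
  with ind st(1) show False by blast
qed

text \<open>If a quintic factors properly, one of the two factors has degree 1 or 2. The expressions
  in \<open>quad\<close> are the coefficients of the remainder of the quintic modulo
  \<open>t^2 - s t + p\<close>.\<close>

lemma nonroot_below_5I:
  fixes c a :: "'k::field_char_0"
  assumes root: "\<And>x. quintic c a x \<noteq> 0"
    and quad: "\<And>s p. s^4 - 3 * s^2 * p + p^2 - 5 * c * (s^2 - p) + 5 * c^2 = 0 \<Longrightarrow>
        a \<noteq> - p * (s^3 - 2 * s * p) + 5 * c * p * s"
  shows "nonroot_below_5 c a"
  unfolding nonroot_below_5_def
proof (intro allI impI, elim conjE)
  fix t and g :: "'k poly"
  assume t: "quintic (to_ac c) (to_ac a) t = 0" and g: "degree g < 5" "poly (map_poly to_ac g) t = 0"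
  define f where "f = [: -a, 5 * c^2, 0, -5 * c, 0, 1 :]"
  have pf: "poly f x = quintic c a x" for x
    by (simp add: f_def quintic_def algebra_simps eval_nat_numeral)
  have ft: "poly (map_poly to_ac f) t = 0"
    using t by (simp add: f_def quintic_def map_poly_pCons algebra_simps eval_nat_numeral)
  have f0: "f \<noteq> 0" "degree f = 5" by (simp_all add: f_def)
  have lin: "\<not> d dvd f" if "degree d = 1" for d
  proof
    assume d: "d dvd f"
    have "coeff d 1 \<noteq> 0" using that leading_coeff_neq_0[of d] by fastforce
    then have "poly d (- coeff d 0 / coeff d 1) = 0" using that by (simp add: poly_altdef)
    then obtain x where "poly d x = 0" by blast
    then have "poly f x = 0" using d by (auto elim!: dvdE)
    with pf root show False by simp
  qed
  have quadr: "\<not> d dvd f" if "degree d = 2" for d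
  proof
    assume d: "d dvd f"
    define u where "u = lead_coeff d"
    have u: "u \<noteq> 0" using that by (metis u_def leading_coeff_0_iff degree_0 zero_neq_numeral)
    define s p where "s = - coeff d 1 / u" and "p = coeff d 0 / u"
    have "d = smult u [:p, - s, 1:]"
    proof (rule poly_eqI)
      fix n :: nat
      consider "n = 0" | "n = 1" | "n = 2" | "n > 2" by linarith
      then show "coeff d n = coeff (smult u [:p, - s, 1:]) n"
      proof cases
        case 4
        then have "coeff d n = 0" using that by (intro coeff_eq_0) simp
        moreover have "coeff (smult u [:p, - s, 1:]) n = 0" using 4 by (intro coeff_eq_0) auto
        ultimately show ?thesis by simp
      qed (use u that in \<open>auto simp: s_def p_def u_def numeral_2_eq_2\<close>)
    qed
    then have *: "[:p, - s, 1:] dvd f" using d by (metis smult_dvd_cancel)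
    define r where "r = [:- a - p * (s^3 - 2 * s * p) + 5 * c * p * s, s^4 - 3 * s^2 * p + p^2 - 5 * c * (s^2 - p) + 5 * c^2:]"
    have "f = [:p, - s, 1:] * [:s^3 - 2 * s * p - 5 * c * s, s^2 - p - 5 * c, s, 1:] + r"
      by (simp add: f_def r_def algebra_simps eval_nat_numeral)
    with * have "[:p, - s, 1:] dvd r" by (metis dvd_add_right_iff dvd_triv_left)
    then have "r = 0"
    proof (rule contrapos_pp)
      assume "r \<noteq> 0"
      moreover have "degree r < degree [:p, - s, 1:]" by (simp add: r_def)
      ultimately show "\<not> [:p, - s, 1:] dvd r" using dvd_imp_degree_le leD by blast
    qed
    then have r0: "- a - p * (s^3 - 2 * s * p) + 5 * c * p * s = 0" and r1: "s^4 - 3 * s^2 * p + p^2 - 5 * c * (s^2 - p) + 5 * c^2 = 0"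
      by (simp_all add: r_def)
    have "a = - p * (s^3 - 2 * s * p) + 5 * c * p * s" using r0 by Groebner_Basis.algebra
    with quad[OF r1] show False by blast
  qed
  define Z where "Z = (\<lambda>d. d \<noteq> 0 \<and> poly (map_poly to_ac d) t = 0)"
  show "g = 0"
  proof (rule ccontr)
    assume "g \<noteq> 0"
    then have "Z g" using g by (simp add: Z_def)
    then obtain d where d: "Z d" and min: "\<And>d'. Z d' \<Longrightarrow> degree d \<le> degree d'"
      using ex_has_least_nat[of Z g degree] by blast
    have "degree d < 5" using min[OF \<open>Z g\<close>] g by simp
    have "f mod d = 0"
    proof (rule ccontr)
      assume nz: "f mod d \<noteq> 0"
      have hom: "map_poly to_ac (x + y) = map_poly to_ac x + map_poly to_ac y" 
        "map_poly to_ac (x * y) = map_poly to_ac x * map_poly to_ac y" for x y :: "'k poly"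
        by (rule poly_eqI; simp add: coeff_map_poly coeff_mult to_ac_sum)+
      have "map_poly to_ac f = map_poly to_ac (f div d) * map_poly to_ac d + map_poly to_ac (f mod d)"
        by (simp only: hom[symmetric] div_mult_mod_eq)
      then have "poly (map_poly to_ac (f mod d)) t = 0" using ft d by (simp add: Z_def)
      with nz have "Z (f mod d)" by (simp add: Z_def)
      moreover have "degree (f mod d) < degree d"
        using nz d by (metis Z_def degree_mod_less)
      ultimately show False using min by (metis leD)
    qed
    then have "d dvd f" by auto
    then obtain q where q: "f = d * q" by (elim dvdE)
    then have "degree d + degree q = 5" using f0 by (metis degree_mult_eq mult_eq_0_iff)
    moreover have "degree d \<noteq> 0"
    proof
      assume "degree d = 0"
      then obtain b where "d = [:b:]" by (metis degree_eq_zeroE)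
      with d show False by (auto simp: Z_def map_poly_pCons split: if_splits)
    qed
    moreover have "degree d \<noteq> 1" "degree q \<noteq> 1" "degree d \<noteq> 2" "degree q \<noteq> 2"
      using lin[of d] lin[of q] quadr[of d] quadr[of q] unfolding q by auto
    ultimately show False using \<open>degree d < 5\<close> by linarith
  qed
qed

text \<open>The constant term \<open>p\<close> of a quadratic factor is the product of two fifth
  roots of \<open>a\<close>, so \<open>p^5 = a^2\<close>, and \<open>a / p^2\<close> is a fifth root
  of \<open>a\<close> in k.\<close>

lemma nonroot_pure:
  fixes a :: "'k::field_char_0"
  assumes "\<And>x. x^5 \<noteq> a"
  shows "nonroot_below_5 0 a"
proof (rule nonroot_below_5I)
  show "quintic 0 a x \<noteq> 0" for x using assms[of x] by (simp add: quintic_def)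
next
  fix s p :: 'k assume 1: "s^4 - 3 * s^2 * p + p^2 - 5 * 0 * (s^2 - p) + 5 * 0^2 = 0"
  show "a \<noteq> - p * (s^3 - 2 * s * p) + 5 * 0 * p * s"
  proof
    assume a: "a = - p * (s^3 - 2 * s * p) + 5 * 0 * p * s"
    have "p \<noteq> 0" using a assms[of 0] by auto
    have "a^2 = p^5" using 1 unfolding a mult_zero_left mult_zero_right power_zero_numeral by Groebner_Basis.algebra
    then have "(a / p^2)^5 * p^10 = a * p^10" using \<open>p \<noteq> 0\<close> 
      by (simp add: power_divide flip: power_mult) (simp add: eval_nat_numeral)
    then show False using assms[of "a / p^2"] \<open>p \<noteq> 0\<close> by simp
  qed
qed

text \<open>The roots are t_m = z^m u + z^(-m) / u with z a primitive fifth root of unity, and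
  t_(m+d) + t_(m-d) = (z^d + z^(-d)) t_m. Hence the sum \<open>s\<close> of two roots, divided by a
  suitable \<beta> with \<beta>^2 + \<beta> = 1, is again a root. Since 5 is a square, \<beta> lies
  in k, and its inverse is \<beta> + 1.\<close>

lemma nonroot_dickson:
  fixes a q :: "'k::field_char_0"
  assumes root: "\<And>x. quintic 1 a x \<noteq> 0" and q: "q^2 = 5"
  shows "nonroot_below_5 1 a"
proof (rule nonroot_below_5I[OF root])
  fix s p :: 'k assume 1: "s^4 - 3 * s^2 * p + p^2 - 5 * 1 * (s^2 - p) + 5 * 1^2 = 0"
  show "a \<noteq> - p * (s^3 - 2 * s * p) + 5 * 1 * p * s"
  proof
    assume a: "a = - p * (s^3 - 2 * s * p) + 5 * 1 * p * s"
    have key: False if \<alpha>: "\<alpha>^2 + \<alpha> = 1" and p: "s^2 - (2 + \<alpha>) * p - 3 - \<alpha> = 0" for \<alpha>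
    proof -
      define \<beta> where "\<beta> = - 1 - \<alpha>"
      have \<beta>: "\<beta> * (\<beta> + 1) = 1" using \<alpha> unfolding \<beta>_def by Groebner_Basis.algebra
      have p': "p = s^2 * (\<beta> + 1)^2 - (2 - \<beta>) * (\<beta> + 1)^2"
        using p \<alpha> unfolding \<beta>_def by Groebner_Basis.algebra
      have "quintic 1 a (s * (\<beta> + 1)) = 0"
        using \<beta> unfolding quintic_def a p' power_one mult_1_right by Groebner_Basis.algebra
      with root show False by blast
    qed
    have "(s^2 - (2 + (- 1 + q) / 2) * p - 3 - (- 1 + q) / 2) * (s^2 - (2 + (- 1 - q) / 2) * p - 3 - (- 1 - q) / 2) = 0"
      using 1 q by (simp add: field_simps) Groebner_Basis.algebra
    moreover have "((- 1 + q) / 2)^2 + (- 1 + q) / 2 = 1" "((- 1 - q) / 2)^2 + (- 1 - q) / 2 = 1"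
      using q by (simp_all add: power2_eq_square field_simps)
    ultimately show False using key[of "(- 1 + q) / 2"] key[of "(- 1 - q) / 2"] by auto
  qed
qed

section \<open>Absolute values and lines over completions\<close>

lemma hom_finprod:
  assumes "ring_hom_ring R S h" "cring R" "cring S" "finite A" "f \<in> A \<rightarrow> carrier R"
  shows "h (finprod R f A) = finprod S (h \<circ> f) A"
proof -
  interpret R: cring R by fact
  interpret S: cring S by fact
  interpret h: ring_hom_ring R S h by fact
  show ?thesis using assms(4,5)
  proof (induction A)
    case (insert a A)
    then have "f x \<in> carrier R" if "x \<in> insert a A" for x using that by auto
    with insert show ?case by (simp add: Pi_def)
  qed simp
qed

text \<open>Applied to two homomorphisms out of the ring of Cauchy sequences: evaluation at an index
  and the quotient map to the completion.\<close>

lemma hom_eval_form: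
  assumes "ring_hom_ring R S h" "cring R" "cring S" "\<And>b. \<phi> b \<in> carrier R" "\<And>i. x i \<in> carrier R"
  shows "h (eval_form R \<phi> F x) = eval_form S (h \<circ> \<phi>) F (h \<circ> x)"
proof -
  interpret R: cring R by fact
  interpret S: cring S by fact
  interpret h: ring_hom_ring R S h by fact
  have pow: "h (y [^]\<^bsub>R\<^esub> (n::nat)) = h y [^]\<^bsub>S\<^esub> n" if "y \<in> carrier R" for y n
    using that by (induction n) simp_all
  have prod: "h (\<Otimes>\<^bsub>R\<^esub>i\<in>(UNIV :: 4 set). x i [^]\<^bsub>R\<^esub> Poly_Mapping.lookup m i) =
      (\<Otimes>\<^bsub>S\<^esub>i\<in>(UNIV :: 4 set). h (x i) [^]\<^bsub>S\<^esub> Poly_Mapping.lookup m i)" for m :: "4 \<Rightarrow>\<^sub>0 nat"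
    by (subst hom_finprod[OF assms(1-3)])
      (auto simp: pow[OF assms(5)] intro!: S.finprod_cong' R.nat_pow_closed S.nat_pow_closed h.hom_closed assms(5))
  have "(\<Otimes>\<^bsub>R\<^esub>i\<in>(UNIV :: 4 set). x i [^]\<^bsub>R\<^esub> Poly_Mapping.lookup m i) \<in> carrier R" for m :: "4 \<Rightarrow>\<^sub>0 nat"
    using assms(5) by (intro R.finprod_closed) auto
  then show ?thesis
    unfolding eval_form_def
    by (subst h.hom_finsum) (auto simp: o_def assms(4) prod intro!: S.finsum_cong' simp: assms(5))
qed


section \<open>Cauchy sequences and the completion\<close>

locale abs_val =
  fixes v :: "'k::field_char_0 \<Rightarrow> real"
  assumes absolute_value: "absolute_value v"
begin

lemma v_nonneg [simp]: "0 \<le> v x"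
  and v_eq_0_iff [simp]: "v x = 0 \<longleftrightarrow> x = 0"
  and v_mult: "v (x * y) = v x * v y"
  and v_add_le: "v (x + y) \<le> v x + v y"
  and v_nontrivial: "\<exists>x. x \<noteq> 0 \<and> v x \<noteq> 1"
  using absolute_value unfolding absolute_value_def by blast+

lemma v_0 [simp]: "v 0 = 0" by simp

lemma v_1 [simp]: "v 1 = 1"
proof -
  have "v 1 * v 1 = v 1 * 1" using v_mult[of 1 1] by simp
  moreover have "v 1 \<noteq> 0" by simp
  ultimately show ?thesis by (metis mult_left_cancel)
qed

lemma v_pos_iff [simp]: "0 < v x \<longleftrightarrow> x \<noteq> 0"
  using v_nonneg[of x] v_eq_0_iff[of x] by linarith

lemma v_minus [simp]: "v (- x) = v x"
proof -
  have "v (- 1) * v (- 1) = 1" using v_mult[of "-1" "-1"] by simp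
  then have "v (- 1) = 1" using v_nonneg[of "-1"] by (metis abs_of_nonneg abs_mult_self_eq power2_eq_square real_sqrt_abs real_sqrt_one)
  then show ?thesis using v_mult[of "-1" x] by simp
qed

lemma v_minus_commute: "v (x - y) = v (y - x)"
  by (metis minus_diff_eq v_minus)

lemma v_diff_le: "v (x - y) \<le> v x + v y"
  using v_add_le[of x "-y"] by simp

lemma v_power: "v (x ^ n) = v x ^ n"
  by (induction n) (simp_all add: v_mult)

lemma v_inverse: "v (inverse x) = inverse (v x)"
proof (cases "x = 0")
  case False
  then have "v x * v (inverse x) = 1" by (simp flip: v_mult)
  with False show ?thesis by (simp add: field_simps)
qed simp

lemma v_divide: "v (x / y) = v x / v y"
  by (simp add: divide_inverse v_mult v_inverse)

lemma abs_v_diff_le: "\<bar>v x - v y\<bar> \<le> v (x - y)"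
  using v_add_le[of "x - y" y] v_add_le[of "y - x" x] v_minus_commute[of x y] by simp

definition cauchy :: "(nat \<Rightarrow> 'k) \<Rightarrow> bool" where "cauchy = cauchy_wrt v"

definition null :: "(nat \<Rightarrow> 'k) \<Rightarrow> bool" where "null s \<longleftrightarrow> (\<lambda>n. v (s n)) \<longlonglongrightarrow> 0"

lemma null_iff: "null s \<longleftrightarrow> (\<forall>e>0. \<exists>N. \<forall>n\<ge>N. v (s n) < e)"
  by (simp add: null_def LIMSEQ_def)

lemma cauchy_bounded: assumes "cauchy s" obtains B where "B > 0" "\<And>n. v (s n) \<le> B"
proof -
  obtain N where N: "\<And>m n. m \<ge> N \<Longrightarrow> n \<ge> N \<Longrightarrow> v (s m - s n) < 1"
    using assms unfolding cauchy_def cauchy_wrt_def by (metis zero_less_one)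
  define B where "B = 1 + v (s N) + (\<Sum>i<N. v (s i))"
  have B: "v (s n) \<le> B" for n
  proof (cases "n < N")
    case True
    then have "v (s n) \<le> (\<Sum>i<N. v (s i))" by (intro member_le_sum) auto
    then show ?thesis using v_nonneg[of "s N"] unfolding B_def by linarith
  next
    case False
    then have "v (s n - s N) < 1" using N by simp
    moreover have "v (s n) \<le> v (s n - s N) + v (s N)" using v_add_le[of "s n - s N" "s N"] by simp
    moreover have "(\<Sum>i<N. v (s i)) \<ge> 0" by (simp add: sum_nonneg)
    ultimately show ?thesis by (simp add: B_def)
  qed
  have "B > 0" using v_nonneg[of "s N"] by (simp add: B_def add_pos_nonneg sum_nonneg)
  with B that show ?thesis by blast
qed

lemma cauchy_const [simp]: "cauchy (\<lambda>n. x)"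
  by (simp add: cauchy_def cauchy_wrt_def)

lemma cauchy_add: assumes "cauchy s" "cauchy t" shows "cauchy (\<lambda>n. s n + t n)"
  unfolding cauchy_def cauchy_wrt_def
proof (intro allI impI)
  fix e :: real assume "e > 0"
  then have "e / 2 > 0" by simp
  then obtain M N where "\<forall>m\<ge>M. \<forall>n\<ge>M. v (s m - s n) < e / 2" "\<forall>m\<ge>N. \<forall>n\<ge>N. v (t m - t n) < e / 2"
    using assms unfolding cauchy_def cauchy_wrt_def by metis
  moreover have "v (s m + t m - (s n + t n)) \<le> v (s m - s n) + v (t m - t n)" for m n
    using v_add_le[of "s m - s n" "t m - t n"] by (simp add: algebra_simps)
  ultimately have "\<forall>m\<ge>max M N. \<forall>n\<ge>max M N. v (s m + t m - (s n + t n)) < e"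
    by (smt (verit) field_sum_of_halves max.bounded_iff)
  then show "\<exists>N. \<forall>m\<ge>N. \<forall>n\<ge>N. v (s m + t m - (s n + t n)) < e" by blast
qed

lemma cauchy_mult: assumes "cauchy s" "cauchy t" shows "cauchy (\<lambda>n. s n * t n)"
  unfolding cauchy_def cauchy_wrt_def
proof (intro allI impI)
  fix e :: real assume e: "e > 0"
  obtain A B where A: "A > 0" "\<And>n. v (s n) \<le> A" and B: "B > 0" "\<And>n. v (t n) \<le> B"
    using assms cauchy_bounded by metis
  have "e / (2 * A) > 0" "e / (2 * B) > 0" using A B e by simp_all
  then obtain M N where M: "\<forall>m\<ge>M. \<forall>n\<ge>M. v (s m - s n) < e / (2 * B)" and N: "\<forall>m\<ge>N. \<forall>n\<ge>N. v (t m - t n) < e / (2 * A)"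
    using assms unfolding cauchy_def cauchy_wrt_def by metis
  have "v (s m * t m - s n * t n) < e" if "m \<ge> max M N" "n \<ge> max M N" for m n
  proof -
    have "s m * t m - s n * t n = s m * (t m - t n) + (s m - s n) * t n" by (simp add: algebra_simps)
    then have "v (s m * t m - s n * t n) \<le> v (s m) * v (t m - t n) + v (s m - s n) * v (t n)"
      using v_add_le by (metis v_mult)
    also have "\<dots> \<le> A * v (t m - t n) + v (s m - s n) * B"
      by (intro add_mono mult_mono) (use A B in auto)
    also have "\<dots> < A * (e / (2 * A)) + e / (2 * B) * B"
      by (intro add_strict_mono mult_strict_left_mono mult_strict_right_mono) (use A B M N that in auto)
    also have "\<dots> = e" using A(1) B(1) by (simp add: field_simps)
    finally show ?thesis .
  qed
  then show "\<exists>N. \<forall>m\<ge>N. \<forall>n\<ge>N. v (s m * t m - s n * t n) < e" by blast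
qed

lemma cauchy_minus: assumes "cauchy s" shows "cauchy (\<lambda>n. - s n)"
  using cauchy_mult[OF cauchy_const[of "-1"] assms] by simp

lemma cauchy_diff: assumes "cauchy s" "cauchy t" shows "cauchy (\<lambda>n. s n - t n)"
  using cauchy_add[OF assms(1) cauchy_minus[OF assms(2)]] by simp

lemma cauchy_power: assumes "cauchy s" shows "cauchy (\<lambda>n. s n ^ k)"
  by (induction k) (simp_all add: cauchy_mult assms)

lemma null_imp_cauchy: assumes "null s" shows "cauchy s"
  unfolding cauchy_def cauchy_wrt_def
proof (intro allI impI)
  fix e :: real assume "e > 0"
  then have "e / 2 > 0" by simp
  then obtain N where "\<forall>n\<ge>N. v (s n) < e / 2" using assms unfolding null_iff by metis
  then show "\<exists>N. \<forall>m\<ge>N. \<forall>n\<ge>N. v (s m - s n) < e"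
    using v_diff_le by (smt (verit) field_sum_of_halves)
qed

lemma null_0 [simp]: "null (\<lambda>n. 0)" by (simp add: null_def)

lemma null_add: assumes "null s" "null t" shows "null (\<lambda>n. s n + t n)"
proof -
  have "(\<lambda>n. v (s n) + v (t n)) \<longlonglongrightarrow> 0" using tendsto_add assms unfolding null_def by force
  then show ?thesis unfolding null_def
    by (rule tendsto_sandwich[OF _ _ tendsto_const, rotated 2]) (simp_all add: v_add_le)
qed

lemma null_mult_cauchy: assumes "null s" "cauchy t" shows "null (\<lambda>n. s n * t n)"
proof -
  obtain B where B: "B > 0" "\<And>n. v (t n) \<le> B" using assms cauchy_bounded by metis
  have "(\<lambda>n. v (s n) * B) \<longlonglongrightarrow> 0" using tendsto_mult_left_zero assms unfolding null_def by force
  then show ?thesis unfolding null_def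
    by (rule tendsto_sandwich[OF _ _ tendsto_const, rotated 2]) (simp_all add: v_mult B mult_left_mono)
qed

lemma null_cauchy_mult: assumes "cauchy s" "null t" shows "null (\<lambda>n. s n * t n)"
  using null_mult_cauchy[OF assms(2,1)] by (simp add: mult.commute)

lemma null_minus: "null (\<lambda>n. - s n) \<longleftrightarrow> null s" by (simp add: null_def)

lemma null_diff: assumes "null s" "null t" shows "null (\<lambda>n. s n - t n)"
  using null_add[OF assms(1), of "\<lambda>n. - t n"] assms(2) by (simp add: null_minus)

lemma null_const_iff [simp]: "null (\<lambda>n. x) \<longleftrightarrow> x = 0"
  by (simp add: null_def LIMSEQ_const_iff)

lemma cauchy_v_convergent: assumes "cauchy s" shows "convergent (\<lambda>n. v (s n))"
  unfolding Cauchy_convergent_iff[symmetric]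
proof (rule metric_CauchyI)
  fix e :: real assume "e > 0"
  then obtain N where "\<forall>m\<ge>N. \<forall>n\<ge>N. v (s m - s n) < e" using assms unfolding cauchy_def cauchy_wrt_def by metis
  then show "\<exists>M. \<forall>m\<ge>M. \<forall>n\<ge>M. dist (v (s m)) (v (s n)) < e"
    using abs_v_diff_le unfolding dist_real_def by (meson le_less_trans)
qed

text \<open>The completion has no zero divisors, expressed on sequences: absolute values of Cauchy
  sequences converge, and their limits multiply.\<close>

lemma null_mult_imp: assumes "cauchy s" "cauchy t" "null (\<lambda>n. s n * t n)" shows "null s \<or> null t"
proof -
  obtain a b where ab: "(\<lambda>n. v (s n)) \<longlonglongrightarrow> a" "(\<lambda>n. v (t n)) \<longlonglongrightarrow> b"
    using assms cauchy_v_convergent unfolding convergent_def by metis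
  then have "(\<lambda>n. v (s n * t n)) \<longlonglongrightarrow> a * b" unfolding v_mult by (rule tendsto_mult)
  with assms(3) have "a * b = 0" unfolding null_def using LIMSEQ_unique by blast
  with ab show ?thesis unfolding null_def by auto
qed

lemma cauchy_ring_simps:
  "carrier (cauchy_ring v) = {s. cauchy s}" "x \<otimes>\<^bsub>cauchy_ring v\<^esub> y = (\<lambda>n. x n * y n)"
  "x \<oplus>\<^bsub>cauchy_ring v\<^esub> y = (\<lambda>n. x n + y n)" "\<zero>\<^bsub>cauchy_ring v\<^esub> = (\<lambda>n. 0)" "\<one>\<^bsub>cauchy_ring v\<^esub> = (\<lambda>n. 1)"
  by (simp_all add: cauchy_ring_def cauchy_def)

lemma cring_cauchy_ring: "cring (cauchy_ring v)"
proof (rule cringI)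
  show "abelian_group (cauchy_ring v)"
  proof (rule abelian_groupI; unfold cauchy_ring_simps)
    fix x assume "x \<in> Collect cauchy"
    then show "\<exists>y\<in>Collect cauchy. (\<lambda>n. y n + x n) = (\<lambda>n. 0)"
      by (intro bexI[of _ "\<lambda>n. - x n"]) (simp_all add: cauchy_minus)
  qed (simp_all add: cauchy_add ac_simps)
  show "Group.comm_monoid (cauchy_ring v)"
    by (rule comm_monoidI) (simp_all add: cauchy_ring_simps cauchy_mult ac_simps)
qed (simp add: cauchy_ring_simps algebra_simps)

lemma ideal_null_sequences: "ideal (null_sequences v) (cauchy_ring v)"
proof (rule idealI)
  interpret cring "cauchy_ring v" by (rule cring_cauchy_ring)
  show "ring (cauchy_ring v)" ..
  have mem: "s \<in> null_sequences v \<longleftrightarrow> null s" for s by (simp add: null_sequences_def null_def)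
  have inv: "inv\<^bsub>add_monoid (cauchy_ring v)\<^esub> s = (\<lambda>n. - s n)" if "cauchy s" for s
  proof -
    have "\<ominus>\<^bsub>cauchy_ring v\<^esub> s = (\<lambda>n. - s n)"
      by (rule minus_equality) (simp_all add: cauchy_ring_simps that cauchy_minus)
    then show ?thesis by (simp add: a_inv_def)
  qed
  show "subgroup (null_sequences v) (add_monoid (cauchy_ring v))"
  proof (rule group.subgroupI)
    show "Group.group (add_monoid (cauchy_ring v))" using a_group .
    show "null_sequences v \<noteq> {}" using mem null_0 by blast
    show "inv\<^bsub>add_monoid (cauchy_ring v)\<^esub> s \<in> null_sequences v" if "s \<in> null_sequences v" for s
      using that inv null_imp_cauchy by (simp add: mem null_minus)
  qed (auto simp: mem cauchy_ring_simps null_imp_cauchy null_add)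
qed (simp_all add: cauchy_ring_simps null_sequences_def null_mult_cauchy[unfolded null_def] null_cauchy_mult[unfolded null_def])


text \<open>Moves the search for a line from the completion to sequences in k. The identity block in
  the coordinates j and k makes the two spanning vectors independent, and as every element of the
  completion is the class of a Cauchy sequence, \<open>zero\<close> covers all points of the
  line.\<close>

lemma contains_line_completionI:
  assumes p: "\<And>i. cauchy (p i)" and q: "\<And>i. cauchy (q i)"
    and pq: "p j = (\<lambda>n. 1)" "p k = (\<lambda>n. 0)" "q j = (\<lambda>n. 0)" "q k = (\<lambda>n. 1)"
    and zero: "\<And>s t. cauchy s \<Longrightarrow> cauchy t \<Longrightarrow> null (\<lambda>n. type_eval id F (\<lambda>i. s n * p i n + t n * q i n))"
  shows "contains_line (completion v) (to_completion v) F"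
proof -
  define R where "R = cauchy_ring v"
  define I where "I = null_sequences v"
  define h where "h = (\<lambda>s. I +>\<^bsub>R\<^esub> s)"
  define K where "K = completion v"
  have K: "K = R Quot I" by (simp add: K_def completion_def R_def I_def)
  interpret R: cring R unfolding R_def by (rule cring_cauchy_ring)
  interpret I: ideal I R unfolding R_def I_def by (rule ideal_null_sequences)
  interpret K: cring K unfolding K by (rule I.quotient_is_cring) (rule R.is_cring)
  interpret h: ring_hom_ring R K h
    using I.rcos_ring_hom_ring unfolding K h_def .
  have carrier: "s \<in> carrier R \<longleftrightarrow> cauchy s" for s by (simp add: R_def cauchy_ring_simps)
  have Kcar: "\<exists>s. cauchy s \<and> x = h s" if "x \<in> carrier K" for x
    using that unfolding K FactRing_def h_def A_RCOSETS_def' by (auto simp: carrier)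
  have h0: "h s = \<zero>\<^bsub>K\<^esub> \<longleftrightarrow> null s" if "cauchy s" for s
  proof -
    have "h s = \<zero>\<^bsub>K\<^esub> \<longleftrightarrow> s \<in> I"
      using that I.rcos_const_imp_mem[of s] R.a_rcos_zero[OF I.is_ideal, of s]
      unfolding h_def K FactRing_def by (auto simp: carrier)
    then show ?thesis by (simp add: I_def null_sequences_def null_def)
  qed
  have Rs: "x \<otimes>\<^bsub>R\<^esub> y = (\<lambda>n. x n * y n)" "x \<oplus>\<^bsub>R\<^esub> y = (\<lambda>n. x n + y n)" "\<zero>\<^bsub>R\<^esub> = (\<lambda>n. 0)" "\<one>\<^bsub>R\<^esub> = (\<lambda>n. 1)" for x y
    unfolding R_def by (rule cauchy_ring_simps)+
  have comb: "h s \<otimes>\<^bsub>K\<^esub> h x \<oplus>\<^bsub>K\<^esub> h t \<otimes>\<^bsub>K\<^esub> h y = h (\<lambda>n. s n * x n + t n * y n)"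
    if "cauchy s" "cauchy t" "cauchy x" "cauchy y" for s t x y
  proof -
    have "h s \<otimes>\<^bsub>K\<^esub> h x \<oplus>\<^bsub>K\<^esub> h t \<otimes>\<^bsub>K\<^esub> h y = h (s \<otimes>\<^bsub>R\<^esub> x \<oplus>\<^bsub>R\<^esub> t \<otimes>\<^bsub>R\<^esub> y)"
      using that[folded carrier] by simp
    then show ?thesis by (simp add: Rs)
  qed
  have eval: "eval_form K (to_completion v) F (\<lambda>i. h (x i)) = h (\<lambda>n. type_eval id F (\<lambda>i. x i n))" if x: "\<And>i. cauchy (x i)" for x
  proof -
    define T where "T = (ring_of_type_algebra :: 'k ring)"
    interpret T: cring T unfolding T_def by (rule cring_from_type_algebra)
    have "eval_form R (\<lambda>b n. b) F x n = type_eval id F (\<lambda>i. x i n)" for n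
    proof -
      have "ring_hom_ring R T (\<lambda>s. s n)"
        by (rule ring_hom_ringI[OF R.ring_axioms T.ring_axioms]) (simp_all add: T_def type_algebra_simps Rs)
      from hom_eval_form[OF this R.is_cring T.is_cring, of "\<lambda>b n. b" x F] show ?thesis
        using x by (simp add: carrier o_def T_def eval_form_type_algebra id_def)
    qed
    then have "eval_form R (\<lambda>b n. b) F x = (\<lambda>n. type_eval id F (\<lambda>i. x i n))" by (rule ext)
    then have "h (\<lambda>n. type_eval id F (\<lambda>i. x i n)) = h (eval_form R (\<lambda>b n. b) F x)" by simp
    also have "\<dots> = eval_form K (h \<circ> (\<lambda>b n. b)) F (h \<circ> x)"
      by (rule hom_eval_form[OF h.ring_hom_ring_axioms R.is_cring K.is_cring]) (simp_all add: carrier x)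
    also have "h \<circ> (\<lambda>b n. b) = to_completion v"
      by (simp add: fun_eq_iff to_completion_def h_def I_def R_def)
    finally show ?thesis by (simp only: o_def)
  qed
  define L where "L = {(\<lambda>i. s \<otimes>\<^bsub>K\<^esub> h (p i) \<oplus>\<^bsub>K\<^esub> t \<otimes>\<^bsub>K\<^esub> h (q i)) | s t. s \<in> carrier K \<and> t \<in> carrier K}"
  have "projective_line K L"
    unfolding projective_line_def
  proof (rule bexI[of _ "\<lambda>i. h (p i)"], rule bexI[of _ "\<lambda>i. h (q i)"], intro conjI ballI impI)
    fix s t assume "s \<in> carrier K" "t \<in> carrier K"
      and st: "\<forall>i. s \<otimes>\<^bsub>K\<^esub> h (p i) \<oplus>\<^bsub>K\<^esub> t \<otimes>\<^bsub>K\<^esub> h (q i) = \<zero>\<^bsub>K\<^esub>"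
    then obtain s' t' where s: "cauchy s'" "s = h s'" and t: "cauchy t'" "t = h t'" using Kcar by metis
    have z: "h (\<lambda>n. s' n * p i n + t' n * q i n) = \<zero>\<^bsub>K\<^esub>" for i
      using st[rule_format, of i] unfolding s t comb[OF s(1) t(1) p q] .
    show "s = \<zero>\<^bsub>K\<^esub>" unfolding s using z[of j] by (simp only: pq mult_1_right mult_zero_right add_0_right)
    show "t = \<zero>\<^bsub>K\<^esub>" unfolding t using z[of k] by (simp only: pq mult_1_right mult_zero_right add_0_left)
  next
    show "L = {\<lambda>i. s \<otimes>\<^bsub>K\<^esub> h (p i) \<oplus>\<^bsub>K\<^esub> t \<otimes>\<^bsub>K\<^esub> h (q i) |s t. s \<in> carrier K \<and> t \<in> carrier K}"
      by (rule L_def)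
    have "h (p i) \<in> carrier K" "h (q i) \<in> carrier K" for i
      by (intro h.hom_closed; simp only: carrier p q)+
    then show "(\<lambda>i. h (p i)) \<in> UNIV \<rightarrow> carrier K" "(\<lambda>i. h (q i)) \<in> UNIV \<rightarrow> carrier K" by simp_all
  qed
  moreover have "eval_form K (to_completion v) F x = \<zero>\<^bsub>K\<^esub>" if "x \<in> L" for x
  proof -
    from that obtain s t where st: "s \<in> carrier K" "t \<in> carrier K"
      and x: "x = (\<lambda>i. s \<otimes>\<^bsub>K\<^esub> h (p i) \<oplus>\<^bsub>K\<^esub> t \<otimes>\<^bsub>K\<^esub> h (q i))"
      unfolding L_def mem_Collect_eq by (elim exE conjE)
    from Kcar[OF st(1)] obtain s' where s: "cauchy s'" "s = h s'" by (elim exE conjE)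
    from Kcar[OF st(2)] obtain t' where t: "cauchy t'" "t = h t'" by (elim exE conjE)
    have "x = (\<lambda>i. h (\<lambda>n. s' n * p i n + t' n * q i n))"
      unfolding x s t comb[OF s(1) t(1) p q] by (rule refl)
    then have "eval_form K (to_completion v) F x = h (\<lambda>n. type_eval id F (\<lambda>i. s' n * p i n + t' n * q i n))"
      using eval[of "\<lambda>i n. s' n * p i n + t' n * q i n"] by (simp only: cauchy_add cauchy_mult p q s(1) t(1))
    also have "\<dots> = \<zero>\<^bsub>K\<^esub>"
      using zero[OF s(1) t(1)] by (subst h0) (simp_all only: null_imp_cauchy)
    finally show ?thesis .
  qed
  ultimately show ?thesis unfolding contains_line_def K_def[symmetric] by (intro exI[of _ L] conjI ballI)
qed

text \<open>For any r, the form restricted to \<open>x0 + r * x1 = x2 + r * x3 = 0\<close> is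
  divisible by \<open>r^2 - e\<close>, so an approximate square root gives values tending to
  0.\<close>

lemma line_if_sqrt:
  assumes r: "cauchy r" "null (\<lambda>n. r n ^ 2 - e)"
  shows "contains_line (completion v) (to_completion v) (surface e a c)"
proof (rule contains_line_completionI[where j = 1 and k = 3])
  let ?p = "\<lambda>i::4. if i = 0 then (\<lambda>n. - r n) else if i = 1 then (\<lambda>n. 1) else (\<lambda>n. 0)"
  let ?q = "\<lambda>i::4. if i = 2 then (\<lambda>n. - r n) else if i = 3 then (\<lambda>n. 1) else (\<lambda>n. 0)"
  show "cauchy (?p i)" "cauchy (?q i)" for i
    using r by (simp_all add: cauchy_minus)
  show "?p 1 = (\<lambda>n. 1)" "?p 3 = (\<lambda>n. 0)" "?q 1 = (\<lambda>n. 0)" "?q 3 = (\<lambda>n. 1)" by simp_all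
  fix x y assume xy: "cauchy x" "cauchy y"
  have "surf e a c (- (x n * r n)) (x n) (- (y n * r n)) (y n) =
      (r n ^ 2 - e) * (e * a * r n * x n * y n ^ 2 - e * a * y n ^ 3 + 5 * c^2 * e * x n * y n ^ 2 - x n ^ 3)" for n
    unfolding surf_def by Groebner_Basis.algebra
  moreover have "type_eval id (surface e a c) (\<lambda>i. x n * ?p i n + y n * ?q i n) =
      surf e a c (- (x n * r n)) (x n) (- (y n * r n)) (y n)" for n
    by (subst type_eval_surface) simp_all
  moreover have "null (\<lambda>n. (r n ^ 2 - e) * (e * a * r n * x n * y n ^ 2 - e * a * y n ^ 3 + 5 * c^2 * e * x n * y n ^ 2 - x n ^ 3))"
    by (intro null_mult_cauchy r cauchy_add cauchy_diff cauchy_mult cauchy_power cauchy_const xy)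
  ultimately show "null (\<lambda>n. type_eval id (surface e a c) (\<lambda>i. x n * ?p i n + y n * ?q i n))"
    by (simp only:)
qed

text \<open>For any t, root or not, the form restricted to the line attached to t is divisible by
  \<open>quintic c a t\<close>.\<close>

lemma line_if_root:
  assumes r: "cauchy t" "null (\<lambda>n. quintic c a (t n))"
  shows "contains_line (completion v) (to_completion v) (surface e a c)"
proof (rule contains_line_completionI[where j = 2 and k = 3])
  let ?p = "\<lambda>i::4. if i = 0 then t else if i = 1 then (\<lambda>n. t n ^ 2) else if i = 2 then (\<lambda>n. 1) else (\<lambda>n. 0)"
  let ?q = "\<lambda>i::4. if i = 0 then (\<lambda>n. e * t n ^ 2) else if i = 1 then t else if i = 2 then (\<lambda>n. 0) else (\<lambda>n. 1)"
  show "cauchy (?p i)" "cauchy (?q i)" for i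
    using r by (simp_all add: cauchy_mult cauchy_power)
  show "?p 2 = (\<lambda>n. 1)" "?p 3 = (\<lambda>n. 0)" "?q 2 = (\<lambda>n. 0)" "?q 3 = (\<lambda>n. 1)" by simp_all
  fix x y assume xy: "cauchy x" "cauchy y"
  have "surf e a c (x n * t n + y n * (e * t n ^ 2)) (x n * t n ^ 2 + y n * t n) (x n) (y n) =
      quintic c a (t n) * (e * (x n ^ 2 - e * y n ^ 2) * (t n * x n + y n))" for n
    unfolding surf_def quintic_def by Groebner_Basis.algebra
  moreover have "type_eval id (surface e a c) (\<lambda>i. x n * ?p i n + y n * ?q i n) =
      surf e a c (x n * t n + y n * (e * t n ^ 2)) (x n * t n ^ 2 + y n * t n) (x n) (y n)" for n
    by (subst type_eval_surface) simp_all
  moreover have "null (\<lambda>n. quintic c a (t n) * (e * (x n ^ 2 - e * y n ^ 2) * (t n * x n + y n)))"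
    by (intro null_mult_cauchy r cauchy_add cauchy_diff cauchy_mult cauchy_power cauchy_const xy)
  ultimately show "null (\<lambda>n. type_eval id (surface e a c) (\<lambda>i. x n * ?p i n + y n * ?q i n))"
    by (simp only:)
qed

end

section \<open>Relations in number fields and non-archimedean absolute values\<close>

text \<open>If \<open>x ^ n\<close> is at most linear in n, then x is at most 1. Both the
  ultrametric inequality and Ostrowski's comparison are obtained by taking high powers and then
  applying this.\<close>

lemma exponential_exceeds_linear:
  fixes x :: real
  assumes "x > 1"
  shows "\<exists>n. x ^ n > A * (real n + 1)"
proof -
  have *: "norm (1 / x) < 1" using assms by simp
  have "(\<lambda>n. A * (real n * (1 / x) ^ n + (1 / x) ^ n)) \<longlonglongrightarrow> A * (0 + 0)"
    by (intro tendsto_intros powser_times_n_limit_0[OF *] LIMSEQ_power_zero[OF *])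
  then have "eventually (\<lambda>n. A * (real n * (1 / x) ^ n + (1 / x) ^ n) < 1) sequentially"
    using order_tendstoD(2)[of _ "A * (0 + 0)" sequentially 1] by simp
  then obtain n where n: "A * (real n * (1 / x) ^ n + (1 / x) ^ n) < 1"
    by (auto simp: eventually_sequentially)
  have "A * (real n + 1) = A * (real n * (1 / x) ^ n + (1 / x) ^ n) * x ^ n"
    using assms by (simp add: field_simps)
  also have "\<dots> < 1 * x ^ n"
    using n assms by (intro mult_strict_right_mono) simp_all
  finally show ?thesis by auto
qed

text \<open>The bound \<open>n\<close> depends on the field alone, not on the elements
  \<open>b\<close>; everything that uses finiteness of the degree rests on this uniformity.\<close>

lemma number_field_relation:
  assumes "number_field TYPE('k::field_char_0)"
  obtains n where "\<And>b :: nat \<Rightarrow> 'k. \<exists>c :: nat \<Rightarrow> rat. (\<exists>i\<le>n. c i \<noteq> 0) \<and> (\<Sum>i\<le>n. of_rat (c i) * b i) = 0"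
proof -
  define sc where "sc = (\<lambda>(r::rat) (x::'k). of_rat r * x)"
  interpret vs: vector_space sc
    by unfold_locales (simp_all add: sc_def algebra_simps of_rat_add of_rat_mult)
  obtain B :: "'k set" where B: "finite B" "vs.span B = UNIV"
    using assms unfolding number_field_def sc_def by blast
  have "\<exists>c :: nat \<Rightarrow> rat. (\<exists>i\<le>card B. c i \<noteq> 0) \<and> (\<Sum>i\<le>card B. of_rat (c i) * b i) = 0" for b :: "nat \<Rightarrow> 'k"
  proof (cases "inj_on b {..card B}")
    case False
    then obtain i j where ij: "i \<le> card B" "j \<le> card B" "i \<noteq> j" "b i = b j" by (auto simp: inj_on_def)
    define c where "c = (\<lambda>l. if l = i then 1 else if l = j then - 1 else (0::rat))"
    have "(\<Sum>l\<le>card B. of_rat (c l) * b l) = (\<Sum>l\<in>{i, j}. of_rat (c l) * b l)"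
      by (rule sum.mono_neutral_right) (use ij in \<open>auto simp: c_def\<close>)
    also have "\<dots> = 0" using ij by (simp add: c_def)
    finally show ?thesis using ij by (intro exI[of _ c]) (auto simp: c_def)
  next
    case True
    then have "card (b ` {..card B}) = Suc (card B)" by (simp add: card_image)
    then have "\<not> vs.independent (b ` {..card B})"
      using vs.independent_span_bound[OF B(1), of "b ` {..card B}"] B(2) by auto
    then obtain u where u: "(\<Sum>x\<in>b ` {..card B}. sc (u x) x) = 0" "\<exists>x\<in>b ` {..card B}. u x \<noteq> 0"
      using vs.dependent_finite[of "b ` {..card B}"] by auto
    from u(1) have "(\<Sum>i\<le>card B. of_rat (u (b i)) * b i) = 0"
      using True by (simp add: sum.reindex sc_def)
    with u(2) show ?thesis by (intro exI[of _ "\<lambda>i. u (b i)"]) auto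
  qed
  then show ?thesis using that by blast
qed

text \<open>After clearing denominators and dividing by the gcd, the relation remains nontrivial
  modulo p.\<close>

lemma number_field_int_relation:
  assumes "number_field TYPE('k::field_char_0)"
  obtains n where "\<And>(b :: nat \<Rightarrow> 'k) p :: int. \<not> p dvd 1 \<Longrightarrow> \<exists>c :: nat \<Rightarrow> int. (\<exists>i\<le>n. \<not> p dvd c i) \<and> (\<Sum>i\<le>n. of_int (c i) * b i) = 0"
proof -
  obtain n where n: "\<And>b :: nat \<Rightarrow> 'k. \<exists>c :: nat \<Rightarrow> rat. (\<exists>i\<le>n. c i \<noteq> 0) \<and> (\<Sum>i\<le>n. of_rat (c i) * b i) = 0"
    by (rule number_field_relation[OF assms]) blast
  have "\<exists>c :: nat \<Rightarrow> int. (\<exists>i\<le>n. \<not> p dvd c i) \<and> (\<Sum>i\<le>n. of_int (c i) * b i) = 0"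
    if p: "\<not> p dvd 1" for b :: "nat \<Rightarrow> 'k" and p :: int
  proof -
    obtain c :: "nat \<Rightarrow> rat" where c: "\<exists>i\<le>n. c i \<noteq> 0" "(\<Sum>i\<le>n. of_rat (c i) * b i) = 0" using n by blast
    define D where "D = (\<Prod>i\<le>n. snd (quotient_of (c i)))"
    have D: "D > 0" unfolding D_def by (intro prod_pos) (simp add: quotient_of_denom_pos')
    have "\<exists>d. rat_of_int d = of_int D * c i" if "i \<le> n" for i
    proof -
      have "snd (quotient_of (c i)) dvd D" unfolding D_def using that by (intro dvd_prodI) auto
      then obtain k where k: "D = snd (quotient_of (c i)) * k" by (elim dvdE)
      have "c i = of_int (fst (quotient_of (c i))) / of_int (snd (quotient_of (c i)))"
        using quotient_of_div[of "c i"] by (metis prod.collapse)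
      moreover have "snd (quotient_of (c i)) \<noteq> 0" using quotient_of_denom_pos'[of "c i"] by simp
      ultimately have "c i * of_int (snd (quotient_of (c i))) = of_int (fst (quotient_of (c i)))"
        by (metis nonzero_divide_eq_eq of_int_eq_0_iff)
      then have "of_int (k * fst (quotient_of (c i))) = of_int D * c i"
        unfolding k by (simp add: algebra_simps)
      then show ?thesis by blast
    qed
    then obtain d where d: "\<And>i. i \<le> n \<Longrightarrow> rat_of_int (d i) = of_int D * c i" by metis
    define g where "g = Gcd (d ` {..n})"
    have "\<exists>i\<le>n. d i \<noteq> 0" using c(1) d D by (metis mult_eq_0_iff of_int_0 of_int_eq_0_iff less_irrefl)
    then have g: "g \<noteq> 0" unfolding g_def by (auto simp: Gcd_0_iff)
    define c' where "c' = (\<lambda>i. d i div g)"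
    have c': "d i = g * c' i" if "i \<le> n" for i using that g by (simp add: c'_def g_def)
    have "\<exists>i\<le>n. \<not> p dvd c' i"
    proof (rule ccontr)
      assume "\<not> ?thesis"
      then have "g * p dvd d i" if "i \<le> n" for i using c' that by auto
      then have "g * p dvd Gcd (d ` {..n})" by (intro Gcd_greatest) auto
      then have "g * p dvd g * 1" by (simp add: g_def)
      then show False using g p by (metis dvd_mult_cancel_left)
    qed
    moreover have "(\<Sum>i\<le>n. of_int (c' i) * b i) = 0"
    proof -
      have *: "(of_int (g * c' i) :: 'k) = of_int D * of_rat (c i)" if "i \<le> n" for i
        using c'[OF that] d[OF that] by (metis of_rat_mult of_rat_of_int_eq)
      have "of_int g * (\<Sum>i\<le>n. of_int (c' i) * b i) = (\<Sum>i\<le>n. of_int (g * c' i) * b i)"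
        by (simp add: sum_distrib_left mult.assoc)
      also have "\<dots> = (\<Sum>i\<le>n. of_int D * (of_rat (c i) * b i))"
        by (intro sum.cong) (simp_all add: * mult.assoc del: of_int_mult)
      finally have "of_int g * (\<Sum>i\<le>n. of_int (c' i) * b i) = of_int D * (\<Sum>i\<le>n. of_rat (c i) * b i)"
        by (simp add: sum_distrib_left)
      with c(2) g show ?thesis by simp
    qed
    ultimately show ?thesis by blast
  qed
  then show ?thesis using that by blast
qed

section \<open>Ultrametric inequality and Hensel's lemma\<close>

locale nonarch = abs_val v for v :: "'k::field_char_0 \<Rightarrow> real" +
  assumes v_of_nat_le: "v (of_nat n) \<le> 1"
begin

lemma v_of_int_le: "v (of_int n) \<le> 1"
  by (cases n rule: int_cases2) (simp_all add: v_of_nat_le)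

lemma v_numeral_le: "v (numeral n) \<le> 1"
  using v_of_nat_le[of "numeral n"] by simp

lemma v_add_max: "v (x + y) \<le> max (v x) (v y)"
proof (rule ccontr)
  assume n: "\<not> ?thesis"
  define M where "M = max (v x) (v y)"
  have lt: "M < v (x + y)" using n unfolding M_def not_le .
  have le: "v x \<le> M" "v y \<le> M" by (simp_all add: M_def)
  then have "M \<ge> 0" using v_nonneg order_trans by blast
  moreover have "M \<noteq> 0"
  proof
    assume "M = 0"
    with le have "v x = 0" "v y = 0" using v_nonneg order_antisym by metis+
    with lt \<open>M = 0\<close> show False by simp
  qed
  ultimately have M: "M > 0" by simp
  have v_sum: "v (sum f {..m}) \<le> (\<Sum>k\<le>m. v (f k))" for f and m :: nat
    by (induction m) (auto intro: order_trans[OF v_add_le])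
  have bound: "v (x + y) ^ m \<le> (real m + 1) * M ^ m" for m
  proof -
    have "v ((x + y) ^ m) \<le> (\<Sum>k\<le>m. v (of_nat (m choose k) * x ^ k * y ^ (m - k)))"
      unfolding binomial_ring by (rule v_sum)
    also have "\<dots> \<le> (\<Sum>k\<le>m. M ^ m)"
    proof (rule sum_mono)
      fix k assume "k \<in> {..m}"
      have "v (of_nat (m choose k) * x ^ k * y ^ (m - k)) \<le> 1 * M ^ k * M ^ (m - k)"
        unfolding v_mult v_power
        by (intro mult_mono v_of_nat_le power_mono le) (use M in simp_all)
      also have "\<dots> = M ^ m" using \<open>k \<in> {..m}\<close> by (simp flip: power_add)
      finally show "v (of_nat (m choose k) * x ^ k * y ^ (m - k)) \<le> M ^ m" .
    qed
    finally show ?thesis by (simp add: v_power add.commute)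
  qed
  have "v (x + y) / M > 1" using lt M by simp
  from exponential_exceeds_linear[OF this, of 1] obtain m where "(v (x + y) / M) ^ m > real m + 1" by auto
  then have "v (x + y) ^ m > (real m + 1) * M ^ m" using M by (simp add: power_divide field_simps)
  with bound[of m] show False by simp
qed

lemma v_add_lt: "v x < b \<Longrightarrow> v y < b \<Longrightarrow> v (x + y) < b"
  using v_add_max[of x y] by simp

lemma v_add_le': "v x \<le> b \<Longrightarrow> v y \<le> b \<Longrightarrow> v (x + y) \<le> b"
  using v_add_max[of x y] by simp

lemma v_diff_lt: "v x < b \<Longrightarrow> v y < b \<Longrightarrow> v (x - y) < b"
  using v_add_lt[of x b "-y"] by simp

lemma v_diff_le': "v x \<le> b \<Longrightarrow> v y \<le> b \<Longrightarrow> v (x - y) \<le> b"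
  using v_add_le'[of x b "-y"] by simp

lemma v_mult_le_1: "v x \<le> 1 \<Longrightarrow> v y \<le> 1 \<Longrightarrow> v (x * y) \<le> 1"
  by (simp add: v_mult mult_le_one)

lemma v_mult_lt_1: "v x < 1 \<Longrightarrow> v y \<le> 1 \<Longrightarrow> v (x * y) < 1"
  unfolding v_mult using mult_left_le[of "v y" "v x"] by simp

lemma v_power_le_1: "v x \<le> 1 \<Longrightarrow> v (x ^ n) \<le> 1"
  by (simp add: v_power power_le_one)

lemma v_eq_of_close: "v (x - y) < v x \<Longrightarrow> v y = v x"
  using v_add_max[of "x - y" y] v_add_max[of "y - x" x] v_minus_commute[of x y] by auto

lemma v_sum_lt: "b > 0 \<Longrightarrow> (\<And>i. i \<in> A \<Longrightarrow> v (f i) < b) \<Longrightarrow> v (sum f A) < b"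
  by (induction A rule: infinite_finite_induct) (auto intro: v_add_lt)

lemma cauchy_if_steps_null:
  assumes "(\<lambda>n. v (s (Suc n) - s n)) \<longlonglongrightarrow> 0"
  shows "cauchy s"
  unfolding cauchy_def cauchy_wrt_def
proof (intro allI impI)
  fix e :: real assume e: "e > 0"
  then obtain N where N: "\<And>n. n \<ge> N \<Longrightarrow> v (s (Suc n) - s n) < e"
    using assms by (fastforce simp: LIMSEQ_def)
  have 1: "v (s n - s N) < e" if "n \<ge> N" for n
    using that
  proof (induction n rule: dec_induct)
    case base then show ?case using e by simp
  next
    case (step n)
    have "v ((s (Suc n) - s n) + (s n - s N)) < e" using step N by (intro v_add_lt) auto
    then show ?case by simp
  qed
  have "v (s m - s n) < e" if "m \<ge> N" "n \<ge> N" for m n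
    using v_diff_lt[OF 1[OF that(1)] 1[OF that(2)]] by simp
  then show "\<exists>N. \<forall>m\<ge>N. \<forall>n\<ge>N. v (s m - s n) < e" by blast
qed

definition integral_poly :: "'k poly \<Rightarrow> bool" where
  "integral_poly f \<longleftrightarrow> (\<forall>i. v (coeff f i) \<le> 1)"

lemma integral_poly_pCons: "integral_poly (pCons b f) \<longleftrightarrow> v b \<le> 1 \<and> integral_poly f"
proof
  assume "integral_poly (pCons b f)"
  then show "v b \<le> 1 \<and> integral_poly f"
    unfolding integral_poly_def by (metis coeff_pCons_0 coeff_pCons_Suc)
next
  assume "v b \<le> 1 \<and> integral_poly f"
  then show "integral_poly (pCons b f)"
    unfolding integral_poly_def by (simp add: coeff_pCons split: nat.split)
qed

lemma integral_poly_0: "integral_poly 0"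
  by (simp add: integral_poly_def)

lemma integral_poly_pderiv: "integral_poly f \<Longrightarrow> integral_poly (pderiv f)"
  unfolding integral_poly_def coeff_pderiv by (metis v_mult_le_1 v_of_nat_le)

lemma v_poly_le: "integral_poly f \<Longrightarrow> v x \<le> 1 \<Longrightarrow> v (poly f x) \<le> 1"
  by (induction f) (auto simp: integral_poly_pCons intro!: v_add_le' v_mult_le_1)

lemma poly_taylor1:
  assumes "integral_poly f" "v x \<le> 1" "v h \<le> 1"
  shows "\<exists>g. v g \<le> 1 \<and> poly f (x + h) = poly f x + h * g"
  using assms(1)
proof (induction f)
  case 0
  show ?case by (rule exI[of _ 0]) simp
next
  case (pCons b f)
  then obtain g where g: "v g \<le> 1" "poly f (x + h) = poly f x + h * g" by (auto simp: integral_poly_pCons)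
  have "v (poly f x + (x + h) * g) \<le> 1"
    using pCons.prems assms(2,3) g(1) unfolding integral_poly_pCons
    by (intro v_add_le' v_mult_le_1 v_poly_le) simp_all
  then show ?case by (intro exI[of _ "poly f x + (x + h) * g"]) (simp only: poly_pCons g(2), simp add: g algebra_simps)
qed

lemma poly_taylor2:
  assumes "integral_poly f" "v x \<le> 1" "v h \<le> 1"
  shows "\<exists>g. v g \<le> 1 \<and> poly f (x + h) = poly f x + h * poly (pderiv f) x + h^2 * g"
  using assms(1)
proof (induction f)
  case 0
  show ?case by (rule exI[of _ 0]) simp
next
  case (pCons b f)
  then have f: "integral_poly f" by (simp add: integral_poly_pCons)
  with pCons obtain g where g: "v g \<le> 1" "poly f (x + h) = poly f x + h * poly (pderiv f) x + h^2 * g" by blast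
  have "v (poly (pderiv f) x + (x + h) * g) \<le> 1"
    using assms(2,3) g(1) f by (intro v_add_le' v_mult_le_1 v_poly_le integral_poly_pderiv) simp_all
  then show ?case by (intro exI[of _ "poly (pderiv f) x + (x + h) * g"])
      (simp only: poly_pCons pderiv_pCons poly_add g(2), simp add: algebra_simps power2_eq_square)
qed

text \<open>Newton iteration inside k. Its limit need not lie in k, so the root is delivered as a
  Cauchy sequence. The derivative keeps its absolute value \<open>d\<close> along the iteration
  while the values shrink at least geometrically with ratio \<epsilon>.\<close>

lemma hensel:
  assumes f: "integral_poly f" and x: "v x \<le> 1" and close: "v (poly f x) < v (poly (pderiv f) x) ^ 2"
  obtains s where "cauchy s" "null (\<lambda>n. poly f (s n))"
proof -
  define d where "d = v (poly (pderiv f) x)"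
  define \<epsilon> where "\<epsilon> = v (poly f x) / d^2"
  have d1: "d \<le> 1" unfolding d_def using f x by (intro v_poly_le integral_poly_pderiv)
  have "d \<noteq> 0"
  proof
    assume "d = 0"
    with close have "v (poly f x) < 0" unfolding d_def by simp
    then show False using v_nonneg[of "poly f x"] by simp
  qed
  then have d: "d > 0" unfolding d_def by simp
  have \<epsilon>: "0 \<le> \<epsilon>" "\<epsilon> < 1" using close d by (simp_all add: \<epsilon>_def d_def[symmetric])
  define s where "s = rec_nat x (\<lambda>_ y. y - poly f y / poly (pderiv f) y)"
  have s: "s 0 = x" "\<And>n. s (Suc n) = s n - poly f (s n) / poly (pderiv f) (s n)" by (simp_all add: s_def)
  have inv: "v (s n) \<le> 1 \<and> v (poly (pderiv f) (s n)) = d \<and> v (poly f (s n)) \<le> d^2 * \<epsilon> ^ Suc n" for n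
  proof (induction n)
    case 0
    then show ?case using x d by (simp add: s d_def[symmetric] \<epsilon>_def)
  next
    case (Suc n)
    then have IH: "v (s n) \<le> 1" "v (poly (pderiv f) (s n)) = d" "v (poly f (s n)) \<le> d^2 * \<epsilon> ^ Suc n"
      by blast+
    define h where "h = - (poly f (s n) / poly (pderiv f) (s n))"
    have "v h = v (poly f (s n)) / d" by (simp add: h_def v_divide IH(2))
    also have "\<dots> \<le> (d^2 * \<epsilon> ^ Suc n) / d" using IH(3) d by (intro divide_right_mono) simp_all
    finally have h: "v h \<le> d * \<epsilon> ^ Suc n" using d by (simp add: power2_eq_square)
    have "\<epsilon> ^ Suc n < 1" using \<epsilon> by (subst power_less_one_iff) simp_all
    then have "d * \<epsilon> ^ Suc n < d * 1" using d by (intro mult_strict_left_mono)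
    with h have hd: "v h < d" by linarith
    then have h1: "v h \<le> 1" using d1 by linarith
    have sn: "s (Suc n) = s n + h" by (simp add: s h_def)
    have "v (s (Suc n)) \<le> 1" unfolding sn using IH(1) h1 by (rule v_add_le')
    moreover have "v (poly (pderiv f) (s (Suc n))) = d"
    proof -
      obtain g where g: "v g \<le> 1" "poly (pderiv f) (s n + h) = poly (pderiv f) (s n) + h * g"
        using poly_taylor1[OF integral_poly_pderiv[OF f] IH(1) h1] by blast
      have "v (h * g) \<le> v h" using g(1) by (simp add: v_mult mult_left_le)
      then have "v (poly (pderiv f) (s n) - poly (pderiv f) (s n + h)) < v (poly (pderiv f) (s n))"
        unfolding g(2) IH(2) using hd by simp
      from v_eq_of_close[OF this] show ?thesis using IH(2) sn by simp
    qed
    moreover have "v (poly f (s (Suc n))) \<le> d^2 * \<epsilon> ^ Suc (Suc n)"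
    proof -
      obtain g where g: "v g \<le> 1" "poly f (s n + h) = poly f (s n) + h * poly (pderiv f) (s n) + h^2 * g"
        using poly_taylor2[OF f IH(1) h1] by blast
      have "poly (pderiv f) (s n) \<noteq> 0" using IH(2) d by auto
      then have "poly f (s (Suc n)) = h^2 * g" using g(2) sn by (simp add: h_def)
      then have "v (poly f (s (Suc n))) \<le> v h ^ 2" using g(1) by (simp add: v_mult v_power mult_left_le)
      also have "\<dots> \<le> (d * \<epsilon> ^ Suc n) ^ 2" using h by (intro power_mono) simp_all
      also have "\<dots> = d^2 * \<epsilon> ^ (Suc n + Suc n)" by (simp only: power_add power2_eq_square ac_simps)
      also have "\<dots> \<le> d^2 * \<epsilon> ^ Suc (Suc n)" using \<epsilon> by (intro mult_left_mono power_decreasing) simp_all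
      finally show ?thesis .
    qed
    ultimately show ?case by blast
  qed
  have lim: "(\<lambda>n. d^2 * \<epsilon> ^ Suc n) \<longlonglongrightarrow> 0"
    using \<epsilon> by (intro tendsto_mult_right_zero LIMSEQ_Suc LIMSEQ_power_zero) simp
  have null: "null (\<lambda>n. poly f (s n))"
    unfolding null_def by (rule tendsto_sandwich[OF _ _ tendsto_const lim]) (simp_all add: inv del: power_Suc)
  then have "(\<lambda>n. v (poly f (s n)) / d) \<longlonglongrightarrow> 0" unfolding null_def by (rule tendsto_divide_zero)
  moreover have "v (s (Suc n) - s n) = v (poly f (s n)) / d" for n
    using inv[of n] by (simp add: s v_divide)
  ultimately have "cauchy s" by (intro cauchy_if_steps_null) simp
  with null that show ?thesis by blast
qed

end

section \<open>Finiteness of residue fields\<close>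

context nonarch
begin

text \<open>If v were trivial on the rationals, an element with \<open>v x > 1\<close> could not
  satisfy an integral polynomial relation: the leading term alone would dominate. So v is nontrivial
  on the integers, hence on some prime.\<close>

lemma exists_prime_lt_1:
  assumes "number_field TYPE('k)"
  obtains p :: nat where "prime p" "v (of_nat p) < 1"
proof -
  obtain n where n: "\<And>(b :: nat \<Rightarrow> 'k) p :: int. \<not> p dvd 1 \<Longrightarrow> \<exists>c :: nat \<Rightarrow> int. (\<exists>i\<le>n. \<not> p dvd c i) \<and> (\<Sum>i\<le>n. of_int (c i) * b i) = 0"
    by (rule number_field_int_relation[OF assms]) blast
  obtain m :: nat where m: "m > 0" "v (of_nat m) < 1"
  proof (rule ccontr)
    assume "\<not> thesis"
    with that have "\<And>m. m > 0 \<Longrightarrow> v (of_nat m) = 1"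
      using v_of_nat_le by (metis order_le_less)
    then have unit: "v (of_int c) = 1" if "c \<noteq> 0" for c
      using that by (cases c rule: int_cases2) auto
    obtain x0 where x0: "x0 \<noteq> 0" "v x0 \<noteq> 1" using v_nontrivial by blast
    define x where "x = (if v x0 > 1 then x0 else inverse x0)"
    have "v x0 < 1 \<Longrightarrow> inverse (v x0) > 1" using x0 by (intro one_less_inverse) simp_all
    then have x: "v x > 1" using x0 by (auto simp: x_def v_inverse)
    \<comment> \<open>The modulus 2 only guarantees a nonzero coefficient.\<close>
    obtain c where c: "\<exists>i\<le>n. \<not> 2 dvd c i" "(\<Sum>i\<le>n. of_int (c i) * x ^ i) = 0"
      using n[of 2 "\<lambda>i. x ^ i"] by auto
    define d where "d = Max {i. i \<le> n \<and> c i \<noteq> 0}"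
    have fin: "finite {i. i \<le> n \<and> c i \<noteq> 0}" by simp
    have ne: "{i. i \<le> n \<and> c i \<noteq> 0} \<noteq> {}" using c(1) by auto
    have d: "d \<le> n" "c d \<noteq> 0" using Max_in[OF fin ne] by (simp_all add: d_def)
    have above: "c i = 0" if "i \<le> n" "i > d" for i
      using that Max_ge[OF fin, of i] unfolding d_def[symmetric] by fastforce
    have "(\<Sum>i\<le>n. of_int (c i) * x ^ i) = (\<Sum>i\<le>d. of_int (c i) * x ^ i)"
      by (rule sum.mono_neutral_right) (use d above in auto)
    also have "\<dots> = (\<Sum>i<d. of_int (c i) * x ^ i) + of_int (c d) * x ^ d"
      by (simp only: lessThan_Suc_atMost[symmetric] sum.lessThan_Suc)
    finally have eq: "of_int (c d) * x ^ d = - (\<Sum>i<d. of_int (c i) * x ^ i)"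
      using c(2) by (simp add: eq_neg_iff_add_eq_0 add.commute)
    have "v (\<Sum>i<d. of_int (c i) * x ^ i) < v x ^ d"
    proof (rule v_sum_lt)
      fix i assume "i \<in> {..<d}"
      have "v (of_int (c i) * x ^ i) \<le> 1 * v x ^ i"
        unfolding v_mult v_power by (intro mult_right_mono v_of_int_le) simp
      also have "\<dots> < v x ^ d" using x \<open>i \<in> {..<d}\<close> by (simp add: power_strict_increasing)
      finally show "v (of_int (c i) * x ^ i) < v x ^ d" .
    next
      have "0 < v x" using x by linarith
      then show "0 < v x ^ d" by (rule zero_less_power)
    qed
    moreover have "v (of_int (c d) * x ^ d) = v x ^ d" using unit d by (simp add: v_mult v_power)
    ultimately show False unfolding eq by simp
  qed
  have "\<exists>p\<in>prime_factors m. v (of_nat p) < 1"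
  proof (rule ccontr)
    assume "\<not> ?thesis"
    then have 1: "v (of_nat p) = 1" if "p \<in> prime_factors m" for p
      using that v_of_nat_le[of p] by force
    have "v (of_nat (prod_mset (prime_factorization m))) = 1"
    proof -
      have "v (of_nat (prod_mset A)) = 1" if "set_mset A \<subseteq> prime_factors m" for A
        using that by (induction A) (auto simp: v_mult 1)
      then show ?thesis by blast
    qed
    with m show False by (simp add: prod_mset_prime_factorization_nat)
  qed
  then show ?thesis using that by (auto simp: in_prime_factors_iff)
qed

text \<open>The residue field has dimension at most \<open>n\<close> over F_p, since among any n + 1
  integral elements there is an integral relation that is nontrivial modulo p. Thus there are
  finitely many residue classes.\<close>

lemma residues_pigeonhole:
  assumes "number_field TYPE('k)" and x: "\<And>i::nat. v (x i) \<le> 1"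
  obtains i j where "i < j" "v (x i - x j) < 1"
proof -
  obtain n where n: "\<And>(b :: nat \<Rightarrow> 'k) p :: int. \<not> p dvd 1 \<Longrightarrow> \<exists>c :: nat \<Rightarrow> int. (\<exists>i\<le>n. \<not> p dvd c i) \<and> (\<Sum>i\<le>n. of_int (c i) * b i) = 0"
    by (rule number_field_int_relation[OF assms(1)]) blast
  obtain p0 :: nat where p0: "prime p0" "v (of_nat p0) < 1" using exists_prime_lt_1[OF assms(1)] .
  define p where "p = int p0"
  have p: "prime p" "v (of_int p) < 1" using p0 by (simp_all add: p_def)
  have dvd: "v (of_int a) < 1" if "p dvd a" for a
  proof -
    from that obtain k where "a = p * k" by (elim dvdE)
    then show ?thesis using v_mult_lt_1[OF p(2) v_of_int_le[of k]] by simp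
  qed
  \<comment> \<open>The elements \<open>b 0\<close>, ..., \<open>b (r - 1)\<close> are integral with
    residues linearly independent over F_p.\<close>
  define indep where "indep = (\<lambda>r (b :: nat \<Rightarrow> 'k). (\<forall>i<r. v (b i) \<le> 1) \<and>
    (\<forall>c. v (\<Sum>i<r. of_int (c i) * b i) < 1 \<longrightarrow> (\<forall>i<r. p dvd c i)))"
  have bound: "r \<le> n" if "indep r b" for r b
  proof (rule ccontr)
    assume "\<not> r \<le> n"
    have "\<not> p dvd 1" using p(1) by (metis not_prime_unit)
    then obtain c where c: "\<exists>i\<le>n. \<not> p dvd c i" "(\<Sum>i\<le>n. of_int (c i) * b i) = 0" using n by blast
    define c' where "c' = (\<lambda>i. if i \<le> n then c i else 0)"
    have "(\<Sum>i<r. of_int (c' i) * b i) = (\<Sum>i\<le>n. of_int (c i) * b i)"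
      by (rule sum.mono_neutral_cong_right) (use \<open>\<not> r \<le> n\<close> in \<open>auto simp: c'_def\<close>)
    then have "v (\<Sum>i<r. of_int (c' i) * b i) < 1" using c by simp
    then have "\<forall>i<r. p dvd c' i" using that unfolding indep_def by blast
    moreover obtain i where "i \<le> n" "\<not> p dvd c i" using c(1) by blast
    ultimately show False using \<open>\<not> r \<le> n\<close> by (metis c'_def le_less_trans not_le)
  qed
  have "indep 0 b" for b by (simp add: indep_def)
  then have ne: "{r. \<exists>b. indep r b} \<noteq> {}" by blast
  have fin: "finite {r. \<exists>b. indep r b}" by (rule finite_subset[of _ "{..n}"]) (use bound in auto)
  obtain r b where b: "indep r b" and max: "\<And>r' b'. indep r' b' \<Longrightarrow> r' \<le> r"
    using Max_in[OF fin ne] Max_ge[OF fin] by blast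
  have rep: "\<exists>d. d \<in> {..<r} \<rightarrow>\<^sub>E {0..<p} \<and> v (y - (\<Sum>i<r. of_int (d i) * b i)) < 1" if y: "v y \<le> 1" for y
  proof -
    \<comment> \<open>By maximality of r, adding \<open>y\<close> creates a relation. Its
      coefficient at \<open>y\<close> is prime to p by independence of the old elements, and
      dividing by it modulo p writes the residue of \<open>y\<close> in terms of
      \<open>b\<close>.\<close>
    have "\<not> indep (Suc r) (b(r := y))" using max by fastforce
    then obtain c where c: "v (\<Sum>i<Suc r. of_int (c i) * (b(r := y)) i) < 1" "\<exists>i<Suc r. \<not> p dvd c i"
      using b y unfolding indep_def by (auto simp: less_Suc_eq)
    define z where "z = (\<Sum>i<r. of_int (c i) * b i)"
    have c1: "v (z + of_int (c r) * y) < 1" using c(1) by (simp add: z_def)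
    have cr: "\<not> p dvd c r"
    proof
      assume "p dvd c r"
      then have "v (of_int (c r) * y) < 1" using dvd y by (intro v_mult_lt_1)
      from v_diff_lt[OF c1 this] have "v z < 1" by simp
      then have "\<forall>i<r. p dvd c i" using b unfolding indep_def z_def by blast
      with c(2) \<open>p dvd c r\<close> show False by (auto simp: less_Suc_eq)
    qed
    then have "coprime (c r) p" using p(1) by (metis coprime_commute prime_imp_coprime)
    then obtain m l where "m * c r + l * p = 1" using bezout_int[of "c r" p] by auto
    then have "1 - c r * m = p * l" by (simp add: algebra_simps)
    then have "p dvd 1 - c r * m" by simp
    then have "v (of_int (1 - c r * m)) < 1" by (rule dvd)
    then have m: "v (of_int (1 - c r * m) * y) < 1" using y by (rule v_mult_lt_1)
    have "v (of_int m * (z + of_int (c r) * y)) < 1"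
      using v_mult_lt_1[OF c1 v_of_int_le[of m]] by (simp add: mult.commute)
    from v_add_lt[OF m this] have 1: "v (y + of_int m * z) < 1" by (simp add: algebra_simps)
    define d where "d = (\<lambda>i\<in>{..<r}. (- m * c i) mod p)"
    have "v (\<Sum>i<r. of_int (- m * c i - d i) * b i) < 1"
    proof (rule v_sum_lt)
      fix i assume "i \<in> {..<r}"
      then have "p dvd - m * c i - d i" by (simp add: d_def minus_mod_eq_mult_div)
      then show "v (of_int (- m * c i - d i) * b i) < 1"
        using b \<open>i \<in> {..<r}\<close> unfolding indep_def by (intro v_mult_lt_1 dvd) auto
    qed simp
    moreover have "(\<Sum>i<r. of_int (- m * c i - d i) * b i) = - of_int m * z - (\<Sum>i<r. of_int (d i) * b i)"
    proof -
      have "(\<Sum>i<r. of_int (- m * c i - d i) * b i) = (\<Sum>i<r. - of_int m * (of_int (c i) * b i) - of_int (d i) * b i)"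
        by (rule sum.cong) (simp_all add: algebra_simps)
      then show ?thesis by (simp only: sum_subtractf sum_distrib_left z_def)
    qed
    ultimately have "v (- of_int m * z - (\<Sum>i<r. of_int (d i) * b i)) < 1" by simp
    from v_add_lt[OF 1 this] have "v (y - (\<Sum>i<r. of_int (d i) * b i)) < 1" by simp
    moreover have "d \<in> {..<r} \<rightarrow>\<^sub>E {0..<p}"
      using prime_gt_0_int[OF p(1)] by (auto simp: d_def)
    ultimately show ?thesis by blast
  qed
  have "\<forall>i. \<exists>d. d \<in> {..<r} \<rightarrow>\<^sub>E {0..<p} \<and> v (x i - (\<Sum>l<r. of_int (d l) * b l)) < 1"
    using rep[OF x] by blast
  from choice[OF this] obtain d where d: "\<And>i. d i \<in> {..<r} \<rightarrow>\<^sub>E {0..<p}" "\<And>i. v (x i - (\<Sum>l<r. of_int (d i l) * b l)) < 1"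
    by blast
  have "finite ({..<r} \<rightarrow>\<^sub>E {0..<p})" by (intro finite_PiE) auto
  then have "\<not> inj d" using d(1) by (metis finite_imageD finite_subset image_subsetI infinite_UNIV_nat)
  then obtain i j where "i \<noteq> j" "d i = d j" by (auto simp: inj_on_def)
  then have "v (x i - x j) < 1" using v_diff_lt[OF d(2)[of i] d(2)[of j]] by simp
  with \<open>i \<noteq> j\<close> that v_minus_commute[of "x i" "x j"] show ?thesis
    by (metis nat_neq_iff)
qed

text \<open>An injective self-map of a finite set is surjective, proved along the orbit of
  \<open>a\<close>: two terms agree modulo the maximal ideal, and injectivity cancels
  \<open>g\<close> until one of them is \<open>a\<close> itself.\<close>

lemma residue_preimage:
  assumes nf: "number_field TYPE('k)" and a: "P a"
    and int: "\<And>x. P x \<Longrightarrow> v x \<le> 1" and closed: "\<And>x. P x \<Longrightarrow> P (g x)"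
    and inj: "\<And>x y. P x \<Longrightarrow> P y \<Longrightarrow> v (g x - g y) < 1 \<Longrightarrow> v (x - y) < 1"
  obtains x where "P x" "v (a - g x) < 1"
proof -
  have P: "P ((g ^^ i) a)" for i by (induction i) (auto simp: a closed)
  obtain i j where ij: "i < j" "v ((g ^^ i) a - (g ^^ j) a) < 1"
    using residues_pigeonhole[OF nf, of "\<lambda>i. (g ^^ i) a"] int P by blast
  define k where "k = j - Suc i"
  have j: "j = i + Suc k" using ij by (simp add: k_def)
  have "v ((g ^^ l) a - (g ^^ (l + Suc k)) a) < 1 \<Longrightarrow> v (a - (g ^^ Suc k) a) < 1" for l
  proof (induction l)
    case (Suc l)
    then show ?case using inj[OF P P, of l "l + Suc k"] by simp
  qed simp
  from this[of i] ij have "v (a - (g ^^ Suc k) a) < 1" unfolding j by blast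
  then show ?thesis using that[OF P[of k]] by simp
qed

end

section \<open>Archimedean absolute values\<close>

context abs_val
begin

lemma v_of_nat_le_of_nat: "v (of_nat n) \<le> real n"
proof (induction n)
  case (Suc n)
  have "v (of_nat (Suc n)) \<le> v 1 + v (of_nat n)" using v_add_le[of 1 "of_nat n"] by simp
  with Suc show ?case by simp
qed simp

text \<open>N is expanded in base a with k digits; each digit has absolute value below a by the
  triangle inequality.\<close>

lemma v_of_nat_digits:
  assumes a: "a \<ge> 2" and N: "N < a ^ k"
  shows "v (of_nat N) \<le> real a * real k * max 1 (v (of_nat a)) ^ k"
  using N
proof (induction k arbitrary: N)
  case (Suc k)
  define A where "A = max 1 (v (of_nat a))"
  have A: "A \<ge> 1" "v (of_nat a) \<le> A" by (simp_all add: A_def)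
  have "N div a < a ^ k" using Suc.prems a by (simp add: less_mult_imp_div_less mult.commute)
  then have IH: "v (of_nat (N div a)) \<le> real a * real k * A ^ k" using Suc.IH unfolding A_def by blast
  have "v (of_nat N) = v (of_nat (N mod a) + of_nat a * of_nat (N div a))"
    by (metis mod_mult_div_eq of_nat_add of_nat_mult)
  also have "\<dots> \<le> v (of_nat (N mod a)) + v (of_nat a) * v (of_nat (N div a))"
    using v_add_le by (metis v_mult)
  also have "\<dots> \<le> real a + A * (real a * real k * A ^ k)"
  proof (intro add_mono mult_mono A IH)
    have "real (N mod a) \<le> real a" using a by (simp add: order_less_imp_le)
    then show "v (of_nat (N mod a)) \<le> real a" using v_of_nat_le_of_nat[of "N mod a"] by linarith
  qed (use A in auto)
  also have "\<dots> \<le> real a * A ^ Suc k + A * (real a * real k * A ^ k)"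
  proof -
    have "1 \<le> A ^ Suc k" using A by (intro one_le_power)
    then have "real a * 1 \<le> real a * A ^ Suc k" by (intro mult_left_mono) auto
    then show ?thesis by simp
  qed
  also have "\<dots> = real a * real (Suc k) * A ^ Suc k" by (simp add: algebra_simps)
  finally show ?case by (simp add: A_def)
qed simp

text \<open>Ostrowski's comparison: the digit bound is applied to \<open>b ^ t\<close> with k about
  t ln b / ln a. After taking t-th roots the factor linear in t disappears as t grows.\<close>

lemma v_of_nat_compare:
  assumes a: "a \<ge> 2" and b: "b \<ge> 2"
  shows "v (of_nat b) \<le> max 1 (v (of_nat a)) powr (ln (real b) / ln (real a))"
proof (rule ccontr)
  define A where "A = max 1 (v (of_nat a))"
  define \<beta> where "\<beta> = ln (real b) / ln (real a)"
  have A: "A \<ge> 1" by (simp add: A_def)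
  have \<beta>: "\<beta> > 0" using a b by (simp add: \<beta>_def)
  assume "\<not> ?thesis"
  then have "v (of_nat b) > A powr \<beta>" by (simp add: A_def \<beta>_def)
  then have "v (of_nat b) / A powr \<beta> > 1" using A by simp
  from exponential_exceeds_linear[OF this, of "real a * A * (\<beta> + 1)"] obtain t
    where t: "(v (of_nat b) / A powr \<beta>) ^ t > real a * A * (\<beta> + 1) * (real t + 1)" by blast
  define k where "k = nat \<lfloor>real t * \<beta>\<rfloor> + 1"
  have nn: "0 \<le> real t * \<beta>" using \<beta> by simp
  then have k: "real t * \<beta> < real k" "real k \<le> real t * \<beta> + 1" unfolding k_def by linarith+
  have "real (b ^ t) < real (a ^ k)"
  proof -
    have "real b ^ t = exp (real t * ln (real b))" using b by (simp add: exp_of_nat_mult)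
    also have "real t * ln (real b) = real t * \<beta> * ln (real a)" using a by (simp add: \<beta>_def)
    also have "exp (real t * \<beta> * ln (real a)) < exp (real k * ln (real a))" using k a by simp
    also have "\<dots> = real a ^ k" using a by (simp add: exp_of_nat_mult)
    finally show ?thesis by simp
  qed
  then have "b ^ t < a ^ k" by (simp only: of_nat_less_iff)
  from v_of_nat_digits[OF a this] have "v (of_nat b) ^ t \<le> real a * real k * A ^ k"
    by (simp add: v_power A_def)
  also have "\<dots> \<le> real a * ((\<beta> + 1) * (real t + 1)) * (A * (A powr \<beta>) ^ t)"
  proof (intro mult_mono)
    have "real t * \<beta> + 1 \<le> (\<beta> + 1) * (real t + 1)" using \<beta> by (simp add: algebra_simps)
    with k show "real k \<le> (\<beta> + 1) * (real t + 1)" by linarith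
    have "A ^ k = A powr real k" using A by (simp add: powr_realpow)
    also have "\<dots> \<le> A powr (1 + \<beta> * real t)" using k A by (intro powr_mono) (simp_all add: mult.commute)
    also have "\<dots> = A * (A powr \<beta>) ^ t" using A by (simp add: powr_add powr_powr flip: powr_realpow)
    finally show "A ^ k \<le> A * (A powr \<beta>) ^ t" .
  qed (use A \<beta> in simp_all)
  finally have "v (of_nat b) ^ t \<le> real a * A * (\<beta> + 1) * (real t + 1) * (A powr \<beta>) ^ t"
    by (simp add: algebra_simps)
  moreover have "(A powr \<beta>) ^ t > 0" using A by simp
  ultimately have "(v (of_nat b) / A powr \<beta>) ^ t \<le> real a * A * (\<beta> + 1) * (real t + 1)"
    by (simp add: power_divide divide_le_eq)
  with t show False by simp
qed

text \<open>Comparison in both directions shows that ln v(n) / ln n is the same for all n at least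
  2; this constant is the exponent s.\<close>

lemma archimedean_powr:
  assumes "v (of_nat m) > 1"
  obtains s where "s > 0" "\<And>q :: rat. v (of_rat q) = \<bar>real_of_rat q\<bar> powr s"
proof -
  have m: "m \<ge> 2" using assms by (cases m; cases "m - 1") auto
  have gt1: "v (of_nat a) > 1" if "a \<ge> 2" for a
    using v_of_nat_compare[OF that m] assms by (cases "v (of_nat a) > 1") auto
  have le: "ln (v (of_nat b)) / ln (real b) \<le> ln (v (of_nat a)) / ln (real a)" if "a \<ge> 2" "b \<ge> 2" for a b
  proof -
    have "v (of_nat b) \<le> v (of_nat a) powr (ln (real b) / ln (real a))"
      using v_of_nat_compare[OF that] gt1[OF that(1)] by simp
    then have "ln (v (of_nat b)) \<le> ln (v (of_nat a) powr (ln (real b) / ln (real a)))"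
      using gt1[OF that(2)] gt1[OF that(1)] that by (subst ln_le_cancel_iff) auto
    then show ?thesis using that gt1[OF that(1)] by (simp add: ln_powr field_simps)
  qed
  define s where "s = ln (v (of_nat m)) / ln (real m)"
  have s: "s > 0" using assms m by (simp add: s_def)
  have nat: "v (of_nat n) = real n powr s" for n
  proof (cases "n \<ge> 2")
    case True
    then have "ln (v (of_nat n)) = s * ln (real n)"
      using le[OF True m] le[OF m True] True by (simp add: s_def field_simps)
    then have "exp (ln (v (of_nat n))) = real n powr s" using True by (simp add: powr_def)
    moreover have "v (of_nat n) > 0" using gt1[OF True] by linarith
    ultimately show ?thesis by (simp only: exp_ln)
  next
    case False
    then have "n = 0 \<or> n = 1" by auto
    then show ?thesis by auto
  qed
  have int: "v (of_int i) = \<bar>real_of_int i\<bar> powr s" for i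
    by (cases i rule: int_cases2) (simp_all add: nat)
  have "v (of_rat q) = \<bar>real_of_rat q\<bar> powr s" for q
  proof -
    obtain i j where "quotient_of q = (i, j)" by (cases "quotient_of q")
    then have "q = of_int i / of_int j" by (rule quotient_of_div)
    then show ?thesis by (simp add: of_rat_divide v_divide int powr_divide)
  qed
  with s that show ?thesis by blast
qed

text \<open>On the rationals v is a power of the usual absolute value, so rational approximations of
  the real k-th root form a Cauchy sequence for v.\<close>

lemma archimedean_root:
  assumes "v (of_nat m) > 1" and q: "q > (0::rat)" and k: "k > 0"
  obtains c where "cauchy c" "null (\<lambda>n. c n ^ k - of_rat q)"
proof -
  obtain s where s: "s > 0" "\<And>q :: rat. v (of_rat q) = \<bar>real_of_rat q\<bar> powr s"
    by (rule archimedean_powr[OF assms(1)]) blast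
  define x where "x = root k (real_of_rat q)"
  have x: "x ^ k = real_of_rat q" using q k by (simp add: x_def)
  have "\<exists>r. x < real_of_rat r \<and> real_of_rat r < x + 1 / real (Suc n)" for n
    by (rule of_rat_dense) simp
  then obtain r where r: "\<And>n. x < real_of_rat (r n)" "\<And>n. real_of_rat (r n) < x + 1 / real (Suc n)" by metis
  have lim: "(\<lambda>n. real_of_rat (r n)) \<longlonglongrightarrow> x"
  proof (rule real_tendsto_sandwich)
    show "(\<lambda>n. x) \<longlonglongrightarrow> x" by simp
    have "(\<lambda>n. x + inverse (real (Suc n))) \<longlonglongrightarrow> x + 0"
      by (intro tendsto_add tendsto_const LIMSEQ_inverse_real_of_nat)
    then show "(\<lambda>n. x + 1 / real (Suc n)) \<longlonglongrightarrow> x" by (simp add: inverse_eq_divide)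
  qed (rule always_eventually, rule allI, rule less_imp_le, rule r)+
  have "cauchy (\<lambda>n. of_rat (r n))"
    unfolding cauchy_def cauchy_wrt_def
  proof (intro allI impI)
    fix e :: real assume e: "e > 0"
    then have "e powr (1 / s) > 0" by simp
    moreover have "Cauchy (\<lambda>n. real_of_rat (r n))" using lim by (rule LIMSEQ_imp_Cauchy)
    ultimately obtain N where N: "\<And>m n. m \<ge> N \<Longrightarrow> n \<ge> N \<Longrightarrow> \<bar>real_of_rat (r m) - real_of_rat (r n)\<bar> < e powr (1 / s)"
      unfolding Cauchy_def dist_real_def by metis
    have "v (of_rat (r m) - of_rat (r n)) < e" if "m \<ge> N" "n \<ge> N" for m n
    proof -
      have "v (of_rat (r m) - of_rat (r n)) = \<bar>real_of_rat (r m) - real_of_rat (r n)\<bar> powr s"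
        using s(2)[of "r m - r n"] by (simp add: of_rat_diff)
      also have "\<dots> < (e powr (1 / s)) powr s" using s(1) N[OF that] by (intro powr_less_mono2) auto
      also have "\<dots> = e" using s(1) e by (simp add: powr_powr)
      finally show ?thesis .
    qed
    then show "\<exists>N. \<forall>m\<ge>N. \<forall>n\<ge>N. v (of_rat (r m) - of_rat (r n)) < e" by blast
  qed
  moreover have "null (\<lambda>n. of_rat (r n) ^ k - of_rat q)"
  proof -
    have "(\<lambda>n. \<bar>real_of_rat (r n) ^ k - x ^ k\<bar> powr s) \<longlonglongrightarrow> \<bar>x ^ k - x ^ k\<bar> powr s"
      using s(1) by (intro tendsto_powr' tendsto_intros lim) auto
    moreover have "v (of_rat (r n) ^ k - of_rat q) = \<bar>real_of_rat (r n) ^ k - x ^ k\<bar> powr s" for n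
      using s(2)[of "r n ^ k - q"] by (simp add: of_rat_diff of_rat_power x)
    ultimately show ?thesis unfolding null_def using s(1) by simp
  qed
  ultimately show ?thesis using that by blast
qed

end

section \<open>Fifth roots of unity and fifth powers by Hensel's lemma\<close>

definition cyclo5 :: "'a::comm_ring_1 \<Rightarrow> 'a" where
  "cyclo5 z = z^4 + z^3 + z^2 + z + 1"

lemma cyclo5_mult: "(z - 1) * cyclo5 z = z^5 - 1"
  unfolding cyclo5_def by (simp add: algebra_simps eval_nat_numeral)

context nonarch
begin

lemma hensel_unit:
  assumes "integral_poly f" "v x \<le> 1" "v (poly f x) < 1" "v (poly (pderiv f) x) = 1"
  obtains s where "cauchy s" "null (\<lambda>n. poly f (s n))"
  by (rule hensel[of f x]) (use assms in auto)

text \<open>Differentiating \<open>(z - 1) * cyclo5 z = z^5 - 1\<close> gives \<open>5 * z^4\<close>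
  as the sum of \<open>cyclo5 z\<close> and z - 1 times the derivative. At an approximate root,
  which must be a unit, the derivative is therefore a unit.\<close>

lemma hensel_cyclo5:
  assumes z: "v z \<le> 1" "v (cyclo5 z) < 1" and 5: "v 5 = 1"
  obtains s where "cauchy s" "null (\<lambda>n. cyclo5 (s n))"
proof -
  define f where "f = [:1, 1, 1, 1, 1 :: 'k:]"
  have f: "poly f x = cyclo5 x" for x
    by (simp add: f_def cyclo5_def algebra_simps eval_nat_numeral)
  have f': "poly (pderiv f) x = 4 * x^3 + 3 * x^2 + 2 * x + 1" for x
    by (simp add: f_def pderiv_pCons algebra_simps eval_nat_numeral)
  have int: "integral_poly f" by (simp add: f_def integral_poly_pCons integral_poly_0)
  have "v (1 - (1 - cyclo5 z)) < v 1" using z by simp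
  then have "v (1 - cyclo5 z) = 1" using v_eq_of_close[of 1 "1 - cyclo5 z"] by simp
  moreover have "1 - cyclo5 z = z * - (z^3 + z^2 + z + 1)" by (simp add: cyclo5_def algebra_simps eval_nat_numeral)
  moreover have "v (- (z^3 + z^2 + z + 1)) \<le> 1"
    unfolding v_minus by (intro v_add_le' v_power_le_1 z) simp
  ultimately have "v z * v (- (z^3 + z^2 + z + 1)) = 1" "v (- (z^3 + z^2 + z + 1)) \<le> 1"
    by (simp_all add: v_mult)
  then have vz: "v z = 1" using z(1) v_nonneg[of z]
    by (metis mult.commute mult_left_le order_antisym)
  have eq: "5 * z^4 - (z - 1) * poly (pderiv f) z = cyclo5 z"
    unfolding f' cyclo5_def by (simp add: algebra_simps eval_nat_numeral)
  have "v (5 * z^4) = 1" by (simp add: v_mult v_power vz 5)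
  then have "v ((z - 1) * poly (pderiv f) z) = 1"
    using v_eq_of_close[of "5 * z^4" "(z - 1) * poly (pderiv f) z"] z eq by simp
  moreover have "v (z - 1) \<le> 1" using z by (intro v_diff_le') simp_all
  moreover have le: "v (poly (pderiv f) z) \<le> 1" using int z by (intro v_poly_le integral_poly_pderiv)
  ultimately have "v (poly (pderiv f) z) = 1"
    by (metis v_mult mult_left_le order_antisym v_nonneg mult.commute)
  with int z that show ?thesis using hensel_unit[of f z] unfolding f by blast
qed

lemma hensel_root:
  assumes "v a \<le> 1" "v x = 1" "v (a - x ^ 5) < 1" and 5: "v 5 = 1"
  obtains s where "cauchy s" "null (\<lambda>n. s n ^ 5 - a)"
proof -
  define f where "f = [:- a, 0, 0, 0, 0, 1:]"
  have f: "poly f x = x^5 - a" for x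
    by (simp add: f_def algebra_simps eval_nat_numeral)
  have f': "poly (pderiv f) x = 5 * x^4" for x
    by (simp add: f_def pderiv_pCons algebra_simps eval_nat_numeral)
  have int: "integral_poly f" using assms by (simp add: f_def integral_poly_pCons integral_poly_0)
  show ?thesis
    by (rule hensel_unit[of f x, unfolded f f'])
      (use assms int that in \<open>auto simp: v_mult v_power v_minus_commute[of "x^5" a]\<close>)
qed

lemma hensel_sqrt:
  assumes "v e \<le> 1" "v x \<le> 1" "v (x ^ 2 - e) < v (2 * x) ^ 2"
  obtains s where "cauchy s" "null (\<lambda>n. s n ^ 2 - e)"
proof -
  define f where "f = [:- e, 0, 1:]"
  have f: "poly f x = x^2 - e" for x
    by (simp add: f_def algebra_simps eval_nat_numeral)
  have f': "poly (pderiv f) x = 2 * x" for x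
    by (simp add: f_def pderiv_pCons algebra_simps eval_nat_numeral)
  have int: "integral_poly f" using assms by (simp add: f_def integral_poly_pCons integral_poly_0)
  show ?thesis
    by (rule hensel[of f x, unfolded f f']) (use assms int that in auto)
qed

text \<open>Hensel's lemma at the approximate root 1. The derivative there is
  \<open>5 ^ (j + 1)\<close>, whose square accounts for \<open>5 ^ (2 * j + 2)\<close>; one further
  factor 5 in \<open>n0\<close> gives the strict inequality.\<close>

lemma hensel_pow5:
  assumes 5: "v 5 < 1" and n0: "5 ^ (2 * j + 3) dvd n0"
  obtains s where "cauchy s" "null (\<lambda>n. s n ^ (5 ^ (j + 1)) - of_nat (n0^4 + n0^3 + n0^2 + n0 + 1))"
proof -
  define m :: nat where "m = 5 ^ (j + 1)"
  define a where "a = (of_nat (n0^4 + n0^3 + n0^2 + n0 + 1) :: 'k)"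
  define f where "f = monom 1 m + [:- a:]"
  have f: "poly f x = x ^ m - a" for x by (simp add: f_def poly_monom)
  have f': "poly (pderiv f) 1 = of_nat m" by (simp add: f_def pderiv_add pderiv_monom poly_monom pderiv_pCons)
  have int: "integral_poly f"
  proof -
    have "v a \<le> 1" unfolding a_def by (rule v_of_nat_le)
    then show ?thesis
      unfolding integral_poly_def f_def coeff_add
      by (intro allI v_add_le') (simp_all add: coeff_pCons split: nat.splits)
  qed
  obtain l where l: "n0 = 5 ^ (2 * j + 3) * l" using n0 by (elim dvdE)
  have "poly f 1 = - (of_nat n0 * of_nat (n0^3 + n0^2 + n0 + 1))"
    unfolding f a_def by (simp add: algebra_simps eval_nat_numeral)
  then have "v (poly f 1) = v (of_nat n0) * v (of_nat (n0^3 + n0^2 + n0 + 1))" by (simp only: v_minus v_mult)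
  also have "\<dots> \<le> v (of_nat n0) * 1" by (intro mult_left_mono v_of_nat_le) simp
  also have "\<dots> = v 5 ^ (2 * j + 3) * v (of_nat l)" by (simp add: l v_mult v_power)
  also have "\<dots> \<le> v 5 ^ (2 * j + 3) * 1" by (intro mult_left_mono v_of_nat_le) simp
  also have "\<dots> < v 5 ^ (2 * j + 2)" using 5 power_strict_decreasing[of "2 * j + 2" "2 * j + 3" "v 5"] by simp
  also have "\<dots> = v (poly (pderiv f) 1) ^ 2"
    unfolding f' m_def by (simp add: v_power v_mult power_mult_distrib power_mult power2_eq_square)
  finally obtain s where "cauchy s" "null (\<lambda>n. poly f (s n))" using hensel[OF int, of 1] by auto
  then show ?thesis using that unfolding f m_def a_def by blast
qed

end

section \<open>Local solubility\<close>

context abs_val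
begin

definition has_sqrt :: "'k \<Rightarrow> bool" where
  "has_sqrt e \<longleftrightarrow> (\<exists>r. cauchy r \<and> null (\<lambda>n. r n ^ 2 - e))"

definition has_quintic_root :: "'k \<Rightarrow> 'k \<Rightarrow> bool" where
  "has_quintic_root c a \<longleftrightarrow> (\<exists>t. cauchy t \<and> null (\<lambda>n. quintic c a (t n)))"

lemma line_if_local_solution:
  assumes "has_sqrt e \<or> has_quintic_root c a"
  shows "contains_line (completion v) (to_completion v) (surface e a c)"
  using assms line_if_sqrt line_if_root unfolding has_sqrt_def has_quintic_root_def by blast

text \<open>Without a fifth root of unity in the completion, \<open>y^5 = x^5\<close> forces y = x
  there. So fifth powers on both sides of the equation can be cancelled one at a time.\<close>

lemma fifth_root_descent:
  assumes a: "a \<noteq> 0" and \<zeta>: "\<And>z. cauchy z \<Longrightarrow> \<not> null (\<lambda>n. cyclo5 (z n))"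
    and c: "cauchy c" "null (\<lambda>n. c n ^ 5 ^ (j + 1) - a ^ 5 ^ j)"
  shows "null (\<lambda>n. c n ^ 5 - a)"
  using c(2)
proof (induction j)
  case (Suc j)
  define x where "x = a ^ 5 ^ j"
  define y where "y = (\<lambda>n. c n ^ 5 ^ (j + 1))"
  define z where "z = (\<lambda>n. y n * inverse x)"
  have x: "x \<noteq> 0" using a by (simp add: x_def)
  have y: "cauchy y" unfolding y_def using c(1) by (rule cauchy_power)
  have z: "cauchy z" unfolding z_def by (intro cauchy_mult y cauchy_const)
  have "null (\<lambda>n. y n ^ 5 - x ^ 5)"
    using Suc.prems by (simp add: x_def y_def mult.commute flip: power_mult)
  then have "null (\<lambda>n. (y n ^ 5 - x ^ 5) * inverse x ^ 5)" by (rule null_mult_cauchy) simp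
  moreover have "(y n ^ 5 - x ^ 5) * inverse x ^ 5 = (z n - 1) * cyclo5 (z n)" for n
    unfolding cyclo5_mult z_def using x by (simp add: field_simps)
  ultimately have "null (\<lambda>n. (z n - 1) * cyclo5 (z n))" by simp
  moreover have "cauchy (\<lambda>n. z n - 1)" "cauchy (\<lambda>n. cyclo5 (z n))"
    unfolding cyclo5_def by (intro cauchy_add cauchy_diff cauchy_power z cauchy_const)+
  ultimately have "null (\<lambda>n. z n - 1)" using null_mult_imp \<zeta>[OF z] by blast
  then have "null (\<lambda>n. (z n - 1) * x)" by (rule null_mult_cauchy) simp
  moreover have "(z n - 1) * x = c n ^ 5 ^ (j + 1) - a ^ 5 ^ j" for n
    using x by (simp add: z_def y_def x_def[symmetric] algebra_simps)
  ultimately show ?case using Suc.IH by simp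
qed simp

text \<open>
  Without a fifth root of unity in the completion, fifth roots are unique there, and an iterated
  fifth root of \<open>1 + n0 + n0^2 + n0^3 + n0^4\<close> in the completion yields a fifth root of \<open>a\<close>.
\<close>

lemma local_solution_pure:
  assumes nf: "number_field TYPE('k)" and a: "a ^ 5 ^ j = of_nat (n0^4 + n0^3 + n0^2 + n0 + 1)"
    and n0: "5 ^ (2 * j + 3) dvd n0"
    and e: "\<And>z. cauchy z \<Longrightarrow> null (\<lambda>n. cyclo5 (z n)) \<Longrightarrow> has_sqrt e"
  shows "has_sqrt e \<or> has_quintic_root 0 a"
proof (cases "has_sqrt e")
  case False
  have \<zeta>: "\<not> null (\<lambda>n. cyclo5 (z n))" if "cauchy z" for z using e[OF that] False by blast
  define a0 where "a0 = n0^4 + n0^3 + n0^2 + n0 + 1"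
  have a: "a ^ 5 ^ j = of_nat a0" using a by (simp only: a0_def)
  have a_nz: "a \<noteq> 0"
  proof
    assume "a = 0"
    then have "(of_nat a0 :: 'k) = of_nat 0" using a by (simp add: power_0_left)
    then show False by (simp only: of_nat_eq_iff) (simp add: a0_def)
  qed
  have root: "has_quintic_root 0 a" if "cauchy c" "null (\<lambda>n. c n ^ 5 - a)" for c
    using that unfolding has_quintic_root_def quintic_def by (intro exI[of _ c]) simp
  show ?thesis
  proof (cases "\<exists>m::nat. v (of_nat m) > 1")
    case True
    then obtain m :: nat where m: "v (of_nat m) > 1" by blast
    have "(of_nat a0 :: rat) > 0" by (simp add: a0_def add_pos_nonneg)
    from archimedean_root[OF m this, of "5 ^ (j + 1)"] obtain c where c: "cauchy c"
      "null (\<lambda>n. c n ^ 5 ^ (j + 1) - of_rat (of_nat a0))" by auto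
    then have "null (\<lambda>n. c n ^ 5 ^ (j + 1) - a ^ 5 ^ j)" unfolding a of_rat_of_nat_eq by blast
    from root[OF c(1) fifth_root_descent[OF a_nz \<zeta> c(1) this]] show ?thesis by blast
  next
    case na: False
    then interpret nonarch v by unfold_locales (simp add: not_less)
    show ?thesis
    proof (cases "v 5 < 1")
      case True
      from hensel_pow5[OF True n0] obtain c where c: "cauchy c" "null (\<lambda>n. c n ^ 5 ^ (j + 1) - of_nat a0)"
        unfolding a0_def by blast
      then have "null (\<lambda>n. c n ^ 5 ^ (j + 1) - a ^ 5 ^ j)" unfolding a by blast
      from root[OF c(1) fifth_root_descent[OF a_nz \<zeta> c(1) this]] show ?thesis by blast
    next
      case False
      then have 5: "v 5 = 1" using v_numeral_le[of "num.Bit1 (num.Bit0 num.One)"] by simp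
      have no\<zeta>: "v (cyclo5 z) = 1" if "v z \<le> 1" for z
      proof -
        have "\<not> v (cyclo5 z) < 1" using hensel_cyclo5[OF that _ 5] \<zeta> by metis
        moreover have "v (cyclo5 z) \<le> 1" unfolding cyclo5_def by (intro v_add_le' v_power_le_1 that) simp
        ultimately show ?thesis by simp
      qed
      \<comment> \<open>This is where it matters that \<open>a0\<close> is a value of
        \<open>cyclo5\<close> at an integer: such values are units as long as the residue field has
        no root of \<open>cyclo5\<close>.\<close>
      have "v (of_nat a0) = 1"
        using no\<zeta>[OF v_of_nat_le[of n0]] by (simp add: a0_def cyclo5_def ac_simps)
      then have "v a ^ 5 ^ j = 1" using a by (metis v_power)
      then have va: "v a = 1" using v_nonneg[of a] by (metis power_eq_1_iff real_norm_def abs_of_nonneg zero_neq_numeral power_not_zero)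
      obtain x where x: "v x = 1" "v (a - x ^ 5) < 1"
      proof (rule residue_preimage[OF nf, where P = "\<lambda>x. v x = 1" and g = "\<lambda>x. x ^ 5" and a = a])
        fix x y assume xy: "v x = 1" "v y = 1" "v (x ^ 5 - y ^ 5) < 1"
        then have y: "y \<noteq> 0" by auto
        \<comment> \<open>The factor \<open>cyclo5 (x / y)\<close> is a unit, so \<open>x^5\<close>
          and \<open>y^5\<close> agree modulo the maximal ideal only if x and y do.\<close>
        have "(x / y - 1) * cyclo5 (x / y) = (x ^ 5 - y ^ 5) / y ^ 5"
          unfolding cyclo5_mult using y by (simp add: power_divide diff_divide_distrib)
        then have "v (x / y - 1) * v (cyclo5 (x / y)) = v (x ^ 5 - y ^ 5)"
          using xy by (metis v_mult v_divide v_power power_one div_by_1)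
        moreover have "v (cyclo5 (x / y)) = 1" using xy by (intro no\<zeta>) (simp add: v_divide)
        ultimately have "v (x / y - 1) < 1" using xy by simp
        moreover have "x - y = (x / y - 1) * y" using y by (simp add: field_simps)
        ultimately show "v (x - y) < 1" using xy by (simp add: v_mult)
      qed (use va in \<open>auto simp: v_power\<close>)
      from hensel_root[of a x] va x 5 obtain c where "cauchy c" "null (\<lambda>n. c n ^ 5 - a)" by auto
      then show ?thesis using root by blast
    qed
  qed
qed blast

end

section \<open>The Dickson polynomial of degree 5\<close>

definition dickson :: "'a::comm_ring_1 \<Rightarrow> 'a" where
  "dickson x = x^5 - 5 * x^3 + 5 * x"

text \<open>The sums are the Gauss periods, the two roots of X^2 + X - 1. With
  \<open>z^4 = 1 / z\<close> the differences are z - 1/z and z^2 - 1/z^2, hence the relation (u +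
  1/u)^2 - 4 = (u - 1/u)^2.\<close>

lemma cyclo5_identities:
  fixes z :: "'a::idom"
  assumes "cyclo5 z = 0"
  shows "(z + z^4) + (z^2 + z^3) = - 1" "(z + z^4) * (z^2 + z^3) = - 1"
    "(z + z^4)^2 - 4 = (z - z^4)^2" "(z^2 + z^3)^2 - 4 = (z^2 - z^3)^2"
    "(z - z^4)^2 * (z^2 - z^3)^2 = 5"
proof -
  have "(z + z^4) + (z^2 + z^3) + 1 = cyclo5 z" by (simp add: cyclo5_def)
  then show *: "(z + z^4) + (z^2 + z^3) = - 1" using assms by (simp add: eq_neg_iff_add_eq_0)
  have "(z + z^4) * (z^2 + z^3) + 1 = cyclo5 z * (z^3 - z + 1)"
    unfolding cyclo5_def by Groebner_Basis.algebra
  then show **: "(z + z^4) * (z^2 + z^3) = - 1" using assms by (simp add: eq_neg_iff_add_eq_0)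
  have "(z + z^4)^2 - 4 - (z - z^4)^2 = 4 * ((z - 1) * cyclo5 z)"
    "(z^2 + z^3)^2 - 4 - (z^2 - z^3)^2 = 4 * ((z - 1) * cyclo5 z)"
    unfolding cyclo5_def by Groebner_Basis.algebra+
  then show ***: "(z + z^4)^2 - 4 = (z - z^4)^2" "(z^2 + z^3)^2 - 4 = (z^2 - z^3)^2"
    unfolding assms by simp_all
  have "(x^2 - 4) * (y^2 - 4) = (x * y)^2 - 4 * ((x + y)^2 - 2 * (x * y)) + 16" for x y :: 'a
    by Groebner_Basis.algebra
  from this[of "z + z^4" "z^2 + z^3"] show "(z - z^4)^2 * (z^2 - z^3)^2 = 5"
    unfolding * ** *** by simp
qed

lemma golden_factorization:
  fixes x :: "'a::idom"
  assumes "\<alpha> + \<beta> = - 1" "\<alpha> * \<beta> = - 1"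
  shows "x^4 - 3 * x^2 + 1 = (x^2 - \<alpha>^2) * (x^2 - \<beta>^2)"
proof -
  have "(x^2 - \<alpha>^2) * (x^2 - \<beta>^2) = x^4 - ((\<alpha> + \<beta>)^2 - 2 * (\<alpha> * \<beta>)) * x^2 + (\<alpha> * \<beta>)^2"
    by Groebner_Basis.algebra
  then show ?thesis unfolding assms by simp
qed

text \<open>For x = u + 1/u and fixed value of the polynomial, the other arguments come from
  multiplying u by fifth roots of unity. The two nontrivial conjugate pairs of these give the two
  quadratic factors.\<close>

lemma dickson_diff_factorization:
  fixes x y :: "'a::idom"
  assumes "\<alpha> + \<beta> = - 1" "\<alpha> * \<beta> = - 1"
  shows "dickson x - dickson y =
    (x - y) * (x^2 - \<alpha> * x * y + y^2 + (\<alpha>^2 - 4)) * (x^2 - \<beta> * x * y + y^2 + (\<beta>^2 - 4))"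
proof -
  have \<beta>: "\<beta> = - 1 - \<alpha>" using assms(1) by (metis add_diff_cancel_left')
  have "\<alpha>^2 + \<alpha> - 1 = 0" using assms(2) unfolding \<beta> by (simp add: algebra_simps power2_eq_square)
  then show ?thesis unfolding dickson_def \<beta> by Groebner_Basis.algebra
qed

lemma quintic_1: "quintic 1 a x = dickson x - a"
  by (simp add: quintic_def dickson_def)

text \<open>With x = u + 1/u both sides are (u^5 - 1/u^5)^2. So \<open>dickson\<close> preserves the
  class of \<open>x^2 - 4\<close> modulo squares.\<close>

lemma dickson_square: "dickson x ^ 2 - 4 = (x^2 - 4) * (x^4 - 3 * x^2 + 1)^2"
  unfolding dickson_def by (simp add: algebra_simps eval_nat_numeral)

context nonarch
begin

lemma hensel_dickson:
  assumes "v a \<le> 1" "v x \<le> 1" "v (dickson x - a) < 1" "v (5 * (x^4 - 3 * x^2 + 1)) = 1"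
  shows "has_quintic_root 1 a"
proof -
  define f where "f = [:- a, 5, 0, - 5, 0, 1:]"
  have f: "poly f x = quintic 1 a x" for x
    by (simp add: f_def quintic_def algebra_simps eval_nat_numeral)
  have f': "poly (pderiv f) x = 5 * (x^4 - 3 * x^2 + 1)" for x
    by (simp add: f_def pderiv_pCons algebra_simps eval_nat_numeral)
  have int: "integral_poly f"
    using assms v_numeral_le[of "num.Bit1 (num.Bit0 num.One)"] by (simp add: f_def integral_poly_pCons integral_poly_0)
  from hensel_unit[OF int assms(2)] obtain s where "cauchy s" "null (\<lambda>n. poly f (s n))"
    using assms(3,4) unfolding f f' quintic_1 by blast
  then show ?thesis unfolding has_quintic_root_def f by blast
qed

text \<open>
  On residues \<open>x = u + 1/u\<close> with \<open>u\<close> outside the residue field, \<open>dickson\<close> is injective: it is the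
  fifth power map on a group of order \<open>q + 1\<close>, which is prime to 5.
\<close>

lemma dickson_residue:
  assumes nf: "number_field TYPE('k)" and \<zeta>: "cyclo5 \<zeta> = (0 :: 'k)" and 2: "v 2 = 1" and 5: "v 5 = 1"
    and a: "v a \<le> 1" "v (a^2 - 4) = 1" and nsq: "\<And>w. v w \<le> 1 \<Longrightarrow> \<not> v (w^2 - (a^2 - 4)) < 1"
  shows "has_quintic_root 1 a"
proof -
  define \<alpha> where "\<alpha> = (\<lambda>b. if b then \<zeta> + \<zeta>^4 else \<zeta>^2 + \<zeta>^3)"
  define d where "d = (\<lambda>b. if b then \<zeta> - \<zeta>^4 else \<zeta>^2 - \<zeta>^3)"
  have \<alpha>1: "\<alpha> True + \<alpha> False = - 1" "\<alpha> True * \<alpha> False = - 1"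
    and d1: "\<alpha> True ^ 2 - 4 = d True ^ 2" "\<alpha> False ^ 2 - 4 = d False ^ 2" "d True ^ 2 * d False ^ 2 = 5"
    unfolding \<alpha>_def d_def if_True if_False by (rule cyclo5_identities[OF \<zeta>])+
  have d2: "\<alpha> b ^ 2 - 4 = d b ^ 2" for b using d1 by (cases b) auto
  have "\<zeta> ^ 5 = 1" using cyclo5_mult[of \<zeta>] \<zeta> by simp
  then have "v \<zeta> ^ 5 = 1" by (metis v_power v_1)
  then have v\<zeta>: "v \<zeta> \<le> 1" using v_nonneg[of \<zeta>] by (metis power_eq_1_iff real_norm_def abs_of_nonneg order_refl zero_neq_numeral)
  have v\<alpha>: "v (\<alpha> b) \<le> 1" and vd_le: "v (d b) \<le> 1" for b
    unfolding \<alpha>_def d_def by (auto intro!: v_add_le' v_diff_le' v_power_le_1 v\<zeta>)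
  have "v (d True) ^ 2 * v (d False) ^ 2 = 1" using d1(3) 5 by (metis v_mult v_power)
  then have "v (d True) * v (d False) = 1"
    using v_nonneg[of "d True"] v_nonneg[of "d False"] by (metis mult_nonneg_nonneg power_mult_distrib power2_eq_1_iff order_trans neg_0_le_iff_le not_one_le_zero zero_le_one)
  then have vd: "v (d b) = 1" for b
    using vd_le[of True] vd_le[of False] v_nonneg[of "d True"] v_nonneg[of "d False"]
    by (cases b) (metis mult.commute mult_left_le order_antisym)+
  have v4: "v 4 = 1" using v_mult[of 2 2] 2 by simp
  \<comment> \<open>The integral x for which \<open>x^2 - 4\<close> is a unit and a non-square in
    the residue field: residues u + 1/u with u of norm one in its quadratic extension and outside of
    it.\<close>
  define P where "P = (\<lambda>x. v x \<le> 1 \<and> v (x^2 - 4) = 1 \<and> (\<forall>w. v w \<le> 1 \<longrightarrow> \<not> v (w^2 - (x^2 - 4)) < 1))"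
  have t: "v (x^4 - 3 * x^2 + 1) = 1" if x: "P x" for x
  proof -
    \<comment> \<open>A residue of x equal to plus or minus \<alpha> would make
      \<open>x^2 - 4\<close> the square of \<open>d b\<close>.\<close>
    have "v (x^2 - \<alpha> b ^ 2) = 1" for b
    proof -
      have "x^2 - \<alpha> b ^ 2 = - (d b ^ 2 - (x^2 - 4))" using d2[of b] by (simp add: algebra_simps)
      then have "v (x^2 - \<alpha> b ^ 2) = v (d b ^ 2 - (x^2 - 4))" by (simp only: v_minus)
      moreover have "\<not> v (d b ^ 2 - (x^2 - 4)) < 1" using x vd_le[of b] unfolding P_def by blast
      moreover have "v (x^2 - \<alpha> b ^ 2) \<le> 1" using x v\<alpha> unfolding P_def by (intro v_diff_le' v_power_le_1) auto
      ultimately show ?thesis by simp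
    qed
    moreover have "x^4 - 3 * x^2 + 1 = (x^2 - \<alpha> True ^ 2) * (x^2 - \<alpha> False ^ 2)"
      using \<alpha>1 by (rule golden_factorization)
    ultimately show ?thesis by (simp add: v_mult)
  qed
  obtain x where x: "P x" "v (a - dickson x) < 1"
  proof (rule residue_preimage[OF nf, of P a dickson])
    show "P a" using a nsq unfolding P_def by blast
  next
    fix x assume x: "P x"
    then show vx: "v x \<le> 1" by (simp add: P_def)
    define t where "t = x^4 - 3 * x^2 + 1"
    have vt: "v t = 1" using t[OF x] by (simp add: t_def)
    then have t0: "t \<noteq> 0" by auto
    have sq: "dickson x ^ 2 - 4 = (x^2 - 4) * t^2" unfolding t_def by (rule dickson_square)
    have "v (dickson x) \<le> 1"
      unfolding dickson_def using vx v_numeral_le by (intro v_add_le' v_diff_le' v_mult_le_1 v_power_le_1)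
    moreover have "v (dickson x ^ 2 - 4) = 1" unfolding sq using x vt by (simp add: P_def v_mult v_power)
    moreover have "\<not> v (w^2 - (dickson x ^ 2 - 4)) < 1" if "v w \<le> 1" for w
    proof -
      have "(w / t)^2 - (x^2 - 4) = (w^2 - (dickson x ^ 2 - 4)) / t^2"
        unfolding sq using t0 by (simp add: field_simps)
      then have "v ((w / t)^2 - (x^2 - 4)) = v (w^2 - (dickson x ^ 2 - 4))" by (simp add: v_divide v_power vt)
      moreover have "v (w / t) \<le> 1" using that by (simp add: v_divide vt)
      ultimately show ?thesis using x unfolding P_def by metis
    qed
    ultimately show "P (dickson x)" unfolding P_def by blast
  next
    fix x y assume x: "P x" and y: "P y" and xy: "v (dickson x - dickson y) < 1"
    define q where "q = (\<lambda>b. x^2 - \<alpha> b * x * y + y^2 + d b ^ 2)"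
    have v1: "v x \<le> 1" "v y \<le> 1" using x y by (simp_all add: P_def)
    have q: "v (q b) = 1" for b
    proof -
      define w where "w = (2 * x - \<alpha> b * y) / d b"
      have d0: "d b \<noteq> 0" using vd[of b] by auto
      \<comment> \<open>Completing the square: if \<open>q b\<close> vanished modulo the maximal
        ideal, \<open>y^2 - 4\<close> would be a square there.\<close>
      have "4 * q b = (2 * x - \<alpha> b * y)^2 - d b ^ 2 * (y^2 - 4)"
        unfolding q_def d2[symmetric] by (simp add: algebra_simps power2_eq_square)
      then have "w^2 - (y^2 - 4) = 4 * q b / d b ^ 2"
        unfolding w_def using d0 by (simp add: field_simps)
      then have "v (w^2 - (y^2 - 4)) = v (q b)" by (simp add: v_mult v_divide v_power vd v4)
      moreover have "v (2 * x - \<alpha> b * y) \<le> 1" using v\<alpha> v1 2 by (intro v_diff_le' v_mult_le_1) auto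
      then have "v w \<le> 1" by (simp add: w_def v_divide vd)
      ultimately have "\<not> v (q b) < 1" using y unfolding P_def by metis
      moreover have "v (q b) \<le> 1" unfolding q_def using v\<alpha> v1 vd_le
        by (intro v_add_le' v_diff_le' v_mult_le_1 v_power_le_1) auto
      ultimately show ?thesis by simp
    qed
    have "dickson x - dickson y = (x - y) * q True * q False"
      unfolding q_def d1(1,2)[symmetric] using \<alpha>1 by (rule dickson_diff_factorization)
    with xy show "v (x - y) < 1" by (simp add: v_mult q)
  qed
  have "v (5 * (x^4 - 3 * x^2 + 1)) = 1" using t[OF x(1)] 5 by (simp only: v_mult mult_1_left)
  with hensel_dickson[of a x] x a show ?thesis by (simp add: P_def v_minus_commute[of "dickson x" a])
qed

end

context abs_val
begin

lemma has_sqrt_mult_square: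
  assumes "has_sqrt e" shows "has_sqrt (e * b^2)"
proof -
  obtain r where r: "cauchy r" "null (\<lambda>n. r n ^ 2 - e)" using assms unfolding has_sqrt_def by blast
  have "null (\<lambda>n. (r n ^ 2 - e) * b^2)" by (rule null_mult_cauchy[OF r(2)]) simp
  moreover have "cauchy (\<lambda>n. r n * b)" by (intro cauchy_mult r cauchy_const)
  ultimately show ?thesis unfolding has_sqrt_def
    by (intro exI[of _ "\<lambda>n. r n * b"]) (simp add: algebra_simps power_mult_distrib)
qed

text \<open>The congruence modulo 40 makes \<open>e\<close> a square over 2, as it is 1 modulo 8,
  and over 5, as it is 1 modulo 5. At the remaining finite places \<open>e\<close> and
  \<open>a^2 - 4\<close> are interchangeable up to squares, and a root is found where
  \<open>a\<close> is near 2 or -2 or where \<open>a^2 - 4\<close> is a non-square unit.\<close>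

lemma local_solution_dickson:
  assumes nf: "number_field TYPE('k)" and \<zeta>: "cyclo5 \<zeta> = (0 :: 'k)"
    and e: "e mod 40 = 1" and a: "a^2 - 4 = of_nat e * b^2" "b \<noteq> 0"
  shows "has_sqrt (of_nat e) \<or> has_quintic_root 1 a"
proof (cases "\<exists>m::nat. v (of_nat m) > 1")
  case True
  then obtain m :: nat where m: "v (of_nat m) > 1" by blast
  have "e > 0" using e by (cases e) auto
  then have "(of_nat e :: rat) > 0" by simp
  from archimedean_root[OF m this, of 2] show ?thesis unfolding has_sqrt_def by auto
next
  case False
  then interpret nonarch v by unfold_locales (simp add: not_less)
  define l where "l = e div 40"
  have e: "e = 40 * l + 1" using e by (metis l_def mult_div_mod_eq)
  have e1: "1 - (of_nat e :: 'k) = - (2^3 * (5 * of_nat l))" by (simp add: e algebra_simps)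
  have sqrt_e: "has_sqrt (of_nat e)" if "has_sqrt (a^2 - 4)"
  proof -
    have "has_sqrt ((a^2 - 4) * (inverse b)^2)" using that by (rule has_sqrt_mult_square)
    also have "(a^2 - 4) * (inverse b)^2 = of_nat e" using a by (simp add: field_simps)
    finally show ?thesis .
  qed
  have le: "v 2 \<le> 1" "v 5 \<le> 1" by (rule v_numeral_le)+
  have "has_sqrt (of_nat e)" if "v 2 < 1"
  proof -
    have "v (1^2 - of_nat e) = v 2 ^ 3 * v (of_nat (5 * l))" unfolding power_one e1 by (simp only: v_minus v_mult v_power of_nat_mult of_nat_numeral)
    also have "\<dots> \<le> v 2 ^ 3 * 1" by (intro mult_left_mono v_of_nat_le) simp
    also have "\<dots> < v 2 ^ 2" using that power_strict_decreasing[of 2 3 "v 2"] by simp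
    finally show ?thesis unfolding has_sqrt_def
      using hensel_sqrt[of "of_nat e" 1] v_of_nat_le[of e] by auto
  qed
  moreover have "has_sqrt (of_nat e)" if "v 2 = 1" "v 5 < 1"
  proof -
    have "v (1^2 - of_nat e) = v 5 * v (of_nat l)" unfolding power_one e1
      by (simp only: v_minus v_mult v_power that power_one mult_1_left)
    also have "\<dots> \<le> v 5 * 1" by (intro mult_left_mono v_of_nat_le) simp
    finally have "v (1^2 - of_nat e) < 1" using that by simp
    then show ?thesis unfolding has_sqrt_def
      using hensel_sqrt[of "of_nat e" 1] v_of_nat_le[of e] that by auto
  qed
  moreover have ?thesis if 2: "v 2 = 1" and 5: "v 5 = 1"
  proof (cases "v a \<le> 1")
    case False
    then have a0: "a \<noteq> 0" by auto
    have v4: "v 4 = 1" using v_mult[of 2 2] 2 by simp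
    \<comment> \<open>For large \<open>a\<close> the element \<open>a^2 - 4\<close> is
      \<open>a^2\<close> times an element near 1, hence a square.\<close>
    have "v (1^2 - (1 - 4 / a^2)) = 1 / v a ^ 2" by (simp add: v_divide v_power v4)
    also have "\<dots> < 1"
    proof -
      have "1 < v a ^ 2" using False by (intro one_less_power) simp_all
      then show ?thesis by (simp add: divide_less_eq)
    qed
    finally have "v (1^2 - (1 - 4 / a^2)) < 1" .
    moreover have "v (1 - 4 / a^2) \<le> 1" using v_diff_le'[of 1 1 "1^2 - (1 - 4 / a^2)"] calculation by simp
    ultimately have "has_sqrt (1 - 4 / a^2)" unfolding has_sqrt_def
      using hensel_sqrt[of "1 - 4 / a^2" 1] 2 by auto
    from has_sqrt_mult_square[OF this, of a] have "has_sqrt ((1 - 4 / a^2) * a^2)" .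
    also have "(1 - 4 / a^2) * a^2 = a^2 - 4" using a0 by (simp add: left_diff_distrib)
    finally have "has_sqrt (a^2 - 4)" .
    then show ?thesis using sqrt_e by blast
  next
    case va: True
    consider "v (a - 2) < 1" | "v (a + 2) < 1" | "v (a^2 - 4) = 1"
    proof -
      have "v (a - 2) \<le> 1" "v (a + 2) \<le> 1" using va le by (auto intro: v_diff_le' v_add_le')
      moreover have "a^2 - 4 = (a - 2) * (a + 2)" by (simp add: algebra_simps power2_eq_square)
      then have "v (a^2 - 4) = v (a - 2) * v (a + 2)" by (simp only: v_mult)
      ultimately show thesis using that by (cases "v (a - 2) = 1"; cases "v (a + 2) = 1") auto
    qed
    then show ?thesis
    proof cases
      case 1
      \<comment> \<open>The points 2 and -2 are fixed by \<open>dickson\<close>, and the derivative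
        there is 25, a unit.\<close>
      have "dickson 2 - a = - (a - 2)" by (simp add: dickson_def)
      then have "v (dickson 2 - a) < 1" using 1 by (simp only: v_minus)
      moreover have "(5 * (2^4 - 3 * 2^2 + 1) :: 'k) = 5 * 5" by simp
      then have "v (5 * (2^4 - 3 * 2^2 + 1)) = 1" using 5 v_mult[of 5 5] by (simp only:)
      ultimately show ?thesis using hensel_dickson[of a 2] va le by blast
    next
      case 2
      have "dickson (- 2) - a = - (a + 2)" by (simp add: dickson_def)
      then have "v (dickson (- 2) - a) < 1" using 2 by (simp only: v_minus)
      moreover have "(5 * ((- 2)^4 - 3 * (- 2)^2 + 1) :: 'k) = 5 * 5" by simp
      then have "v (5 * ((- 2)^4 - 3 * (- 2)^2 + 1)) = 1" using 5 v_mult[of 5 5] by (simp only:)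
      moreover have "v (- 2) \<le> 1" using le by simp
      ultimately show ?thesis using hensel_dickson[of a "- 2"] va by blast
    next
      case 3
      show ?thesis
      proof (cases "\<exists>w. v w \<le> 1 \<and> v (w^2 - (a^2 - 4)) < 1")
        case True
        then obtain w where w: "v w \<le> 1" "v (w^2 - (a^2 - 4)) < 1" by blast
        then have "v (w^2) = 1" using v_eq_of_close[of "a^2 - 4" "w^2"] 3 by (simp add: v_minus_commute)
        then have "v (2 * w) ^ 2 = 1" using \<open>v 2 = 1\<close> by (simp add: v_mult v_power)
        then have "has_sqrt (a^2 - 4)" unfolding has_sqrt_def using hensel_sqrt[of "a^2 - 4" w] w 3 by auto
        then show ?thesis using sqrt_e by blast
      next
        case False
        then show ?thesis using dickson_residue[OF nf \<zeta> \<open>v 2 = 1\<close> 5 va 3] by blast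
      qed
    qed
  qed
  ultimately show ?thesis using le by (metis order_le_less)
qed

end

section \<open>Iterated preimages and Eisenstein polynomials\<close>

text \<open>The least m for which \<open>y\<close> is not an m-fold iterate is positive; an element
  one step before it has no further preimage. The bound j < N later controls how divisible by 5 the
  starting data must be.\<close>

lemma last_iterated_preimage:
  assumes "\<And>b. (g ^^ N) b \<noteq> (y :: 'a)"
  obtains j x where "j < N" "(g ^^ j) x = y" "\<And>z. g z \<noteq> x"
proof -
  define m where "m = (LEAST m. \<forall>b. (g ^^ m) b \<noteq> y)"
  have m: "\<forall>b. (g ^^ m) b \<noteq> y" unfolding m_def by (rule LeastI[of _ N]) (use assms in blast)
  have "m \<le> N" unfolding m_def by (rule Least_le) (use assms in blast)
  have "m \<noteq> 0" using m by (metis funpow_0)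
  then obtain j where j: "m = Suc j" by (cases m) auto
  have "\<not> (\<forall>b. (g ^^ j) b \<noteq> y)" using not_less_Least[of j "\<lambda>m. \<forall>b. (g ^^ m) b \<noteq> y"] j by (simp add: m_def)
  then obtain x where x: "(g ^^ j) x = y" by blast
  have "g z \<noteq> x" for z
  proof
    assume "g z = x"
    then have "(g ^^ m) z = y" using x unfolding j funpow_Suc_right by simp
    with m show False by blast
  qed
  with x j \<open>m \<le> N\<close> that show ?thesis by (metis Suc_le_lessD)
qed

section \<open>Eisenstein polynomials and degrees of their roots\<close>

lemma top_coeff_mult_mod_prime:
  fixes f g :: "int poly"
  assumes p: "prime p" and f: "\<not> [:p:] dvd f" and g: "\<not> [:p:] dvd g"
  obtains i j where "\<not> p dvd coeff f i" "\<And>k. k > i \<Longrightarrow> p dvd coeff f k"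
    "\<not> p dvd coeff g j" "\<And>k. k > j \<Longrightarrow> p dvd coeff g k" "\<not> p dvd coeff (f * g) (i + j)"
proof -
  have top: "\<exists>i. \<not> p dvd coeff f i \<and> (\<forall>k>i. p dvd coeff f k)" if f: "\<not> [:p:] dvd f" for f :: "int poly"
  proof -
    define I where "I = {i. \<not> p dvd coeff f i}"
    have "I \<subseteq> {..degree f}" unfolding I_def by (auto intro: le_degree)
    then have fin: "finite I" by (rule finite_subset) simp
    have ne: "I \<noteq> {}" using f unfolding I_def const_poly_dvd_iff by blast
    show ?thesis
      using Max_in[OF fin ne] Max_ge[OF fin] by (intro exI[of _ "Max I"]) (auto simp: I_def not_less[symmetric])
  qed
  obtain i where i: "\<not> p dvd coeff f i" "\<And>k. k > i \<Longrightarrow> p dvd coeff f k" using top[OF f] by blast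
  obtain j where j: "\<not> p dvd coeff g j" "\<And>k. k > j \<Longrightarrow> p dvd coeff g k" using top[OF g] by blast
  have "coeff (f * g) (i + j) = (\<Sum>k\<le>i + j. coeff f k * coeff g (i + j - k))" by (rule coeff_mult)
  also have "\<dots> = coeff f i * coeff g j + (\<Sum>k\<in>{..i + j} - {i}. coeff f k * coeff g (i + j - k))"
    by (subst sum.remove[of _ i]) simp_all
  finally have eq: "coeff (f * g) (i + j) = \<dots>" .
  have rest: "p dvd (\<Sum>k\<in>{..i + j} - {i}. coeff f k * coeff g (i + j - k))"
  proof (rule dvd_sum)
    fix k assume "k \<in> {..i + j} - {i}"
    then have "k > i \<or> i + j - k > j" by auto
    then show "p dvd coeff f k * coeff g (i + j - k)" using i(2) j(2) by auto
  qed
  have "\<not> p dvd coeff f i * coeff g j" using i(1) j(1) p by (simp add: prime_dvd_mult_iff)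
  then have "\<not> p dvd coeff (f * g) (i + j)" unfolding eq using rest by (simp add: dvd_add_left_iff)
  with i j that show ?thesis by blast
qed

text \<open>Eisenstein's criterion with the coefficients in reverse order. A primitive
  \<open>f\<close> of least degree vanishing at \<open>b\<close> divides a multiple of
  \<open>H\<close>. Modulo p the product \<open>f * q\<close> is a nonzero constant, so if both
  factors have positive degree, p divides both leading coefficients and \<open>p^2\<close> divides
  that of \<open>H\<close>.\<close>

lemma eisenstein_root_degree:
  fixes b :: "'k::field_char_0" and H :: "int poly"
  assumes p: "prime p" and H: "\<And>i. i > 0 \<Longrightarrow> p dvd coeff H i" "\<not> p^2 dvd lead_coeff H" "\<not> p dvd coeff H 0"
    and root: "poly (map_poly of_int H) b = 0"
    and g: "g \<noteq> 0" "poly (map_poly of_int g) b = 0"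
  shows "degree H \<le> degree g"
proof (rule ccontr)
  define ev where "ev = (\<lambda>f. poly (map_poly of_int f) b)"
  have map_add: "map_poly of_int (f + h) = (map_poly of_int f + map_poly of_int h :: 'k poly)" for f h
    by (rule poly_eqI) (simp add: coeff_map_poly)
  have map_mult: "map_poly of_int (f * h) = (map_poly of_int f * map_poly of_int h :: 'k poly)" for f h
    by (rule poly_eqI) (simp add: coeff_map_poly coeff_mult)
  have ev_add: "ev (f + h) = ev f + ev h" and ev_mult: "ev (f * h) = ev f * ev h" for f h
    by (simp_all add: ev_def map_add map_mult)
  have ev_const: "ev [:c:] = of_int c" for c by (simp add: ev_def map_poly_pCons)
  have ev_smult: "ev (smult c f) = of_int c * ev f" for c f
    using ev_mult[of "[:c:]" f] ev_const by simp
  define Z where "Z = (\<lambda>f. f \<noteq> 0 \<and> ev f = 0)"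
  assume "\<not> degree H \<le> degree g"
  moreover have "Z g" using g by (simp add: Z_def ev_def)
  ultimately obtain f0 where f0: "Z f0" "degree f0 < degree H" "\<And>f. Z f \<Longrightarrow> degree f0 \<le> degree f"
    using ex_has_least_nat[of Z g degree] by (metis le_less_trans not_le)
  define f where "f = primitive_part f0"
  have c0: "content f0 \<noteq> 0" using f0 by (simp add: Z_def)
  have "smult (content f0) f = f0" by (simp add: f_def)
  then have "of_int (content f0) * ev f = 0" using f0 ev_smult[of "content f0" f] by (simp add: Z_def)
  then have f: "Z f" using c0 f0 by (simp add: Z_def f_def)
  have deg: "degree f = degree f0" by (simp add: f_def)
  have "content f = 1" using f0 by (simp add: f_def Z_def content_primitive_part)
  have pf: "\<not> [:p:] dvd f"
  proof
    assume "[:p:] dvd f"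
    then have "p dvd content f" by (simp add: const_poly_dvd_iff_dvd_content)
    with \<open>content f = 1\<close> p show False by (metis not_prime_unit)
  qed
  have "f \<noteq> 0" using f by (simp add: Z_def)
  define R where "R = pseudo_mod H f"
  obtain t q where tq: "t \<noteq> 0" "smult t H = f * q + R" and R: "R = 0 \<or> degree R < degree f"
    using pseudo_mod[OF \<open>f \<noteq> 0\<close>, of H] unfolding R_def by blast
  have "ev (smult t H) = ev f * ev q + ev R" unfolding tq ev_add ev_mult ..
  then have "ev R = 0" using root f unfolding ev_smult by (simp add: ev_def[symmetric] Z_def) (simp add: ev_def)
  then have "R \<noteq> 0 \<Longrightarrow> degree f0 \<le> degree R" using f0(3)[of R] by (simp add: Z_def)
  then have "R = 0" using R deg by (metis not_le)
  with tq have "\<exists>t q. t \<noteq> 0 \<and> smult t H = f * q" by auto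
  \<comment> \<open>With |t| least, p does not divide t: otherwise p would divide \<open>q\<close>,
    as \<open>f\<close> is primitive, and could be cancelled.\<close>
  then obtain t where "t \<noteq> 0 \<and> (\<exists>q. smult t H = f * q)" and min: "\<And>t'. t' \<noteq> 0 \<and> (\<exists>q. smult t' H = f * q) \<Longrightarrow> nat \<bar>t\<bar> \<le> nat \<bar>t'\<bar>"
    using ex_has_least_nat[of "\<lambda>t. t \<noteq> 0 \<and> (\<exists>q. smult t H = f * q)" _ "\<lambda>t. nat \<bar>t\<bar>"] by blast
  then obtain q where t: "t \<noteq> 0" "smult t H = f * q" by blast
  have pt: "\<not> p dvd t"
  proof
    assume "p dvd t"
    then obtain t' where t': "t = p * t'" by (elim dvdE)
    have "[:p:] dvd smult t H" unfolding const_poly_dvd_iff t' by simp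
    then have "[:p:] dvd f * q" using t by simp
    then have "[:p:] dvd q" using pf p by (metis prime_elem_const_poly_iff prime_elem_dvd_mult_iff prime_imp_prime_elem)
    then obtain q' where q': "q = smult p q'" by (elim dvdE) simp
    have "p \<noteq> 0" using p by auto
    have "smult p (smult t' H) = smult p (f * q')" using t unfolding t' q' by simp
    then have "smult p (smult t' H - f * q') = 0" by (simp only: smult_diff_right diff_self)
    then have "smult t' H - f * q' = 0" using \<open>p \<noteq> 0\<close> by (simp only: smult_eq_0_iff simp_thms)
    then have "smult t' H = f * q'" by simp
    moreover have "t' \<noteq> 0" using t t' by auto
    ultimately have "nat \<bar>t\<bar> \<le> nat \<bar>t'\<bar>" using min by blast
    moreover have "\<bar>t\<bar> = \<bar>p\<bar> * \<bar>t'\<bar>" by (simp add: t' abs_mult)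
    moreover have "\<bar>p\<bar> \<ge> 2" using prime_ge_2_int[OF p] by simp
    then have "2 * \<bar>t'\<bar> \<le> \<bar>p\<bar> * \<bar>t'\<bar>" by (intro mult_right_mono) simp_all
    ultimately show False using \<open>t' \<noteq> 0\<close> by linarith
  qed
  have pH0: "\<not> p dvd coeff (f * q) 0" unfolding t(2)[symmetric] using pt H(3) p by (simp add: prime_dvd_mult_iff)
  have pq: "\<not> [:p:] dvd q"
  proof
    assume "[:p:] dvd q"
    then have "p dvd coeff q 0" by (simp add: const_poly_dvd_iff)
    then show False using pH0 by (simp add: coeff_mult)
  qed
  obtain i j where ij: "\<And>k. k > i \<Longrightarrow> p dvd coeff f k" "\<And>k. k > j \<Longrightarrow> p dvd coeff q k" "\<not> p dvd coeff (f * q) (i + j)"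
    using top_coeff_mult_mod_prime[OF p pf pq] by metis
  have "i + j = 0"
  proof (rule ccontr)
    assume "i + j \<noteq> 0"
    then have "p dvd coeff H (i + j)" using H(1) by simp
    then have "p dvd coeff (f * q) (i + j)" unfolding t(2)[symmetric] by simp
    with ij(3) show False by blast
  qed
  have "H \<noteq> 0" using H(3) by auto
  then have "q \<noteq> 0" using t by auto
  have "degree H = degree f + degree q"
    using t \<open>f \<noteq> 0\<close> \<open>q \<noteq> 0\<close> by (metis degree_mult_eq degree_smult_eq)
  moreover have "degree f > 0"
  proof (rule ccontr)
    assume "\<not> degree f > 0"
    then obtain u where u: "f = [:u:]" by (metis degree_eq_zeroE gr0I)
    then show False using f ev_const by (simp add: Z_def)
  qed
  ultimately have "p dvd lead_coeff f" "p dvd lead_coeff q"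
    using ij(1,2) \<open>i + j = 0\<close> f0(2) deg by auto
  then have "p * p dvd lead_coeff (f * q)" unfolding lead_coeff_mult by (rule mult_dvd_mono)
  then have "p^2 dvd t * lead_coeff H" unfolding t(2)[symmetric] using t(1) by (simp add: power2_eq_square)
  moreover have "coprime (p^2) t" using pt p by (simp add: prime_imp_coprime)
  ultimately have "p^2 dvd lead_coeff H" by (simp add: coprime_dvd_mult_right_iff)
  with H(2) show False by blast
qed

text \<open>The powers 1, b, ..., b^n satisfy an integral relation, so \<open>b\<close> is not a
  root of \<open>s * D - r\<close>, which is Eisenstein in reverse order and of degree above
  n.\<close>

lemma number_field_eisenstein:
  assumes "number_field TYPE('k::field_char_0)"
  obtains n where "\<And>(p :: int) s r D (b :: 'k). prime p \<Longrightarrow> p dvd s \<Longrightarrow> \<not> p^2 dvd s \<Longrightarrow> \<not> p dvd r \<Longrightarrow>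
    lead_coeff D = 1 \<Longrightarrow> degree D > n \<Longrightarrow> of_int s * poly (map_poly of_int D) b \<noteq> of_int r"
proof -
  obtain n where n: "\<And>(b :: nat \<Rightarrow> 'k) p :: int. \<not> p dvd 1 \<Longrightarrow> \<exists>c :: nat \<Rightarrow> int. (\<exists>i\<le>n. \<not> p dvd c i) \<and> (\<Sum>i\<le>n. of_int (c i) * b i) = 0"
    by (rule number_field_int_relation[OF assms]) blast
  have "of_int s * poly (map_poly of_int D) b \<noteq> of_int r"
    if p: "prime p" "p dvd s" "\<not> p^2 dvd s" "\<not> p dvd r" and D: "lead_coeff D = 1" "degree D > n" for p s r D and b :: 'k
  proof
    assume eq: "of_int s * poly (map_poly of_int D) b = of_int r"
    define H where "H = smult s D - [:r:]"
    have "s \<noteq> 0" using p by auto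
    have H_coeff: "coeff H i = s * coeff D i" if "i > 0" for i
      using that by (cases i) (simp_all add: H_def)
    have deg: "degree H = degree D"
    proof (rule antisym)
      show "degree H \<le> degree D" unfolding H_def by (intro degree_diff_le) simp_all
      show "degree D \<le> degree H" using H_coeff[of "degree D"] D \<open>s \<noteq> 0\<close> by (intro le_degree) simp
    qed
    have lead: "lead_coeff H = s" using H_coeff[of "degree D"] D by (simp add: deg)
    have "map_poly of_int H = smult (of_int s) (map_poly of_int D) - [:of_int r :: 'k:]"
      by (rule poly_eqI) (simp add: H_def coeff_map_poly coeff_pCons split: nat.split)
    then have root: "poly (map_poly of_int H) b = 0" using eq by simp
    have "\<not> p dvd 1" using p(1) by (metis not_prime_unit)
    from n[OF this, of "\<lambda>i. b ^ i"] obtain c where c: "\<exists>i\<le>n. \<not> p dvd c i" "(\<Sum>i\<le>n. of_int (c i) * b ^ i) = 0" by blast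
    define g where "g = (\<Sum>i\<le>n. monom (c i) i)"
    have g_coeff: "coeff g i = (if i \<le> n then c i else 0)" for i
      by (simp add: g_def coeff_sum coeff_monom)
    have "g \<noteq> 0" using c(1) g_coeff by (metis coeff_0 dvd_0_right)
    have "degree g \<le> n" by (rule degree_le) (simp add: g_coeff)
    have "map_poly of_int g = (\<Sum>i\<le>n. monom (of_int (c i) :: 'k) i)"
      by (rule poly_eqI) (simp add: coeff_map_poly g_coeff coeff_sum coeff_monom)
    then have "poly (map_poly of_int g) b = 0" using c(2) by (simp add: poly_sum poly_monom)
    from eisenstein_root_degree[OF p(1) _ _ _ root \<open>g \<noteq> 0\<close> this]
    have "degree H \<le> degree g" using p H_coeff lead
      by (simp add: H_def dvd_diff_right_iff)
    with deg D \<open>degree g \<le> n\<close> show False by simp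
  qed
  then show ?thesis using that by blast
qed

section \<open>Non-square radicands\<close>

text \<open>
  \<open>conductor i\<close> is the product of the \<open>radicand j\<close> with \<open>j < i\<close>, so the radicands are pairwise coprime. They
  are not squares, and a number field contains square roots of only finitely many of them.
\<close>

fun conductor :: "nat \<Rightarrow> nat" where
  "conductor 0 = 1"
| "conductor (Suc i) = conductor i * (1 + 3600 * (conductor i)^2)"

text \<open>With 3600 = 60^2 this is 1 + (60 Q)^2 for Q the conductor: never a square, 1 modulo 40,
  and with 60 Q available as a denominator divisible by 3.\<close>

definition radicand :: "nat \<Rightarrow> nat" where
  "radicand i = 1 + 3600 * (conductor i)^2"

lemma conductor_pos: "conductor i > 0"
  by (induction i) simp_all

lemma radicand_dvd_conductor: "j < i \<Longrightarrow> radicand j dvd conductor i"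
proof (induction i)
  case (Suc i)
  have "conductor (Suc i) = conductor i * radicand i" by (simp add: radicand_def)
  moreover have "radicand j dvd conductor i \<or> j = i" using Suc by auto
  ultimately show ?case by auto
qed simp

lemma coprime_radicand: assumes "i \<noteq> j" shows "coprime (radicand i) (radicand j)"
proof -
  have "coprime (radicand i) (radicand j)" if "i < j" for i j
  proof (rule coprimeI)
    fix c assume c: "c dvd radicand i" "c dvd radicand j"
    then have "c dvd conductor j" using radicand_dvd_conductor[OF that] dvd_trans by blast
    then have "c dvd 3600 * (conductor j)^2" by (simp add: power2_eq_square)
    with c(2) show "c dvd 1" unfolding radicand_def using dvd_add_left_iff by blast
  qed
  with assms show ?thesis by (metis coprime_commute nat_neq_iff)
qed

lemma radicand_not_square: "radicand i \<noteq> m^2"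
proof
  assume eq: "radicand i = m^2"
  define k where "k = 60 * conductor i"
  have k: "m^2 = k^2 + 1" "k > 0" using eq conductor_pos[of i] by (simp_all add: radicand_def k_def power_mult_distrib)
  have "k < m" using k(1) by (metis less_add_one power_less_imp_less_base zero_le)
  then have "(k + 1)^2 \<le> m^2" by (intro power_mono) simp_all
  with k show False by (simp add: power2_eq_square)
qed

lemma prod_radicand_not_square:
  assumes "finite T" "T \<noteq> {}" shows "prod radicand T \<noteq> m^2"
proof
  assume eq: "prod radicand T = m^2"
  obtain i where i: "i \<in> T" using assms by blast
  have "radicand i * prod radicand (T - {i}) = m^2" using eq assms i by (simp add: prod.remove)
  moreover have "coprime (radicand i) (prod radicand (T - {i}))"
    by (rule prod_coprime_right) (auto intro: coprime_radicand)
  moreover have "prod radicand (T - {i}) > 0" by (intro prod_pos) (simp add: radicand_def)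
  ultimately have "is_nth_power 2 (radicand i)"
    by (intro is_nth_power_mult_coprime_natD(1)[of "radicand i" "prod radicand (T - {i})"])
      (auto simp: radicand_def is_nth_power_def)
  then show False using radicand_not_square unfolding is_nth_power_def by blast
qed

text \<open>If all square roots \<open>r i\<close> existed, consider the tower F i = Q(r 0, ..., r
  (i - 1)). By induction no nonempty product of radicands with index at least i becomes a square in
  \<open>F i\<close>; in particular each \<open>r i\<close> is new. A linear relation among finitely
  many \<open>r i\<close> contradicts this at its highest index.\<close>

lemma number_field_nonsquare_radicand:
  assumes "number_field TYPE('k::field_char_0)"
  obtains i where "\<And>x :: 'k. x^2 \<noteq> of_nat (radicand i)"
proof (rule ccontr)
  assume "\<not> thesis"
  with that have "\<forall>i. \<exists>x :: 'k. x^2 = of_nat (radicand i)" by blast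
  then obtain r :: "nat \<Rightarrow> 'k" where r: "\<And>i. r i ^ 2 = of_nat (radicand i)" by metis
  define F :: "nat \<Rightarrow> 'k set" where "F = rec_nat (range of_rat) (\<lambda>i A. {x + y * r i | x y. x \<in> A \<and> y \<in> A})"
  have F: "F 0 = range of_rat" "\<And>i. F (Suc i) = {x + y * r i | x y. x \<in> F i \<and> y \<in> F i}" by (simp_all add: F_def)
  define closed :: "'k set \<Rightarrow> bool" where "closed = (\<lambda>A. range of_rat \<subseteq> A \<and>
    (\<forall>x\<in>A. \<forall>y\<in>A. x + y \<in> A \<and> x * y \<in> A) \<and> (\<forall>x\<in>A. - x \<in> A \<and> inverse x \<in> A))"
  have main: "closed (F i) \<and> (\<forall>T z. finite T \<and> T \<noteq> {} \<and> T \<subseteq> {i..} \<and> z \<in> F i \<longrightarrow> z^2 \<noteq> of_nat (prod radicand T))" for i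
  proof (induction i)
    case 0
    have "closed (F 0)"
      unfolding closed_def F
      by (auto simp flip: of_rat_add of_rat_mult of_rat_minus of_rat_inverse)
    moreover have "(of_rat q :: 'k)^2 \<noteq> of_nat (prod radicand T)" if T: "finite T" "T \<noteq> {}" for q T
    proof
      assume "(of_rat q :: 'k)^2 = of_nat (prod radicand T)"
      then have "(of_rat (q^2) :: 'k) = of_rat (of_nat (prod radicand T))" by (simp add: of_rat_power del: of_nat_prod)
      then have q: "q^2 = of_nat (prod radicand T)" by (simp only: of_rat_eq_iff)
      obtain a b where ab: "quotient_of q = (a, b)" by (cases "quotient_of q")
      then have "b > 0" "coprime a b" "q = of_int a / of_int b"
        using quotient_of_denom_pos quotient_of_coprime quotient_of_div by blast+
      then have "rat_of_int a = q * of_int b" by simp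
      then have "rat_of_int (a^2) = of_int (b^2) * q^2" by (simp add: power_mult_distrib)
      then have "rat_of_int (a^2) = of_int (b^2 * int (prod radicand T))"
        unfolding q by (simp only: of_int_mult of_int_of_nat_eq)
      then have eq: "a^2 = b^2 * int (prod radicand T)" by (simp only: of_int_eq_iff)
      then have "b^2 dvd a^2" by simp
      then have "b dvd a" by simp
      then have "b = 1" using coprime_common_divisor[OF \<open>coprime a b\<close>, of b] \<open>b > 0\<close> by simp
      then have "int ((nat \<bar>a\<bar>)^2) = int (prod radicand T)" using eq by simp
      then have "(nat \<bar>a\<bar>)^2 = prod radicand T" by (simp only: of_nat_eq_iff)
      then show False using prod_radicand_not_square[OF T] by metis
    qed
    ultimately show ?case unfolding F by blast
  next
    case (Suc i)
    then have cl: "closed (F i)" and ns: "\<And>T z. finite T \<Longrightarrow> T \<noteq> {} \<Longrightarrow> T \<subseteq> {i..} \<Longrightarrow> z \<in> F i \<Longrightarrow> z^2 \<noteq> of_nat (prod radicand T)"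
      by blast+
    have add: "x + y \<in> F i" and mult: "x * y \<in> F i" if "x \<in> F i" "y \<in> F i" for x y
      using cl that unfolding closed_def by blast+
    have uminus: "- x \<in> F i" and inv: "inverse x \<in> F i" if "x \<in> F i" for x
      using cl that unfolding closed_def by blast+
    have rat: "of_rat q \<in> F i" for q using cl unfolding closed_def by blast
    have nat: "of_nat n \<in> F i" for n using rat[of "of_nat n"] by simp
    have minus: "x - y \<in> F i" if "x \<in> F i" "y \<in> F i" for x y
      using add[OF that(1) uminus[OF that(2)]] by simp
    have divide: "x / y \<in> F i" if "x \<in> F i" "y \<in> F i" for x y
      using mult[OF that(1) inv[OF that(2)]] by (simp add: divide_inverse)
    have ns1: "z^2 \<noteq> of_nat (radicand i)" if "z \<in> F i" for z using ns[of "{i}" z] that by simp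
    have memI: "x + y * r i \<in> F (Suc i)" if "x \<in> F i" "y \<in> F i" for x y using that unfolding F by blast
    have rr: "r i * r i = of_nat (radicand i)" using r[of i] by (simp add: power2_eq_square)
    have "closed (F (Suc i))"
      unfolding closed_def
    proof (intro conjI ballI subsetI)
      fix x assume "x \<in> range (of_rat :: rat \<Rightarrow> 'k)"
      then show "x \<in> F (Suc i)" using memI[of x 0] rat nat[of 0] by auto
    next
      fix z z' assume "z \<in> F (Suc i)" "z' \<in> F (Suc i)"
      then obtain x y x' y' where z: "z = x + y * r i" "x \<in> F i" "y \<in> F i" and z': "z' = x' + y' * r i" "x' \<in> F i" "y' \<in> F i"
        unfolding F by blast
      have "z + z' = (x + x') + (y + y') * r i" by (simp add: z z' algebra_simps)
      then show "z + z' \<in> F (Suc i)" using memI add z z' by metis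
      have "z * z' = (x * x' + y * y' * (r i * r i)) + (x * y' + y * x') * r i"
        by (simp add: z z' algebra_simps)
      then have "z * z' = (x * x' + y * y' * of_nat (radicand i)) + (x * y' + y * x') * r i" unfolding rr .
      moreover have "x * x' + y * y' * of_nat (radicand i) \<in> F i" "x * y' + y * x' \<in> F i"
        by (intro add mult nat z z')+
      ultimately show "z * z' \<in> F (Suc i)" using memI by metis
    next
      fix z assume "z \<in> F (Suc i)"
      then obtain x y where z: "z = x + y * r i" "x \<in> F i" "y \<in> F i" unfolding F by blast
      have "- z = - x + (- y) * r i" by (simp add: z)
      then show "- z \<in> F (Suc i)" using memI[OF uminus uminus] z by metis
      define N where "N = x * x - y * y * of_nat (radicand i)"
      have N: "N \<in> F i" unfolding N_def by (intro minus mult nat z)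
      have zN: "z * (x - y * r i) = N"
        unfolding N_def rr[symmetric] z by (simp add: algebra_simps)
      show "inverse z \<in> F (Suc i)"
      proof (cases "N = 0")
        case True
        have "y = 0"
        proof (rule ccontr)
          assume "y \<noteq> 0"
          then have "(x / y)^2 = of_nat (radicand i)" using True by (simp add: N_def field_simps power2_eq_square)
          then show False using ns1 divide z by blast
        qed
        then have "z = x" by (simp add: z)
        then show ?thesis using memI[OF inv[OF z(2)] nat[of 0]] by simp
      next
        case False
        then have "inverse z = (x - y * r i) / N" using zN by (metis inverse_unique mult_eq_0_iff nonzero_eq_divide_eq mult.commute times_divide_eq_right divide_self)
        also have "\<dots> = x / N + (- y / N) * r i" by (simp add: diff_divide_distrib)
        finally show ?thesis using memI[OF divide[OF z(2) N] divide[OF uminus[OF z(3)] N]] by metis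
      qed
    qed
    moreover have "z^2 \<noteq> of_nat (prod radicand T)" if T: "finite T" "T \<noteq> {}" "T \<subseteq> {Suc i..}" and z: "z \<in> F (Suc i)" for T z
    proof
      assume eq: "z^2 = of_nat (prod radicand T)"
      define m where "m = (of_nat (prod radicand T) :: 'k)"
      define E where "E = (of_nat (radicand i) :: 'k)"
      have mE: "m \<in> F i" "E \<in> F i" unfolding m_def E_def by (rule nat)+
      obtain x y where xy: "z = x + y * r i" "x \<in> F i" "y \<in> F i" using z unfolding F by blast
      have "z^2 = x^2 + y^2 * (r i * r i) + 2 * x * y * r i" by (simp add: xy power2_eq_square algebra_simps)
      then have m: "m = x^2 + y^2 * E + 2 * x * y * r i" using eq unfolding rr by (simp add: m_def E_def)
      \<comment> \<open>Since \<open>r i\<close> is not in \<open>F i\<close>, the cross term must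
        vanish. If x = 0 and y is nonzero, the factor \<open>radicand i\<close> joins the
        product.\<close>
      consider "y = 0" | "x = 0" "y \<noteq> 0" | "x \<noteq> 0" "y \<noteq> 0" by blast
      then show False
      proof cases
        case 1
        then have "x^2 = of_nat (prod radicand T)" using m by (simp add: m_def)
        moreover have "T \<subseteq> {i..}" using T(3) by auto
        ultimately show False using ns T xy(2) by blast
      next
        case 2
        then have "(y * E)^2 = E * m" using m by (simp add: power2_eq_square)
        also have "\<dots> = of_nat (prod radicand (insert i T))"
          using T by (subst prod.insert) (auto simp: E_def m_def)
        finally have "(y * E)^2 = of_nat (prod radicand (insert i T))" .
        moreover have "y * E \<in> F i" using mult xy mE by blast
        moreover have "finite (insert i T)" "insert i T \<noteq> {}" "insert i T \<subseteq> {i..}" using T by auto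
        ultimately show False using ns by blast
      next
        case 3
        then have "r i = (m - x * x - y * y * E) / ((1 + 1) * x * y)" using m by (simp add: field_simps power2_eq_square)
        moreover have "(m - x * x - y * y * E) / ((1 + 1) * x * y) \<in> F i"
          using nat[of 1] by (intro divide minus mult add mE xy) simp_all
        ultimately show False using ns1 r by metis
      qed
    qed
    ultimately show ?case by blast
  qed
  have F_mono: "F i \<subseteq> F j" if "i \<le> j" for i j
    using that
  proof (induction j rule: dec_induct)
    case (step j)
    have "x \<in> F (Suc j)" if "x \<in> F j" for x
    proof -
      have "0 \<in> F j" using main[of j] rangeI[of "of_rat :: rat \<Rightarrow> 'k" 0] unfolding closed_def by auto
      then have "x + 0 * r j \<in> F (Suc j)" using that unfolding F by blast
      then show ?thesis by simp
    qed
    with step show ?case by blast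
  qed simp
  obtain n where n: "\<And>b :: nat \<Rightarrow> 'k. \<exists>c :: nat \<Rightarrow> rat. (\<exists>i\<le>n. c i \<noteq> 0) \<and> (\<Sum>i\<le>n. of_rat (c i) * b i) = 0"
    by (rule number_field_relation[OF assms]) blast
  then obtain c :: "nat \<Rightarrow> rat" where c: "\<exists>i\<le>n. c i \<noteq> 0" "(\<Sum>i\<le>n. of_rat (c i) * r i) = 0" by blast
  define d where "d = Max {i. i \<le> n \<and> c i \<noteq> 0}"
  have fin: "finite {i. i \<le> n \<and> c i \<noteq> 0}" by simp
  have ne: "{i. i \<le> n \<and> c i \<noteq> 0} \<noteq> {}" using c(1) by auto
  have d: "d \<le> n" "c d \<noteq> 0" using Max_in[OF fin ne] by (simp_all add: d_def)
  have above: "c i = 0" if "i \<le> n" "i > d" for i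
    using that Max_ge[OF fin, of i] unfolding d_def[symmetric] by fastforce
  have "(\<Sum>i\<le>n. of_rat (c i) * r i) = (\<Sum>i\<le>d. of_rat (c i) * r i)"
    by (rule sum.mono_neutral_right) (use d above in auto)
  also have "\<dots> = (\<Sum>i<d. of_rat (c i) * r i) + of_rat (c d) * r d"
    by (simp only: lessThan_Suc_atMost[symmetric] sum.lessThan_Suc)
  finally have eq: "r d = (\<Sum>i<d. of_rat (c i) * r i) * - inverse (of_rat (c d))"
    using c(2) d by (simp add: field_simps eq_neg_iff_add_eq_0)
  have cl: "closed (F d)" using main by blast
  have rat: "of_rat q \<in> F d" for q using cl unfolding closed_def by blast
  have mem: "r i \<in> F d" if "i < d" for i
  proof -
    have "0 \<in> F i" "1 \<in> F i"
      using main[of i] rangeI[of "of_rat :: rat \<Rightarrow> 'k" 0] rangeI[of "of_rat :: rat \<Rightarrow> 'k" 1] unfolding closed_def by auto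
    then have "0 + 1 * r i \<in> F (Suc i)" unfolding F by blast
    then show ?thesis using F_mono[of "Suc i" d] that by auto
  qed
  have sum: "(\<Sum>i\<in>A. of_rat (c i) * r i) \<in> F d" if "A \<subseteq> {..<d}" for A
    using finite_subset[OF that finite_lessThan] that
  proof (induction A rule: finite_induct)
    case empty
    show ?case using rat[of 0] by simp
  next
    case (insert i A)
    then have "r i \<in> F d" using mem by blast
    with insert have "of_rat (c i) * r i \<in> F d" "(\<Sum>i\<in>A. of_rat (c i) * r i) \<in> F d"
      using cl rat[of "c i"] unfolding closed_def by blast+
    with insert cl show ?case unfolding closed_def by simp
  qed
  from sum[of "{..<d}"] have r_mem: "r d \<in> F d"
    unfolding eq using cl rat[of "c d"] unfolding closed_def by blast
  have "\<forall>T z. finite T \<and> T \<noteq> {} \<and> T \<subseteq> {d..} \<and> z \<in> F d \<longrightarrow> z^2 \<noteq> of_nat (prod radicand T)" using main by blast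
  from this[rule_format, of "{d}" "r d"] have "r d ^ 2 \<noteq> of_nat (prod radicand {d})" using r_mem by simp
  then show False using r by simp
qed

section \<open>The Hasse principle for lines\<close>

lemma completions_contain_line:
  fixes e a c :: "'k::field_char_0"
  assumes "\<And>v :: 'k \<Rightarrow> real. abs_val v \<Longrightarrow> abs_val.has_sqrt v e \<or> abs_val.has_quintic_root v c a"
  shows "\<forall>P\<in>places. \<forall>v\<in>P. contains_line (completion v) (to_completion v) (surface e a c)"
proof (intro ballI)
  fix P and v :: "'k \<Rightarrow> real" assume "P \<in> places" "v \<in> P"
  then have "absolute_value v" unfolding places_def quotient_def absolute_value_equiv_def by auto
  then have "abs_val v" by (rule abs_val.intro)
  then show "contains_line (completion v) (to_completion v) (surface e a c)"
    using assms abs_val.line_if_local_solution by blast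
qed

lemma counterexampleI:
  fixes e a c :: "'k::field_char_0"
  assumes e: "\<And>x. x^2 \<noteq> e" and a: "a \<noteq> 0" and irr: "nonroot_below_5 c a"
    and d: "11 - 20 * c * e + 5 * c^2 * e^2 \<noteq> 0"
    and loc: "\<And>v :: 'k \<Rightarrow> real. abs_val v \<Longrightarrow> abs_val.has_sqrt v e \<or> abs_val.has_quintic_root v c a"
  shows "\<exists>F :: (4 \<Rightarrow>\<^sub>0 nat) \<Rightarrow>\<^sub>0 'k.
           cubic_form F \<and> smooth_surface F \<and>
           \<not> contains_line ring_of_type_algebra id F \<and>
           (\<forall>P\<in>places. \<forall>v\<in>P. contains_line (completion v) (to_completion v) F)"
proof (intro exI conjI)
  have "e \<noteq> 0" using e[of 0] by auto
  then show "cubic_form (surface e a c)" by (rule cubic_form_surface)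
  show "smooth_surface (surface e a c)" by (rule smooth_surface_surface[OF e a irr d])
  show "\<not> contains_line ring_of_type_algebra id (surface e a c)" by (rule no_line_surface[OF e a irr])
qed (rule completions_contain_line[OF loc])

section \<open>Quadratic steps in the fifth cyclotomic extension\<close>

context abs_val
begin

text \<open>The quadratic Gauss sum 1 + 2 (z + 1/z) is a square root of 5.\<close>

lemma has_sqrt_5_if_cyclo5_root:
  assumes z: "cauchy z" "null (\<lambda>n. cyclo5 (z n))"
  shows "has_sqrt 5"
proof -
  define r where "r = (\<lambda>n. 1 + 2 * (z n + z n ^ 4))"
  have "r n ^ 2 - 5 = cyclo5 (z n) * (4 * (z n ^ 4 - z n ^ 3 + 2 * z n - 1))" for n
    unfolding r_def cyclo5_def by Groebner_Basis.algebra
  moreover have "null (\<lambda>n. cyclo5 (z n) * (4 * (z n ^ 4 - z n ^ 3 + 2 * z n - 1)))"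
    by (intro null_mult_cauchy z cauchy_mult cauchy_add cauchy_diff cauchy_power cauchy_const)
  moreover have "cauchy r" unfolding r_def
    by (intro cauchy_mult cauchy_add cauchy_power cauchy_const z)
  ultimately show ?thesis unfolding has_sqrt_def by auto
qed

text \<open>If q already lies in k, adjoining z means adjoining z - 1/z. Its square is s^2 - 4 with
  s = z + 1/z = (-1 + q) / 2 or the conjugate value, that is -(5 + q) / 2 or -(5 - q) / 2.\<close>

lemma has_sqrt_delta_if_cyclo5_root:
  assumes z: "cauchy z" "null (\<lambda>n. cyclo5 (z n))" and q: "q^2 = 5"
  shows "has_sqrt (- (5 + q) / 2)"
proof -
  define s where "s = (\<lambda>n. z n + z n ^ 4)"
  define d where "d = (\<lambda>n. z n - z n ^ 4)"
  have s: "cauchy s" and d: "cauchy d" unfolding s_def d_def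
    by (intro cauchy_add cauchy_diff cauchy_power z)+
  have "(2 * s n + 1 - q) * (2 * s n + 1 + q) = cyclo5 (z n) * (4 * (z n ^ 4 - z n ^ 3 + 2 * z n - 1))" for n
  proof -
    have "(2 * s n + 1 - q) * (2 * s n + 1 + q) = (2 * s n + 1)^2 - q^2" by Groebner_Basis.algebra
    also have "\<dots> = cyclo5 (z n) * (4 * (z n ^ 4 - z n ^ 3 + 2 * z n - 1))"
      unfolding q s_def cyclo5_def by Groebner_Basis.algebra
    finally show ?thesis .
  qed
  then have "null (\<lambda>n. (2 * s n + 1 - q) * (2 * s n + 1 + q))"
    by (simp only:) (intro null_mult_cauchy z cauchy_mult cauchy_add cauchy_diff cauchy_power cauchy_const)
  moreover have "cauchy (\<lambda>n. 2 * s n + 1 - q)" "cauchy (\<lambda>n. 2 * s n + 1 + q)"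
    by (intro cauchy_mult cauchy_add cauchy_diff cauchy_const s)+
  ultimately have or: "null (\<lambda>n. 2 * s n + 1 - q) \<or> null (\<lambda>n. 2 * s n + 1 + q)" by (rule null_mult_imp[rotated 2])
  have d_sq: "has_sqrt (- (5 + p) / 2)" if p: "p^2 = 5" and n: "null (\<lambda>n. 2 * s n + 1 - p)" for p
  proof -
    have "4 * (d n ^ 2 - (- (5 + p) / 2)) = (2 * s n + 1 - p) * (2 * s n - 1 + p) - cyclo5 (z n) * (16 * (z n - 1))" for n
    proof -
      have "4 * (d n ^ 2 - (- (5 + p) / 2)) = 4 * d n ^ 2 + 10 + 2 * p" by (simp add: field_simps)
      also have "\<dots> = (2 * s n + 1 - p) * (2 * s n - 1 + p) - 16 * ((z n - 1) * cyclo5 (z n)) + (p^2 - 5)"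
        unfolding d_def s_def cyclo5_mult by Groebner_Basis.algebra
      finally show ?thesis using p by (simp add: algebra_simps)
    qed
    then have eq: "d n ^ 2 - (- (5 + p) / 2) = ((2 * s n + 1 - p) * (2 * s n - 1 + p) - cyclo5 (z n) * (16 * (z n - 1))) * (1 / 4)" for n
      by (metis mult.commute nonzero_mult_div_cancel_left times_divide_eq_right mult_1_right zero_neq_numeral)
    have "null (\<lambda>n. d n ^ 2 - (- (5 + p) / 2))"
      unfolding eq by (intro null_mult_cauchy[OF null_diff] null_mult_cauchy n z s cauchy_mult cauchy_add cauchy_diff cauchy_const)
    with d show ?thesis unfolding has_sqrt_def by blast
  qed
  from or show ?thesis
  proof
    assume "null (\<lambda>n. 2 * s n + 1 - q)"
    then show ?thesis using d_sq q by blast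
  next
    assume "null (\<lambda>n. 2 * s n + 1 + q)"
    then have *: "has_sqrt (- (5 + (- q)) / 2)" using d_sq[of "- q"] q by simp
    \<comment> \<open>The two candidates differ by a square, because (5 + q) (5 - q) = 20 = (2
      q)^2.\<close>
    have "q \<noteq> 5" using q by auto
    then have q5: "5 - q \<noteq> 0" by simp
    have "- u / 2 * (2 * q / u)^2 = - (2 * q^2) / u" if "u \<noteq> 0" for u
      using that by (simp add: field_simps power2_eq_square)
    moreover have "5 + (- q) = 5 - q" by simp
    ultimately have "- (5 + (- q)) / 2 * (2 * q / (5 - q))^2 = - (2 * q^2) / (5 - q)" using q5 by metis
    also have "\<dots> = - (5 + q) / 2"
    proof -
      have "2 * (2 * q^2) = (5 + q) * (5 - q)" using q by (simp add: algebra_simps power2_eq_square)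
      then show ?thesis using q5 by (simp add: field_simps)
    qed
    finally show ?thesis using has_sqrt_mult_square[OF *, of "2 * q / (5 - q)"] by simp
  qed
qed

end

section \<open>Fields without a primitive fifth root of unity\<close>

lemma funpow_fifth_power: "((\<lambda>x. x ^ 5) ^^ j) (b :: 'a :: comm_monoid_mult) = b ^ 5 ^ j"
  by (induction j) (simp_all add: mult.commute flip: power_mult)

text \<open>The value of \<open>cyclo5\<close> at 4 is 341 = 11 * 31, so 11 divides it exactly once.
  As 5^55 is 1 modulo 121, multiplying 4 by powers of 5^55 leaves this unchanged while making
  \<open>n0\<close> highly divisible by 5.\<close>

lemma cyclo5_value_mod_121:
  fixes K :: nat
  defines "n0 \<equiv> 4 * 5 ^ (55 * K) :: nat"
  shows "(n0^4 + n0^3 + n0^2 + n0 + 1) mod 121 = 99"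
proof -
  have *: "(5 ^ 55 :: nat) mod 121 = 1" by simp
  have "(5 ^ (55 * K) :: nat) mod 121 = (5 ^ 55 mod 121) ^ K mod 121" by (simp only: power_mult power_mod)
  then have "(5 ^ (55 * K) :: nat) mod 121 = 1" unfolding * by simp
  moreover have "n0 mod 121 = 4 * (5 ^ (55 * K) mod 121) mod 121" unfolding n0_def by (simp only: mod_mult_right_eq)
  ultimately have n0: "n0 mod 121 = 4" by simp
  have pow: "n0 ^ i mod 121 = 4 ^ i mod 121" for i using power_mod[of n0 121 i] n0 by simp
  have "(n0^4 + n0^3 + n0^2 + n0 + 1) mod 121 = (4^4 + 4^3 + 4^2 + 4 + 1) mod 121"
    by (intro mod_add_cong pow refl) (simp add: n0)
  then show ?thesis by simp
qed

theorem hasse_failure_pure: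
  assumes nf: "number_field TYPE('k::field_char_0)" and \<zeta>: "\<And>z :: 'k. cyclo5 z \<noteq> 0"
  shows "\<exists>F :: (4 \<Rightarrow>\<^sub>0 nat) \<Rightarrow>\<^sub>0 'k.
           cubic_form F \<and> smooth_surface F \<and>
           \<not> contains_line ring_of_type_algebra id F \<and>
           (\<forall>P\<in>places. \<forall>v\<in>P. contains_line (completion v) (to_completion v) F)"
proof -
  obtain n where n: "\<And>(p :: int) s r D (b :: 'k). prime p \<Longrightarrow> p dvd s \<Longrightarrow> \<not> p^2 dvd s \<Longrightarrow> \<not> p dvd r \<Longrightarrow>
    lead_coeff D = 1 \<Longrightarrow> degree D > n \<Longrightarrow> of_int s * poly (map_poly of_int D) b \<noteq> of_int r"
    by (rule number_field_eisenstein[OF nf]) blast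
  define n0 :: nat where "n0 = 4 * 5 ^ (55 * (n + 1))"
  define a0 where "a0 = n0^4 + n0^3 + n0^2 + n0 + 1"
  have mod: "a0 mod 121 = 99" unfolding a0_def n0_def by (rule cyclo5_value_mod_121)
  have "((\<lambda>x. x ^ 5) ^^ (n + 1)) b \<noteq> of_nat a0" for b :: 'k
  proof
    assume "((\<lambda>x. x ^ 5) ^^ (n + 1)) b = of_nat a0"
    then have b: "b ^ 5 ^ (n + 1) = of_nat a0" by (simp only: funpow_fifth_power)
    define m :: nat where "m = 5 ^ (n + 1)"
    have "n < m" unfolding m_def using less_exp[of "n + 1"] power_mono[of "2 :: nat" 5 "n + 1"] by simp
    have a0_nz: "(of_nat a0 :: 'k) \<noteq> 0" by (simp only: of_nat_eq_0_iff) (simp add: a0_def)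
    \<comment> \<open>The prime 11 divides \<open>a0\<close> and not 1, so the relation is put into
      Eisenstein shape by passing to the inverse of \<open>b\<close>.\<close>
    have "of_int (int a0) * poly (map_poly of_int (monom 1 m)) (inverse b) = (of_int 1 :: 'k)"
    proof -
      have "b ^ m = of_nat a0" using b by (simp only: m_def)
      then show ?thesis using a0_nz by (simp add: map_poly_monom poly_monom power_inverse)
    qed
    moreover have "11 dvd int a0" "\<not> 121 dvd int a0"
    proof -
      have "a0 = 11 * (11 * (a0 div 121) + 9)" using div_mult_mod_eq[of a0 121] mod by simp
      then have "11 dvd a0" by (rule dvdI)
      moreover have "\<not> 121 dvd a0" using mod by (simp add: dvd_eq_mod_eq_0)
      ultimately show "11 dvd int a0" "\<not> 121 dvd int a0"
        using int_dvd_int_iff[of 11 a0] int_dvd_int_iff[of 121 a0] by simp_all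
    qed
    moreover have "(11 :: int)^2 = 121" by simp
    ultimately show False
      using n[of 11 "int a0" 1 "monom 1 m" "inverse b"] \<open>n < m\<close> by (simp add: degree_monom_eq lead_coeff_monom)
  qed
  from last_iterated_preimage[of "n + 1" "\<lambda>x. x ^ 5" "of_nat a0 :: 'k", OF this] obtain j a
    where j: "j < n + 1" and a: "((\<lambda>x. x ^ 5) ^^ j) a = of_nat a0" and irr: "\<And>z. z ^ 5 \<noteq> (a :: 'k)" by blast
  have a: "a ^ 5 ^ j = of_nat a0" using a by (simp only: funpow_fifth_power)
  have "5 ^ (2 * j + 3) dvd (5 :: nat) ^ (55 * (n + 1))" using j by (intro le_imp_power_dvd) simp
  then have n0: "5 ^ (2 * j + 3) dvd n0" unfolding n0_def by simp
  have a_nz: "a \<noteq> 0" using irr[of 0] by auto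
  \<comment> \<open>If 5 is not a square, \<open>e = 5\<close> works. If it is, the fifth cyclotomic
    extension is quadratic over k and generated by a square root of -(5 + q) / 2.\<close>
  obtain e :: 'k where e: "\<And>x. x^2 \<noteq> e"
    and e_loc: "\<And>v z. abs_val v \<Longrightarrow> abs_val.cauchy v z \<Longrightarrow> abs_val.null v (\<lambda>n. cyclo5 (z n)) \<Longrightarrow> abs_val.has_sqrt v e"
  proof (cases "\<exists>q :: 'k. q^2 = 5")
    case False
    then show ?thesis using that abs_val.has_sqrt_5_if_cyclo5_root by blast
  next
    case True
    then obtain q :: 'k where q: "q^2 = 5" by blast
    have "x^2 \<noteq> - (5 + q) / 2" for x
    proof
      assume x: "x^2 = - (5 + q) / 2"
      define \<alpha> where "\<alpha> = (q - 1) / 2"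
      \<comment> \<open>A root of z^2 - \<alpha> z + 1, whose discriminant is \<alpha>^2 - 4 = x^2;
        it would be a primitive fifth root of unity in k.\<close>
      define z where "z = (\<alpha> + x) / 2"
      have "2 * \<alpha> = q - 1" by (simp add: \<alpha>_def)
      then have q': "q = 2 * \<alpha> + 1" by simp
      have \<alpha>: "\<alpha>^2 + \<alpha> - 1 = 0"
      proof -
        have "4 * (\<alpha>^2 + \<alpha> - 1) = q^2 - 5" unfolding q' by Groebner_Basis.algebra
        then have "4 * (\<alpha>^2 + \<alpha> - 1) = 4 * 0" using q by (simp only: diff_self mult_zero_right)
        then show ?thesis by (rule numeral_cancel)
      qed
      have "2 * z = \<alpha> + x" by (simp add: z_def)
      then have x': "x = 2 * z - \<alpha>" by simp
      have "2 * x^2 = - (5 + q)" unfolding x by simp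
      then have "8 * (z^2 - \<alpha> * z + 1) = 2 * (\<alpha>^2 + \<alpha> - 1) * (-1) + 4 * (\<alpha>^2 + \<alpha> - 1) - 2 * (\<alpha>^2 + \<alpha> - 1)"
        unfolding x' q' using \<alpha> by Groebner_Basis.algebra
      then have "8 * (z^2 - \<alpha> * z + 1) = 8 * 0" unfolding \<alpha> by (simp only: mult_zero_left mult_zero_right add_0_right diff_0_right)
      then have "z^2 - \<alpha> * z + 1 = 0" by (rule numeral_cancel)
      then have "cyclo5 z = 0" unfolding cyclo5_def using \<alpha> by Groebner_Basis.algebra
      with \<zeta> show False by blast
    qed
    then show ?thesis using that abs_val.has_sqrt_delta_if_cyclo5_root[OF _ _ _ q] by blast
  qed
  show ?thesis
  proof (rule counterexampleI[OF e a_nz nonroot_pure[OF irr]])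
    fix v :: "'k \<Rightarrow> real" assume v: "abs_val v"
    show "abs_val.has_sqrt v e \<or> abs_val.has_quintic_root v 0 a"
      by (rule abs_val.local_solution_pure[OF v nf a[unfolded a0_def] n0 e_loc[OF v]])
  qed simp
qed

section \<open>Fields containing a primitive fifth root of unity\<close>

primrec dickson_poly :: "nat \<Rightarrow> int poly" where
  "dickson_poly 0 = [:0, 1:]"
| "dickson_poly (Suc j) = pcompose [:0, 5, 0, - 5, 0, 1:] (dickson_poly j)"

lemma dickson_poly: "degree (dickson_poly j) = 5 ^ j \<and> lead_coeff (dickson_poly j) = 1"
proof (induction j)
  case (Suc j)
  define p :: "int poly" where "p = [:0, 5, 0, - 5, 0, 1:]"
  have p: "degree p = 5" "lead_coeff p = 1" by (simp_all add: p_def)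
  have IH: "degree (dickson_poly j) = 5 ^ j" "lead_coeff (dickson_poly j) = 1" using Suc by blast+
  then have "lead_coeff (pcompose p (dickson_poly j)) = lead_coeff p * lead_coeff (dickson_poly j) ^ degree p"
    by (intro lead_coeff_comp) simp
  also have "\<dots> = 1" by (simp only: p(2) IH(2) power_one mult_1_left)
  finally have "lead_coeff (pcompose p (dickson_poly j)) = 1" .
  moreover have "degree (pcompose p (dickson_poly j)) = 5 ^ Suc j"
    by (simp only: degree_pcompose p IH power_Suc)
  ultimately show ?case by (simp only: dickson_poly.simps p_def simp_thms)
qed simp

lemma poly_dickson_poly: "poly (map_poly of_int (dickson_poly j)) b = (dickson ^^ j) (b :: 'k::field_char_0)"
proof -
  have hom: "map_poly of_int (pcompose p q) = pcompose (map_poly of_int p) (map_poly of_int q :: 'k poly)" for p q :: "int poly"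
  proof (induction p)
    case (pCons c p)
    have "map_poly of_int (q * r) = (map_poly of_int q * map_poly of_int r :: 'k poly)" for r :: "int poly"
      by (rule poly_eqI) (simp add: coeff_map_poly coeff_mult)
    moreover have "map_poly of_int ([:c:] + r) = ([:of_int c:] + map_poly of_int r :: 'k poly)" for r :: "int poly"
      by (rule poly_eqI) (simp add: coeff_map_poly coeff_pCons split: nat.split)
    ultimately show ?case using pCons by (simp add: pcompose_pCons map_poly_pCons)
  qed simp
  show ?thesis
  proof (induction j)
    case (Suc j)
    have "poly (map_poly of_int [:0, 5, 0, - 5, 0, 1:]) x = dickson x" for x :: 'k
      by (simp add: map_poly_pCons dickson_def algebra_simps eval_nat_numeral)
    then show ?case using Suc by (simp only: dickson_poly.simps hom poly_pcompose funpow.simps o_def)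
  qed (simp add: map_poly_pCons)
qed

lemma dickson_iterate_square:
  fixes x :: "'k::field_char_0"
  obtains t where "(dickson ^^ j) x ^ 2 - 4 = (x^2 - 4) * t^2"
proof -
  have "\<exists>t. (dickson ^^ j) x ^ 2 - 4 = (x^2 - 4) * t^2"
  proof (induction j)
    case (Suc j)
    then obtain t where "(dickson ^^ j) x ^ 2 - 4 = (x^2 - 4) * t^2" by blast
    then have "(dickson ^^ Suc j) x ^ 2 - 4 = (x^2 - 4) * (t * ((dickson ^^ j) x ^ 4 - 3 * (dickson ^^ j) x ^ 2 + 1))^2"
      by (simp add: dickson_square power_mult_distrib)
    then show ?case by blast
  qed (auto intro: exI[of _ 1])
  then show ?thesis using that by blast
qed

text \<open>Ensures that 3 divides 60 times the conductor exactly once, as the Eisenstein argument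
  at 3 requires.\<close>

lemma conductor_mod_3: "conductor i mod 3 = 1"
proof (induction i)
  case (Suc i)
  have "conductor (Suc i) = conductor i + 3 * (conductor i * (1200 * (conductor i)^2))"
    by (simp add: algebra_simps)
  then show ?case using Suc by (metis mod_mult_self2)
qed simp

theorem hasse_failure_dickson:
  assumes nf: "number_field TYPE('k::field_char_0)" and \<zeta>: "cyclo5 (\<zeta> :: 'k) = 0"
  shows "\<exists>F :: (4 \<Rightarrow>\<^sub>0 nat) \<Rightarrow>\<^sub>0 'k.
           cubic_form F \<and> smooth_surface F \<and>
           \<not> contains_line ring_of_type_algebra id F \<and>
           (\<forall>P\<in>places. \<forall>v\<in>P. contains_line (completion v) (to_completion v) F)"
proof -
  obtain n where n: "\<And>(p :: int) s r D (b :: 'k). prime p \<Longrightarrow> p dvd s \<Longrightarrow> \<not> p^2 dvd s \<Longrightarrow> \<not> p dvd r \<Longrightarrow>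
    lead_coeff D = 1 \<Longrightarrow> degree D > n \<Longrightarrow> of_int s * poly (map_poly of_int D) b \<noteq> of_int r"
    by (rule number_field_eisenstein[OF nf]) blast
  obtain i where i: "\<And>x :: 'k. x^2 \<noteq> of_nat (radicand i)" by (rule number_field_nonsquare_radicand[OF nf]) blast
  define Q where "Q = conductor i"
  \<comment> \<open>The starting value \<open>r / s\<close> is u + 1/u for u = (x + sqrt e) / (x -
    sqrt e), that is 2 (x^2 + e) / (x^2 - e). This makes its square minus 4 equal to e times a
    square, and x = 60 Q + 1 is chosen so that x^2 - e = 2 s.\<close>
  define e where "e = 1 + 3600 * Q^2"
  define x where "x = 60 * Q + 1"
  define s where "s = 60 * Q"
  define r where "r = x^2 + e"
  have e: "e = radicand i" by (simp add: e_def radicand_def Q_def)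
  have e_nonsq: "\<And>x :: 'k. x^2 \<noteq> of_nat e" using i e by simp
  have Q: "Q mod 3 = 1" "Q > 0" unfolding Q_def by (rule conductor_mod_3 conductor_pos)+
  define a0 where "a0 = (of_nat r / of_nat s :: 'k)"
  have s0: "(of_nat s :: 'k) \<noteq> 0" using Q by (simp add: s_def)
  have x2: "x^2 = e + 2 * s" unfolding s_def x_def e_def by (simp add: algebra_simps power2_eq_square)
  have "(x^2 + e)^2 = 4 * s^2 + e * (4 * x^2)"
    unfolding x2 by (simp add: algebra_simps power2_eq_square)
  then have "r^2 = 4 * s^2 + e * (2 * x)^2" by (simp add: r_def power_mult_distrib)
  then have "(of_nat (r^2) :: 'k) = of_nat (4 * s^2 + e * (2 * x)^2)" by (simp only:)
  then have "(of_nat r :: 'k)^2 = 4 * (of_nat s)^2 + of_nat e * (2 * of_nat x)^2" by (simp add: power_mult_distrib)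
  then have a0: "a0^2 - 4 = of_nat e * (2 * of_nat x / of_nat s)^2"
    using s0 by (simp add: a0_def field_simps)
  have "(dickson ^^ (n + 1)) b \<noteq> a0" for b :: 'k
  proof
    assume "(dickson ^^ (n + 1)) b = a0"
    define D where "D = dickson_poly (n + 1)"
    have D: "degree D = 5 ^ (n + 1)" "lead_coeff D = 1"
      unfolding D_def using dickson_poly by blast+
    have "poly (map_poly of_int D) b = a0"
      unfolding D_def poly_dickson_poly by fact
    then have "of_int (int s) * poly (map_poly of_int D) b = of_int (int r)"
      using s0 by (simp add: a0_def)
    moreover have "n < 5 ^ (n + 1)" using less_exp[of "n + 1"] power_mono[of "2 :: nat" 5 "n + 1"] by simp
    moreover have "3 dvd int s" "\<not> 9 dvd int s"
    proof -
      have "s = 6 + 9 * (20 * (Q div 3) + 6)"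
        unfolding s_def using div_mult_mod_eq[of Q 3] Q(1) by simp
      then have "s mod 9 = 6 mod 9" by (simp only: mod_mult_self2)
      then have "\<not> 9 dvd s" by (simp add: dvd_eq_mod_eq_0)
      moreover have "3 dvd s" unfolding s_def by simp
      ultimately show "3 dvd int s" "\<not> 9 dvd int s"
        using int_dvd_int_iff[of 3 s] int_dvd_int_iff[of 9 s] by simp_all
    qed
    moreover have "(3 :: int)^2 = 9" by simp
    moreover have "r = 2 + 3 * (2400 * Q^2 + 40 * Q)" unfolding r_def x_def e_def
      by (simp add: algebra_simps power2_eq_square)
    then have "r mod 3 = 2 mod 3" by (simp only: mod_mult_self2)
    then have "\<not> 3 dvd int r" using int_dvd_int_iff[of 3 r] by (simp add: dvd_eq_mod_eq_0)
    ultimately show False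
      using n[of 3 "int s" "int r" D b] D by simp
  qed
  from last_iterated_preimage[of "n + 1" dickson a0, OF this] obtain j a
    where a: "(dickson ^^ j) a = a0" and irr: "\<And>z. dickson z \<noteq> (a :: 'k)" by blast
  obtain t where t: "a0^2 - 4 = (a^2 - 4) * t^2" using dickson_iterate_square[of j a] unfolding a by blast
  have e0: "(of_nat e :: 'k) \<noteq> 0" using e_nonsq[of 0] by auto
  have "(of_nat x :: 'k) \<noteq> 0" by (simp only: of_nat_eq_0_iff) (simp add: x_def)
  then have "a0^2 - 4 \<noteq> 0" unfolding a0 using e0 s0 by simp
  then have t0: "t \<noteq> 0" using t by auto
  define b where "b = 2 * of_nat x / of_nat s / t"
  have b: "a^2 - 4 = of_nat e * b^2" "b \<noteq> 0"
    using t0 t a0 s0 \<open>(of_nat x :: 'k) \<noteq> 0\<close> by (simp_all add: b_def field_simps)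
  have a_nz: "a \<noteq> 0" using irr[of 0] by (auto simp: dickson_def)
  have q: "(2 * (\<zeta> + \<zeta>^4) + 1)^2 = 5"
  proof -
    have "(2 * (\<zeta> + \<zeta>^4) + 1)^2 - 5 = cyclo5 \<zeta> * (4 * (\<zeta>^4 - \<zeta>^3 + 2 * \<zeta> - 1))"
      unfolding cyclo5_def by Groebner_Basis.algebra
    then show ?thesis using \<zeta> by simp
  qed
  show ?thesis
  proof (rule counterexampleI[OF e_nonsq a_nz nonroot_dickson[OF _ q]])
    show "quintic 1 a x \<noteq> 0" for x using irr[of x] by (simp add: quintic_1)
    \<comment> \<open>The smoothness condition holds because its value is 1 modulo 5.\<close>
    define k where "k = 2 - 4 * int e + (int e)^2"
    have "11 - 20 * int e + 5 * (int e)^2 = 1 + 5 * k" by (simp add: k_def)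
    moreover have "1 + 5 * k \<noteq> 0" by presburger
    ultimately have "11 - 20 * int e + 5 * (int e)^2 \<noteq> 0" by simp
    then have "(of_int (11 - 20 * int e + 5 * (int e)^2) :: 'k) \<noteq> 0" by (metis of_int_eq_0_iff)
    then show "11 - 20 * 1 * of_nat e + 5 * 1\<^sup>2 * (of_nat e)\<^sup>2 \<noteq> (0 :: 'k)" by simp
  next
    fix v :: "'k \<Rightarrow> real" assume v: "abs_val v"
    have "e = 1 + 40 * (90 * Q^2)" by (simp add: e_def)
    then have "e mod 40 = 1 mod 40" by (simp only: mod_mult_self2)
    then have "e mod 40 = 1" by simp
    then show "abs_val.has_sqrt v (of_nat e) \<or> abs_val.has_quintic_root v 1 a"
      using abs_val.local_solution_dickson[OF v nf \<zeta> _ b] by blast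
  qed
qed

theorem theorem1p1:
  assumes "number_field TYPE('k::field_char_0)"
  shows "\<exists>F :: (4 \<Rightarrow>\<^sub>0 nat) \<Rightarrow>\<^sub>0 'k.
           cubic_form F \<and> smooth_surface F \<and>
           \<not> contains_line ring_of_type_algebra id F \<and>
           (\<forall>P\<in>places. \<forall>v\<in>P. contains_line (completion v) (to_completion v) F)"
  using hasse_failure_pure[OF assms] hasse_failure_dickson[OF assms] by blast

end
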